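(* Let $g$ be the accelerating Kerr-Newman-(anti-)de Sitter metric with real parameters $a,m,q,\Lambda,\alpha$ (see context) and write $c=\cos\theta$. At points where $I_1^2+I_2^2\neq0$, the invariant $$Q_2=\frac1{27}\,\frac{I_5I_6-I_7^2}{(I_1^2+I_2^2)^{5/2}}$$ of $g$ equals $$\begin{aligned} Q_2=\frac{-1}{\mathcal A}\Big(&\alpha\Big(\big(a^4m^2r+2a^2mq^2r^2+\tfrac89q^4r^3\big)\alpha^2+a^2m\big(mr-\tfrac{2q^2}{3}\big)\Big)c^3\\ &+\Big(\big(a^4m^2+2a^2mq^2r-2mq^2r^3+\tfrac{16}{9}q^4r^2\big)\alpha^2+a^2m^2\Big)c^2\\ &+\alpha\Big(a^2\alpha^2m^2r^3+2a^2mq^2+r^3m^2-2mq^2r^2+\tfrac{16}{9}q^4r\Big)c\\ &+mr^2\big(a^2m+\tfrac{2q^2r}{3}\big)\alpha^2+r^2m^2-2mq^2r+\tfrac{8q^4}{9}\Big)^2\\ \times\Big[&r^2(a^2-2mr+q^2+r^2)\alpha^2+\tfrac{\Lambda r^4}{3}+\big(\tfrac{\Lambda a^2}{3}-1\big)r^2+2mr-a^2-q^2\Big]\\ \times\;&a^2\sin^2\theta\,\Big(1-2\alpha mc+\big(\alpha^2(a^2+q^2)+\tfrac{\Lambda a^2}{3}\big)c^2\Big), \end{aligned}$$ where $$\mathcal A=(\alpha rc-1)^4\Big(\big((a^2m+q^2r)^2\alpha^2+a^2m^2\big)c^2+2q^2\alpha(a^2m-mr^2+q^2r)c+r^2m^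2\alpha^2a^2+(mr-q^2)^2\Big)^3.$$
   Context: Accelerating Kerr-Newman black hole in (anti-)de Sitter spacetime: in coordinates $(t,r,\theta,\phi)$, signature $(-,+,+,+)$, $$ds^2=\frac1{\Omega^2}\Big\{-\frac{Q}{\rho^2}\big[dt-a\sin^2\theta\,d\phi\big]^2+\frac{\rho^2}{Q}dr^2+\frac{\rho^2}{P}d\theta^2+\frac{P}{\rho^2}\sin^2\theta\big[a\,dt-(r^2+a^2)d\phi\big]^2\Big\},$$ $\Omega=1-\alpha r\cos\theta$, $\rho^2=r^2+a^2\cos^2\theta$, $P=1-2\alpha m\cos\theta+(\alpha^2(a^2+q^2)+\frac13\Lambda a^2)\cos^2\theta$, $Q=(a^2+q^2-2mr+r^2)(1-\alpha^2r^2)-\frac13\Lambda(a^2+r^2)r^2$, on the domain where the metric is regular ($\Omega>0$, $\rho^2\ne0$, $Q\neq0$, $P>0$, $\sin\theta\neq0$). With $C_{\kappa\lambda\mu\nu}$ the Weyl tensor and $C^*_{\kappa\lambda\mu\nu}=\frac12E_{\kappa\lambda\sigma\tau}C^{\sigma\tau}{}_{\mu\nu}$ its dual ($E$ the Levi-Civita pseudotensor; $Q_2$ does not depend on orientation): $I_1=C_{\kappa\lambda\mu\nu}C^{\kappa\lambda\mu\nu}$, $I_2=C^*_{\kappa\lambda\mu\nu}C^{\kappa\lambda\mu\nu}$, $k_\mu=-\nabla_\mu I_1$, $l_\mu=-\nabla_\mu I_2$, $I_5=k_\mu k^\mu$, $I_6=l_\mu l^\mu$, $I_7=k_\mu l^\mu$.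 *)

theory Defs
  imports "HOL-Analysis.Analysis"
begin

section \<open>Curvature of a four-dimensional pseudo-Riemannian metric in coordinates\<close>

text \<open>
  A metric is given by its component matrix in a coordinate chart; the coordinate indices
  are the elements 1, 2, 3, 4 of the type 4. Tensors at a point are functions of their indices.
\<close>

type_synonym metric_field = "real^4 \<Rightarrow> real^4^4"

definition partial_deriv :: "4 \<Rightarrow> (real^4 \<Rightarrow> real) \<Rightarrow> real^4 \<Rightarrow> real" where
  "partial_deriv i f x = deriv (\<lambda>s. f (x + s *\<^sub>R axis i 1)) 0"

definition inv_metric :: "metric_field \<Rightarrow> real^4 \<Rightarrow> 4 \<Rightarrow> 4 \<Rightarrow> real" where
  "inv_metric g x i j = matrix_inv (g x) $ i $ j"

text \<open>\<open>christoffel g x i j k\<close> is $\Gamma^i{}_{jk}$.\<close>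

definition christoffel :: "metric_field \<Rightarrow> real^4 \<Rightarrow> 4 \<Rightarrow> 4 \<Rightarrow> 4 \<Rightarrow> real" where
  "christoffel g x i j k =
     1/2 * (\<Sum>l\<in>UNIV. inv_metric g x i l *
       (partial_deriv j (\<lambda>y. g y $ l $ k) x + partial_deriv k (\<lambda>y. g y $ l $ j) x
        - partial_deriv l (\<lambda>y. g y $ j $ k) x))"

text \<open>
  \<open>riemann_mixed g x i j k l\<close> is
  $R^i{}_{jkl} = \partial_k \Gamma^i{}_{jl} - \partial_l \Gamma^i{}_{jk}
    + \Gamma^i{}_{kn}\Gamma^n{}_{jl} - \Gamma^i{}_{ln}\Gamma^n{}_{jk}$,
  and the Ricci tensor is the contraction $R_{jl} = R^n{}_{jnl}$. The opposite sign convention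
  for the Riemann tensor only changes the sign of the Weyl tensor, in which the scalar
  invariants below are quadratic.
\<close>

definition riemann_mixed :: "metric_field \<Rightarrow> real^4 \<Rightarrow> 4 \<Rightarrow> 4 \<Rightarrow> 4 \<Rightarrow> 4 \<Rightarrow> real" where
  "riemann_mixed g x i j k l =
     partial_deriv k (\<lambda>y. christoffel g y i j l) x
     - partial_deriv l (\<lambda>y. christoffel g y i j k) x
     + (\<Sum>n\<in>UNIV. christoffel g x i k n * christoffel g x n j l
                 - christoffel g x i l n * christoffel g x n j k)"

definition riemann :: "metric_field \<Rightarrow> real^4 \<Rightarrow> 4 \<Rightarrow> 4 \<Rightarrow> 4 \<Rightarrow> 4 \<Rightarrow> real" where
  "riemann g x i j k l = (\<Sum>n\<in>UNIV. g x $ i $ n * riemann_mixed g x n j k l)"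

definition ricci :: "metric_field \<Rightarrow> real^4 \<Rightarrow> 4 \<Rightarrow> 4 \<Rightarrow> real" where
  "ricci g x j l = (\<Sum>n\<in>UNIV. riemann_mixed g x n j n l)"

definition scalar_curvature :: "metric_field \<Rightarrow> real^4 \<Rightarrow> real" where
  "scalar_curvature g x = (\<Sum>i\<in>UNIV. \<Sum>j\<in>UNIV. inv_metric g x i j * ricci g x i j)"

definition weyl :: "metric_field \<Rightarrow> real^4 \<Rightarrow> 4 \<Rightarrow> 4 \<Rightarrow> 4 \<Rightarrow> 4 \<Rightarrow> real" where
  "weyl g x i j k l =
     riemann g x i j k l
     - 1/2 * (g x $ i $ k * ricci g x j l - g x $ i $ l * ricci g x j k
              - g x $ j $ k * ricci g x i l + g x $ j $ l * ricci g x i k)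
     + scalar_curvature g x / 6 * (g x $ i $ k * g x $ j $ l - g x $ i $ l * g x $ j $ k)"

text \<open>The Weyl tensor with the first two indices raised, $C^{ij}{}_{kl}$, and with all raised.\<close>

definition weyl_mixed :: "metric_field \<Rightarrow> real^4 \<Rightarrow> 4 \<Rightarrow> 4 \<Rightarrow> 4 \<Rightarrow> 4 \<Rightarrow> real" where
  "weyl_mixed g x i j k l =
     (\<Sum>p\<in>UNIV. \<Sum>q\<in>UNIV. inv_metric g x i p * inv_metric g x j q * weyl g x p q k l)"

definition weyl_up :: "metric_field \<Rightarrow> real^4 \<Rightarrow> 4 \<Rightarrow> 4 \<Rightarrow> 4 \<Rightarrow> 4 \<Rightarrow> real" where
  "weyl_up g x i j k l =
     (\<Sum>p\<in>UNIV. \<Sum>q\<in>UNIV. inv_metric g x k p * inv_metric g x l q * weyl_mixed g x i j p q)"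

definition levi_civita_symbol :: "4 \<Rightarrow> 4 \<Rightarrow> 4 \<Rightarrow> 4 \<Rightarrow> real" where
  "levi_civita_symbol i j k l =
     (let p = (\<lambda>n::4. (vector [i, j, k, l] :: 4^4) $ n)
      in if bij p then of_int (sign p) else 0)"

text \<open>
  The Levi-Civita pseudotensor; \<open>\<epsilon>\<close> is 1 or -1 and selects the orientation for which
  the coordinate frame is positively or negatively oriented.
\<close>

definition levi_civita :: "real \<Rightarrow> metric_field \<Rightarrow> real^4 \<Rightarrow> 4 \<Rightarrow> 4 \<Rightarrow> 4 \<Rightarrow> 4 \<Rightarrow> real" where
  "levi_civita \<epsilon> g x i j k l = \<epsilon> * sqrt \<bar>det (g x)\<bar> * levi_civita_symbol i j k l"

definition dual_weyl :: "real \<Rightarrow> metric_field \<Rightarrow> real^4 \<Rightarrow> 4 \<Rightarrow> 4 \<Rightarrow> 4 \<Rightarrow> 4 \<Rightarrow> real" where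
  "dual_weyl \<epsilon> g x i j k l =
     1/2 * (\<Sum>s\<in>UNIV. \<Sum>t\<in>UNIV. levi_civita \<epsilon> g x i j s t * weyl_mixed g x s t k l)"

definition I1 :: "metric_field \<Rightarrow> real^4 \<Rightarrow> real" where
  "I1 g x = (\<Sum>i\<in>UNIV. \<Sum>j\<in>UNIV. \<Sum>k\<in>UNIV. \<Sum>l\<in>UNIV. weyl g x i j k l * weyl_up g x i j k l)"

definition I2 :: "real \<Rightarrow> metric_field \<Rightarrow> real^4 \<Rightarrow> real" where
  "I2 \<epsilon> g x =
     (\<Sum>i\<in>UNIV. \<Sum>j\<in>UNIV. \<Sum>k\<in>UNIV. \<Sum>l\<in>UNIV. dual_weyl \<epsilon> g x i j k l * weyl_up g x i j k l)"

definition k_covector :: "metric_field \<Rightarrow> real^4 \<Rightarrow> 4 \<Rightarrow> real" where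
  "k_covector g x i = - partial_deriv i (I1 g) x"

definition l_covector :: "real \<Rightarrow> metric_field \<Rightarrow> real^4 \<Rightarrow> 4 \<Rightarrow> real" where
  "l_covector \<epsilon> g x i = - partial_deriv i (I2 \<epsilon> g) x"

definition covector_inner :: "metric_field \<Rightarrow> real^4 \<Rightarrow> (4 \<Rightarrow> real) \<Rightarrow> (4 \<Rightarrow> real) \<Rightarrow> real" where
  "covector_inner g x u v = (\<Sum>i\<in>UNIV. \<Sum>j\<in>UNIV. inv_metric g x i j * u i * v j)"

definition I5 :: "metric_field \<Rightarrow> real^4 \<Rightarrow> real" where
  "I5 g x = covector_inner g x (k_covector g x) (k_covector g x)"

definition I6 :: "real \<Rightarrow> metric_field \<Rightarrow> real^4 \<Rightarrow> real" where
  "I6 \<epsilon> g x = covector_inner g x (l_covector \<epsilon> g x) (l_covector \<epsilon> g x)"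

definition I7 :: "real \<Rightarrow> metric_field \<Rightarrow> real^4 \<Rightarrow> real" where
  "I7 \<epsilon> g x = covector_inner g x (k_covector g x) (l_covector \<epsilon> g x)"

definition Q2 :: "real \<Rightarrow> metric_field \<Rightarrow> real^4 \<Rightarrow> real" where
  "Q2 \<epsilon> g x =
     1/27 * ((I5 g x * I6 \<epsilon> g x - (I7 \<epsilon> g x)\<^sup>2) / ((I1 g x)\<^sup>2 + (I2 \<epsilon> g x)\<^sup>2) powr (5/2))"

section \<open>The accelerating Kerr-Newman-(anti-)de Sitter metric\<close>

definition conf_factor :: "real \<Rightarrow> real \<Rightarrow> real \<Rightarrow> real" where
  "conf_factor \<alpha> r \<theta> = 1 - \<alpha> * r * cos \<theta>"

definition rho_sq :: "real \<Rightarrow> real \<Rightarrow> real \<Rightarrow> real" where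
  "rho_sq a r \<theta> = r\<^sup>2 + a\<^sup>2 * (cos \<theta>)\<^sup>2"

definition P_fun :: "real \<Rightarrow> real \<Rightarrow> real \<Rightarrow> real \<Rightarrow> real \<Rightarrow> real \<Rightarrow> real" where
  "P_fun a m q \<Lambda> \<alpha> \<theta> =
     1 - 2 * \<alpha> * m * cos \<theta> + (\<alpha>\<^sup>2 * (a\<^sup>2 + q\<^sup>2) + 1/3 * \<Lambda> * a\<^sup>2) * (cos \<theta>)\<^sup>2"

definition Q_fun :: "real \<Rightarrow> real \<Rightarrow> real \<Rightarrow> real \<Rightarrow> real \<Rightarrow> real \<Rightarrow> real" where
  "Q_fun a m q \<Lambda> \<alpha> r =
     (a\<^sup>2 + q\<^sup>2 - 2 * m * r + r\<^sup>2) * (1 - \<alpha>\<^sup>2 * r\<^sup>2) - 1/3 * \<Lambda> * (a\<^sup>2 + r\<^sup>2) * r\<^sup>2"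

definition tensor_square :: "real^4 \<Rightarrow> real^4^4" where
  "tensor_square w = (\<chi> i j. w $ i * w $ j)"

text \<open>
  The coordinates are ordered as $(t, r, \theta, \phi)$, so \<open>axis 1 1\<close>, \ldots, \<open>axis 4 1\<close> are the
  components of $dt$, $dr$, $d\theta$, $d\phi$.
\<close>

definition accel_KN_metric :: "real \<Rightarrow> real \<Rightarrow> real \<Rightarrow> real \<Rightarrow> real \<Rightarrow> metric_field" where
  "accel_KN_metric a m q \<Lambda> \<alpha> x =
     (let r = x $ 2; \<theta> = x $ 3;
          dt = axis 1 1; dr = axis 2 1; d\<theta> = axis 3 1; d\<phi> = axis 4 1;
          \<Omega> = conf_factor \<alpha> r \<theta>; \<rho>2 = rho_sq a r \<theta>;
          P = P_fun a m q \<Lambda> \<alpha> \<theta>; Q = Q_fun a m q \<Lambda> \<alpha> r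
      in (1 / \<Omega>\<^sup>2) *\<^sub>R
           (- (Q / \<rho>2) *\<^sub>R tensor_square (dt - (a * (sin \<theta>)\<^sup>2) *\<^sub>R d\<phi>)
            + (\<rho>2 / Q) *\<^sub>R tensor_square dr
            + (\<rho>2 / P) *\<^sub>R tensor_square d\<theta>
            + (P / \<rho>2 * (sin \<theta>)\<^sup>2) *\<^sub>R tensor_square (a *\<^sub>R dt - (r\<^sup>2 + a\<^sup>2) *\<^sub>R d\<phi>)))"

end

theory Submission
  imports Defs
begin

text \<open>
  With $c = \cos\theta$ the metric is conformal to Carter's form with $Q$ a function of $r$ and
  $Y = P\sin^2\theta$ a function of $c$, and in the adapted frame its Weyl tensor is of type D,
  described by one complex function $W = X + iZ$ which is linear in $Q$, $Y$ and their first two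
  derivatives. Then $I_1 = 12\,\mathrm{Re}\,W^2$ and $I_2 = \pm 12\,\mathrm{Im}\,W^2$. Only
  the $r$- and $\theta$-components of the gradients survive, so the Gram determinant
  $I_5I_6-I_7^2$ is $g^{rr}g^{\theta\theta}$ times the squared Jacobian of $(I_1,I_2)$, i.e. a
  multiple of $|W|^4\,(\mathrm{Im}(\overline{W_r}\,W_\theta))^2$, while
  $I_1^2+I_2^2 = 144|W|^4$. The closed form of $W$ makes $\mathrm{Im}(\overline{W_r}W_c)$ equal
  to $36\,a\,\Omega^5(r^2+a^2c^2)^{-5}$ times the polynomial squared in the theorem.
\<close>

section \<open>The Levi-Civita symbol\<close>

text \<open>The obstacle is size: unfolding the coordinate definitions for this metric would produce
  unmanageable rational functions. Hence the curvature is first computed for an abstract frame, then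
  for symbols whose derivatives are again polynomials in the symbols, and nothing is differentiated
  further until \<open>W\<close> has a closed form. Working over the complex numbers is what makes
  this form and its derivatives factor.

  The constants arise as follows. The derivatives of 12 W^2 are 24 W W_r and 24 W W_c, so the
  Jacobian carries 24^2 |W|^2, while the power 5/2 of 144 |W|^4 is 12^5 |W|^10. This leaves (1/27)
  24^4 / 12^5 = 4/81 in front of g^rr g^cc Im(conj W_r W_c)^2 / |W|^6. With R = r^2 + a^2 c^2, |W|^2
  is 4 Omega^6 / R^4 times the polynomial that is cubed in the theorem, and g^rr g^cc = Q Y Omega^4
  / R^2. Then (4/81) 36^2 / 4^3 = 1, all powers of R cancel, and Omega^(10 + 4 - 18) is the fourth
  power in the denominator. The cosmological constant cancels in \<open>W\<close>, so it enters only
  through Q and Y.\<close>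

lemma vector_4 [simp]:
  fixes w :: "'a::zero"
  shows "(vector [w, x, y, z] :: 'a^4) $ 1 = w"
    "(vector [w, x, y, z] :: 'a^4) $ 2 = x"
    "(vector [w, x, y, z] :: 'a^4) $ 3 = y"
    "(vector [w, x, y, z] :: 'a^4) $ 4 = z"
  unfolding vector_def by simp_all

lemma prod_4: "prod f (UNIV :: 4 set) = f 1 * f 2 * f 3 * f 4"
  unfolding UNIV_4 by (simp add: ac_simps)

lemma vector_4_eta: "(\<lambda>n. (vector [p 1, p 2, p 3, p 4] :: 'a::zero^4) $ n) = p"
proof
  fix n :: 4
  show "(vector [p 1, p 2, p 3, p 4] :: 'a::zero^4) $ n = p n"
    using exhaust_4[of n] by auto
qed

text \<open>Reading the four indices as the values of a map \<open>p\<close> on the index type makes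
  general facts on \<open>sign\<close> and \<open>bij\<close> applicable to the symbol.\<close>

lemma levi_civita_symbol_fun:
  "levi_civita_symbol (p 1) (p 2) (p 3) (p 4) = (if bij p then of_int (sign p) else 0)"
  unfolding levi_civita_symbol_def Let_def vector_4_eta ..

text \<open>Leibniz formula: index quadruples correspond to self-maps of the index type, and those
  that are not permutations contribute 0.\<close>

lemma levi_civita_symbol_contract_rows:
  fixes e :: "4 \<Rightarrow> 4 \<Rightarrow> real"
  shows "(\<Sum>i\<in>UNIV. \<Sum>j\<in>UNIV. \<Sum>k\<in>UNIV. \<Sum>l\<in>UNIV.
           levi_civita_symbol i j k l * (e (f 1) i * e (f 2) j * e (f 3) k * e (f 4) l))
         = det (\<chi> n i. e (f n) i)"
proof -
  let ?F = "\<lambda>p. levi_civita_symbol (p 1) (p 2) (p 3) (p 4) *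
              (e (f 1) (p 1) * e (f 2) (p 2) * e (f 3) (p 3) * e (f 4) (p 4))"
  have "(\<Sum>i\<in>UNIV. \<Sum>j\<in>UNIV. \<Sum>k\<in>UNIV. \<Sum>l\<in>UNIV.
           levi_civita_symbol i j k l * (e (f 1) i * e (f 2) j * e (f 3) k * e (f 4) l))
        = (\<Sum>(i,j,k,l)\<in>UNIV.
           levi_civita_symbol i j k l * (e (f 1) i * e (f 2) j * e (f 3) k * e (f 4) l))"
    by (simp add: sum.cartesian_product)
  also have "\<dots> = sum ?F (UNIV :: (4 \<Rightarrow> 4) set)"
    by (rule sum.reindex_bij_witness[where i = "\<lambda>p. (p 1, p 2, p 3, p 4)"
          and j = "\<lambda>(i,j,k,l) n. (vector [i,j,k,l] :: 4^4) $ n"])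
       (auto simp: vector_4_eta)
  also have "\<dots> = sum ?F {p. p permutes UNIV}"
    by (rule sum.mono_neutral_right)
       (auto simp: levi_civita_symbol_fun permutes_altdef)
  also have "\<dots> = det (\<chi> n i. e (f n) i)"
    unfolding det_def
    by (rule sum.cong) (auto simp: levi_civita_symbol_fun permutes_bij prod_4)
  finally show ?thesis .
qed

text \<open>Transformation law of the symbol: selecting rows by a permutation multiplies the
  determinant by its sign, and a repeated selection gives two equal rows. It carries the dual from
  coordinate to frame components.\<close>

lemma levi_civita_symbol_frame:
  fixes e :: "4 \<Rightarrow> 4 \<Rightarrow> real"
  shows "(\<Sum>i\<in>UNIV. \<Sum>j\<in>UNIV. \<Sum>k\<in>UNIV. \<Sum>l\<in>UNIV.
           levi_civita_symbol i j k l * (e A i * e B j * e C k * e D l))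
         = det (\<chi> n i. e n i) * levi_civita_symbol A B C D"
proof -
  define f where "f = (\<lambda>n. (vector [A, B, C, D] :: 4^4) $ n)"
  have f: "f 1 = A" "f 2 = B" "f 3 = C" "f 4 = D" by (simp_all add: f_def)
  have "det (\<chi> n i. e (f n) i) = det (\<chi> n i. e n i) * levi_civita_symbol (f 1) (f 2) (f 3) (f 4)"
  proof (cases "bij f")
    case True
    have "det (\<chi> n. (\<chi> m i. e m i) $ f n :: real^4^4) = of_int (sign f) * det (\<chi> n i. e n i)"
      by (rule det_permute_rows) (simp add: True permutes_altdef)
    then show ?thesis by (simp add: levi_civita_symbol_fun True vec_lambda_eta)
  next
    case False
    then have "\<not> inj f" by (metis bij_def finite finite_UNIV_inj_surj)
    then obtain i j where "i \<noteq> j" "f i = f j" by (auto simp: inj_on_def)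
    then have "det (\<chi> n i. e (f n) i) = 0"
      by (intro det_identical_rows[of i j]) (auto simp: row_def)
    then show ?thesis by (simp add: levi_civita_symbol_fun False)
  qed
  then show ?thesis
    using levi_civita_symbol_contract_rows[of e f] by (simp add: f)
qed

lemma levi_civita_symbol_1234: "levi_civita_symbol 1 2 3 4 = 1"
  using levi_civita_symbol_fun[of id] by (simp add: sign_id)

text \<open>Precomposing with a transposition exchanges two slots of the symbol. If \<open>p\<close>
  is not bijective, neither is the composite, and both sides are 0.\<close>

lemma levi_civita_symbol_transpose:
  fixes p :: "4 \<Rightarrow> 4"
  assumes "a \<noteq> b"
  shows "levi_civita_symbol (p (Transposition.transpose a b 1)) (p (Transposition.transpose a b 2))
     (p (Transposition.transpose a b 3)) (p (Transposition.transpose a b 4))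
   = - levi_civita_symbol (p 1) (p 2) (p 3) (p 4)"
proof -
  let ?t = "Transposition.transpose a b"
  have "bij (p \<circ> ?t) \<longleftrightarrow> bij p"
    by (metis bij_comp bij_transpose comp_assoc comp_id transpose_comp_involutory)
  moreover have "bij p \<Longrightarrow> sign (p \<circ> ?t) = - sign p"
    using assms by (subst sign_compose)
      (auto simp: sign_swap_id permutation_swap_id permutation intro: bij_betw_finite)
  ultimately show ?thesis
    using levi_civita_symbol_fun[of "p \<circ> ?t"] by (simp add: levi_civita_symbol_fun)
qed

lemma levi_civita_symbol_swap:
  "levi_civita_symbol j i k l = - levi_civita_symbol i j k l"
  "levi_civita_symbol i k j l = - levi_civita_symbol i j k l"
  "levi_civita_symbol i j l k = - levi_civita_symbol i j k l"
  using levi_civita_symbol_transpose[of 1 2 "\<lambda>n. (vector [i, j, k, l] :: 4^4) $ n"]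
    levi_civita_symbol_transpose[of 2 3 "\<lambda>n. (vector [i, j, k, l] :: 4^4) $ n"]
    levi_civita_symbol_transpose[of 3 4 "\<lambda>n. (vector [i, j, k, l] :: 4^4) $ n"]
  by (simp_all add: Transposition.transpose_def)

lemma levi_civita_symbol_repeat:
  "levi_civita_symbol i i k l = 0" "levi_civita_symbol i k i l = 0"
  "levi_civita_symbol i k l i = 0" "levi_civita_symbol k i i l = 0"
  "levi_civita_symbol k i l i = 0" "levi_civita_symbol k l i i = 0"
  using levi_civita_symbol_swap(1)[of i i k l] levi_civita_symbol_swap(2)[of k i i l]
    levi_civita_symbol_swap(3)[of k l i i] levi_civita_symbol_swap(2)[of i i k l]
    levi_civita_symbol_swap(3)[of k i i l] levi_civita_symbol_swap(3)[of i k i l]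
    levi_civita_symbol_swap(2)[of i k i l] by simp_all

text \<open>The values are listed for rewriting; each is one adjacent swap away from a value
  obtained before it.\<close>

lemma levi_civita_symbol_values:
  "levi_civita_symbol 1 2 3 4 = 1" "levi_civita_symbol 1 2 4 3 = -1"
  "levi_civita_symbol 1 3 2 4 = -1" "levi_civita_symbol 1 3 4 2 = 1"
  "levi_civita_symbol 1 4 2 3 = 1" "levi_civita_symbol 1 4 3 2 = -1"
  "levi_civita_symbol 2 1 3 4 = -1" "levi_civita_symbol 2 1 4 3 = 1"
  "levi_civita_symbol 2 3 1 4 = 1" "levi_civita_symbol 2 3 4 1 = -1"
  "levi_civita_symbol 2 4 1 3 = -1" "levi_civita_symbol 2 4 3 1 = 1"
  "levi_civita_symbol 3 1 2 4 = 1" "levi_civita_symbol 3 1 4 2 = -1"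
  "levi_civita_symbol 3 2 1 4 = -1" "levi_civita_symbol 3 2 4 1 = 1"
  "levi_civita_symbol 3 4 1 2 = 1" "levi_civita_symbol 3 4 2 1 = -1"
  "levi_civita_symbol 4 1 2 3 = -1" "levi_civita_symbol 4 1 3 2 = 1"
  "levi_civita_symbol 4 2 1 3 = 1" "levi_civita_symbol 4 2 3 1 = -1"
  "levi_civita_symbol 4 3 1 2 = -1" "levi_civita_symbol 4 3 2 1 = 1"
proof -
  note s = levi_civita_symbol_swap
  show v1234: "levi_civita_symbol 1 2 3 4 = 1" by (rule levi_civita_symbol_1234)
  show v1243: "levi_civita_symbol 1 2 4 3 = -1" using s(3)[of 1 2 3 4] v1234 by simp
  show v1324: "levi_civita_symbol 1 3 2 4 = -1" using s(2)[of 1 2 3 4] v1234 by simp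
  show v1342: "levi_civita_symbol 1 3 4 2 = 1" using s(3)[of 1 3 2 4] v1324 by simp
  show v1423: "levi_civita_symbol 1 4 2 3 = 1" using s(2)[of 1 2 4 3] v1243 by simp
  show v1432: "levi_civita_symbol 1 4 3 2 = -1" using s(3)[of 1 4 2 3] v1423 by simp
  show v2134: "levi_civita_symbol 2 1 3 4 = -1" using s(1)[of 1 2 3 4] v1234 by simp
  show v2143: "levi_civita_symbol 2 1 4 3 = 1" using s(1)[of 1 2 4 3] v1243 by simp
  show v3124: "levi_civita_symbol 3 1 2 4 = 1" using s(1)[of 1 3 2 4] v1324 by simp
  show v3142: "levi_civita_symbol 3 1 4 2 = -1" using s(1)[of 1 3 4 2] v1342 by simp
  show v4123: "levi_civita_symbol 4 1 2 3 = -1" using s(1)[of 1 4 2 3] v1423 by simp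
  show v4132: "levi_civita_symbol 4 1 3 2 = 1" using s(1)[of 1 4 3 2] v1432 by simp
  show v2314: "levi_civita_symbol 2 3 1 4 = 1" using s(2)[of 2 1 3 4] v2134 by simp
  show v2341: "levi_civita_symbol 2 3 4 1 = -1" using s(3)[of 2 3 1 4] v2314 by simp
  show v2413: "levi_civita_symbol 2 4 1 3 = -1" using s(2)[of 2 1 4 3] v2143 by simp
  show v2431: "levi_civita_symbol 2 4 3 1 = 1" using s(3)[of 2 4 1 3] v2413 by simp
  show v3214: "levi_civita_symbol 3 2 1 4 = -1" using s(1)[of 2 3 1 4] v2314 by simp
  show v3241: "levi_civita_symbol 3 2 4 1 = 1" using s(1)[of 2 3 4 1] v2341 by simp
  show v3412: "levi_civita_symbol 3 4 1 2 = 1" using s(2)[of 3 1 4 2] v3142 by simp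
  show v3421: "levi_civita_symbol 3 4 2 1 = -1" using s(3)[of 3 4 1 2] v3412 by simp
  show v4213: "levi_civita_symbol 4 2 1 3 = 1" using s(1)[of 2 4 1 3] v2413 by simp
  show v4231: "levi_civita_symbol 4 2 3 1 = -1" using s(1)[of 2 4 3 1] v2431 by simp
  show v4312: "levi_civita_symbol 4 3 1 2 = -1" using s(1)[of 3 4 1 2] v3412 by simp
  show v4321: "levi_civita_symbol 4 3 2 1 = 1" using s(1)[of 3 4 2 1] v3421 by simp
qed

section \<open>Curvature in a moving frame\<close>

text \<open>A relation, because \<open>deriv\<close> has some value even where no derivative exists:
  differentiability must travel together with the value.\<close>

definition has_partial_deriv :: "(real^4 \<Rightarrow> real) \<Rightarrow> real \<Rightarrow> 4 \<Rightarrow> real^4 \<Rightarrow> bool" where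
  "has_partial_deriv f D i x \<longleftrightarrow> ((\<lambda>s. f (x + s *\<^sub>R axis i 1)) has_real_derivative D) (at 0)"

lemma has_partial_deriv_imp: "has_partial_deriv f D i x \<Longrightarrow> partial_deriv i f x = D"
  unfolding has_partial_deriv_def partial_deriv_def by (rule DERIV_imp_deriv)

lemma has_partial_deriv_unique:
  "has_partial_deriv f D i x \<Longrightarrow> has_partial_deriv f D' i x \<Longrightarrow> D = D'"
  using has_partial_deriv_imp by metis

lemma has_partial_deriv_add:
  "has_partial_deriv f D i x \<Longrightarrow> has_partial_deriv g E i x \<Longrightarrow>
   has_partial_deriv (\<lambda>y. f y + g y) (D + E) i x"
  unfolding has_partial_deriv_def by (rule DERIV_add)

lemma has_partial_deriv_mult:
  "has_partial_deriv f D i x \<Longrightarrow> has_partial_deriv g E i x \<Longrightarrow>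
   has_partial_deriv (\<lambda>y. f y * g y) (D * g x + f x * E) i x"
  unfolding has_partial_deriv_def by (auto intro!: derivative_eq_intros)

lemma has_partial_deriv_sum:
  "(\<And>A. A \<in> I \<Longrightarrow> has_partial_deriv (f A) (D A) i x) \<Longrightarrow>
   has_partial_deriv (\<lambda>y. \<Sum>A\<in>I. f A y) (\<Sum>A\<in>I. D A) i x"
  unfolding has_partial_deriv_def by (rule DERIV_sum)

text \<open>A coordinate line through \<open>x\<close> stays in the open set \<open>S\<close> for
  small parameters, so formulas valid only on \<open>S\<close> can be differentiated.\<close>

lemma has_partial_deriv_cong:
  assumes "has_partial_deriv f D i x" "open S" "x \<in> S" "\<And>y. y \<in> S \<Longrightarrow> f y = h y"
  shows "has_partial_deriv h D i x"
proof -
  let ?p = "\<lambda>s. x + s *\<^sub>R axis i 1 :: real^4"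
  have o: "open (?p -` S)"
    by (rule open_vimage[OF \<open>open S\<close>]) (intro continuous_intros)
  have "((\<lambda>s. f (?p s)) has_real_derivative D) (at 0)"
    using assms(1) by (simp add: has_partial_deriv_def)
  then have "((\<lambda>s. h (?p s)) has_real_derivative D) (at 0)"
    by (rule has_field_derivative_transform_within_open[OF _ o]) (use assms(3,4) in auto)
  then show ?thesis by (simp add: has_partial_deriv_def)
qed

lemma matrix_inv_unique:
  fixes A :: "'a::semiring_1^'n^'n"
  assumes "A ** B = mat 1" "B ** A = mat 1"
  shows "matrix_inv A = B"
proof -
  have "A ** B = mat 1 \<and> B ** A = mat 1" using assms by blast
  then have "A ** matrix_inv A = mat 1 \<and> matrix_inv A ** A = mat 1"
    unfolding matrix_inv_def by (rule someI)
  then have "matrix_inv A = matrix_inv A ** (A ** B)" "matrix_inv A ** A = mat 1"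
    using assms by simp_all
  then show ?thesis
    by (simp add: matrix_mul_assoc)
qed

lemma sum_delta_mult:
  "(\<Sum>A\<in>UNIV. (if A = B then c A else 0) * f A) = c B * (f B :: real)"
  "(\<Sum>A\<in>UNIV. (if B = A then c A else 0) * f A) = c B * (f B :: real)"
  "(\<Sum>A\<in>UNIV. f A * (if A = B then c A else 0)) = f B * (c B :: real)"
  "(\<Sum>A\<in>UNIV. f A * (if B = A then c A else 0)) = f B * (c B :: real)"
  for B :: "'n::finite"
  by (simp_all add: if_distrib[of "\<lambda>u. u * _"] if_distrib[of "\<lambda>u. _ * u"] cong: if_cong)

text \<open>Cartan's second structure equation evaluated on the frame vectors C and D. The last sum
  is the connection form applied to their commutator, which for zero torsion has components
  \<open>M C K D - M D K C\<close>.\<close>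

definition frame_curvature :: "(4 \<Rightarrow> 4 \<Rightarrow> 4 \<Rightarrow> real) \<Rightarrow> (4 \<Rightarrow> 4 \<Rightarrow> 4 \<Rightarrow> 4 \<Rightarrow> real) \<Rightarrow> 4 \<Rightarrow> 4 \<Rightarrow> 4 \<Rightarrow> 4 \<Rightarrow> real" where
  "frame_curvature M dM A B C D =
     dM C D A B - dM D C A B
     + (\<Sum>K\<in>UNIV. M C A K * M D K B - M D A K * M C K B)
     - (\<Sum>K\<in>UNIV. (M C K D - M D K C) * M K A B)"

text \<open>
  In \<open>moving_frame\<close>, \<open>th x A i\<close> and \<open>e x A i\<close> are the components of an orthogonal coframe
  and its dual frame, \<open>dth x k A i\<close> is $\partial_k \theta^A{}_i$, \<open>G x A\<close> is the squared length
  of the frame vector $E_A$, and \<open>M x C A B\<close> is $\omega^A{}_B(E_C)$ for the connection forms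
  $\omega$. The first index of \<open>dG\<close> and \<open>dM\<close> is the frame direction of differentiation. No
  normalisation is imposed, so that no square roots of metric functions appear.
\<close>

locale moving_frame =
  fixes g :: metric_field and S :: "(real^4) set"
    and e th :: "real^4 \<Rightarrow> 4 \<Rightarrow> 4 \<Rightarrow> real"
    and dth :: "real^4 \<Rightarrow> 4 \<Rightarrow> 4 \<Rightarrow> 4 \<Rightarrow> real"
    and ddth :: "real^4 \<Rightarrow> 4 \<Rightarrow> 4 \<Rightarrow> 4 \<Rightarrow> 4 \<Rightarrow> real"
    and G :: "real^4 \<Rightarrow> 4 \<Rightarrow> real"
    and dG :: "real^4 \<Rightarrow> 4 \<Rightarrow> 4 \<Rightarrow> real"
    and M :: "real^4 \<Rightarrow> 4 \<Rightarrow> 4 \<Rightarrow> 4 \<Rightarrow> real"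
    and dM :: "real^4 \<Rightarrow> 4 \<Rightarrow> 4 \<Rightarrow> 4 \<Rightarrow> 4 \<Rightarrow> real"
  assumes open_S: "open S"
    and e_th: "x \<in> S \<Longrightarrow> (\<Sum>A\<in>UNIV. e x A i * th x A j) = (if i = j then 1 else 0)"
    and th_e: "x \<in> S \<Longrightarrow> (\<Sum>i\<in>UNIV. th x A i * e x B i) = (if A = B then 1 else 0)"
    and metric: "x \<in> S \<Longrightarrow> g x $ i $ j = (\<Sum>A\<in>UNIV. G x A * (th x A i * th x A j))"
    and G_nonzero: "x \<in> S \<Longrightarrow> G x A \<noteq> 0"
    and e_differentiable: "x \<in> S \<Longrightarrow> \<exists>d. has_partial_deriv (\<lambda>y. e y A i) d k x"
    and th_deriv: "x \<in> S \<Longrightarrow> has_partial_deriv (\<lambda>y. th y A i) (dth x k A i) k x"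
    and dth_deriv: "x \<in> S \<Longrightarrow> has_partial_deriv (\<lambda>y. dth y k A i) (ddth x l k A i) l x"
    and ddth_sym: "x \<in> S \<Longrightarrow> ddth x l k A i = ddth x k l A i"
    and G_deriv: "x \<in> S \<Longrightarrow>
          has_partial_deriv (\<lambda>y. G y A) (\<Sum>C\<in>UNIV. th x C k * dG x C A) k x"
    and M_deriv: "x \<in> S \<Longrightarrow>
          has_partial_deriv (\<lambda>y. M y C A B) (\<Sum>D\<in>UNIV. th x D k * dM x D C A B) k x"
    and compatible: "x \<in> S \<Longrightarrow>
          G x A * M x C A B + G x B * M x C B A = (if A = B then dG x C A else 0)"
    and torsion_free: "x \<in> S \<Longrightarrow>
          dth x k A j - dth x j A k
            = (\<Sum>C\<in>UNIV. \<Sum>B\<in>UNIV. (M x B A C - M x C A B) * (th x C k * th x B j))"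
begin

definition conn :: "real^4 \<Rightarrow> 4 \<Rightarrow> 4 \<Rightarrow> 4 \<Rightarrow> real" where
  "conn x k A B = (\<Sum>C\<in>UNIV. th x C k * M x C A B)"

definition dconn :: "real^4 \<Rightarrow> 4 \<Rightarrow> 4 \<Rightarrow> 4 \<Rightarrow> 4 \<Rightarrow> real" where
  "dconn x l k A B = (\<Sum>C\<in>UNIV. dth x l C k * M x C A B
                       + th x C k * (\<Sum>D\<in>UNIV. th x D l * dM x D C A B))"

text \<open>By the tetrad postulate this should be the Christoffel symbol with its upper index
  contracted with the coframe. \<open>Gam\<close> solves that relation, and
  \<open>christoffel_eq\<close> confirms it.\<close>

definition frame_grad :: "real^4 \<Rightarrow> 4 \<Rightarrow> 4 \<Rightarrow> 4 \<Rightarrow> real" where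
  "frame_grad x A k j = dth x k A j + (\<Sum>B\<in>UNIV. conn x k A B * th x B j)"

definition Gam :: "real^4 \<Rightarrow> 4 \<Rightarrow> 4 \<Rightarrow> 4 \<Rightarrow> real" where
  "Gam x i k j = (\<Sum>A\<in>UNIV. e x A i * frame_grad x A k j)"

definition frame_riemann :: "real^4 \<Rightarrow> 4 \<Rightarrow> 4 \<Rightarrow> 4 \<Rightarrow> 4 \<Rightarrow> real" where
  "frame_riemann x = frame_curvature (M x) (dM x)"

lemma th_e_contract:
  assumes "x \<in> S"
  shows "(\<Sum>i\<in>UNIV. th x A i * (\<Sum>B\<in>UNIV. e x B i * f B)) = f A"
proof -
  have "(\<Sum>i\<in>UNIV. th x A i * (\<Sum>B\<in>UNIV. e x B i * f B))
      = (\<Sum>B\<in>UNIV. (\<Sum>i\<in>UNIV. th x A i * e x B i) * f B)"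
    unfolding sum_distrib_left sum_distrib_right by (subst sum.swap) (simp add: mult.assoc)
  then show ?thesis by (simp add: th_e[OF assms] sum_delta_mult)
qed

lemma e_th_contract:
  assumes "x \<in> S"
  shows "(\<Sum>A\<in>UNIV. e x A i * (\<Sum>j\<in>UNIV. th x A j * f j)) = f i"
proof -
  have "(\<Sum>A\<in>UNIV. e x A i * (\<Sum>j\<in>UNIV. th x A j * f j))
      = (\<Sum>j\<in>UNIV. (\<Sum>A\<in>UNIV. e x A i * th x A j) * f j)"
    unfolding sum_distrib_left sum_distrib_right by (subst sum.swap) (simp add: mult.assoc)
  then show ?thesis by (simp add: e_th[OF assms] sum_delta_mult)
qed

lemma th_Gam: "x \<in> S \<Longrightarrow> (\<Sum>i\<in>UNIV. th x A i * Gam x i k j) = frame_grad x A k j"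
  unfolding Gam_def by (rule th_e_contract)

lemma inv_metric_eq:
  assumes "x \<in> S"
  shows "inv_metric g x i j = (\<Sum>A\<in>UNIV. e x A i * (e x A j / G x A))"
proof -
  let ?h = "\<chi> i j. \<Sum>A\<in>UNIV. e x A i * (e x A j / G x A)"
  have "g x ** ?h = mat 1"
  proof -
    have "(\<Sum>l\<in>UNIV. g x $ i $ l * (\<Sum>A\<in>UNIV. e x A l * (e x A j / G x A)))
        = (if i = j then 1 else 0)" for i j
    proof -
      define u where "u l = (\<Sum>A\<in>UNIV. e x A l * (e x A j / G x A))" for l
      have th_u: "(\<Sum>l\<in>UNIV. th x B l * u l) = e x B j / G x B" for B
        unfolding u_def by (rule th_e_contract[OF assms])
      have "(\<Sum>l\<in>UNIV. g x $ i $ l * u l)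
          = (\<Sum>B\<in>UNIV. G x B * th x B i * (\<Sum>l\<in>UNIV. th x B l * u l))"
        unfolding metric[OF assms] sum_distrib_left sum_distrib_right
        by (subst sum.swap) (simp add: mult.assoc)
      also have "\<dots> = (\<Sum>B\<in>UNIV. e x B j * th x B i)"
        unfolding th_u by (rule sum.cong) (simp_all add: G_nonzero[OF assms])
      finally show ?thesis by (simp add: e_th[OF assms] u_def eq_commute)
    qed
    then show ?thesis by (simp add: matrix_matrix_mult_def mat_def vec_eq_iff)
  qed
  moreover from this have "?h ** g x = mat 1"
    by (simp add: matrix_left_right_inverse)
  ultimately have "matrix_inv (g x) = ?h"
    by (rule matrix_inv_unique)
  then show ?thesis by (simp add: inv_metric_def)
qed

lemma conn_deriv:
  assumes "x \<in> S"
  shows "has_partial_deriv (\<lambda>y. conn y k A B) (dconn x l k A B) l x"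
  unfolding conn_def dconn_def
  by (intro has_partial_deriv_sum has_partial_deriv_mult th_deriv M_deriv assms)

lemma frame_grad_deriv:
  assumes "x \<in> S"
  shows "has_partial_deriv (\<lambda>y. frame_grad y A k j)
    (ddth x l k A j + (\<Sum>B\<in>UNIV. dconn x l k A B * th x B j + conn x k A B * dth x l B j)) l x"
  unfolding frame_grad_def
  by (intro has_partial_deriv_sum has_partial_deriv_mult has_partial_deriv_add
        th_deriv dth_deriv conn_deriv assms)

text \<open>Existence suffices: \<open>th_riemann_mixed\<close> obtains the contracted derivative
  from the product rule applied to \<open>th_Gam\<close>, so no formula for the derivatives of
  \<open>e\<close> enters.\<close>

lemma Gam_differentiable:
  assumes "x \<in> S"
  shows "\<exists>d. has_partial_deriv (\<lambda>y. Gam y i k j) d l x"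
proof -
  have "\<forall>A. \<exists>d. has_partial_deriv (\<lambda>y. e y A i) d l x"
    using e_differentiable[OF assms] by blast
  then obtain de where "\<And>A. has_partial_deriv (\<lambda>y. e y A i) (de A) l x"
    by metis
  then show ?thesis
    unfolding Gam_def
    by (intro exI) (rule has_partial_deriv_sum has_partial_deriv_mult frame_grad_deriv assms | assumption)+
qed

text \<open>The antisymmetric part of \<open>frame_grad\<close> in its last two indices is the
  torsion of the connection.\<close>

lemma frame_grad_sym:
  assumes "x \<in> S"
  shows "frame_grad x A k j = frame_grad x A j k"
proof -
  have *: "(\<Sum>B\<in>UNIV. conn x k A B * th x B j)
      = (\<Sum>C\<in>UNIV. \<Sum>B\<in>UNIV. M x C A B * (th x C k * th x B j))" for k j
    unfolding conn_def sum_distrib_right by (subst sum.swap) (simp add: mult_ac)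
  have "(\<Sum>C\<in>UNIV. \<Sum>B\<in>UNIV. (M x B A C - M x C A B) * (th x C k * th x B j))
      = (\<Sum>C\<in>UNIV. \<Sum>B\<in>UNIV. M x B A C * (th x C k * th x B j))
        - (\<Sum>C\<in>UNIV. \<Sum>B\<in>UNIV. M x C A B * (th x C k * th x B j))"
    by (simp add: left_diff_distrib sum_subtractf)
  also have "(\<Sum>C\<in>UNIV. \<Sum>B\<in>UNIV. M x B A C * (th x C k * th x B j))
      = (\<Sum>C\<in>UNIV. \<Sum>B\<in>UNIV. M x C A B * (th x C j * th x B k))"
    by (subst sum.swap) (simp add: mult_ac)
  finally show ?thesis
    using torsion_free[OF assms, of k A j] by (simp add: frame_grad_def *)
qed

text \<open>Compatibility exchanges the derivatives of the squared lengths for the symmetrised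
  connection, which together with the coframe derivatives forms \<open>frame_grad\<close>.\<close>

lemma metric_deriv:
  assumes "x \<in> S"
  shows "has_partial_deriv (\<lambda>y. g y $ i $ j)
    (\<Sum>A\<in>UNIV. G x A * (frame_grad x A k i * th x A j + th x A i * frame_grad x A k j)) k x"
proof -
  let ?cG = "\<lambda>A. \<Sum>C\<in>UNIV. th x C k * dG x C A"
  have d: "has_partial_deriv (\<lambda>y. \<Sum>A\<in>UNIV. G y A * (th y A i * th y A j))
    (\<Sum>A\<in>UNIV. ?cG A * (th x A i * th x A j)
        + G x A * (dth x k A i * th x A j + th x A i * dth x k A j)) k x"
    by (intro has_partial_deriv_sum has_partial_deriv_mult G_deriv th_deriv assms)
  have comp: "G x A * conn x k A B + G x B * conn x k B A = (if A = B then ?cG A else 0)" for A B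
  proof -
    have "G x A * conn x k A B + G x B * conn x k B A
        = (\<Sum>C\<in>UNIV. th x C k * (G x A * M x C A B + G x B * M x C B A))"
      unfolding conn_def sum_distrib_left sum.distrib[symmetric]
      by (simp add: algebra_simps)
    then show ?thesis by (simp add: compatible[OF assms])
  qed
  have "(\<Sum>A\<in>UNIV. G x A * ((\<Sum>B\<in>UNIV. conn x k A B * th x B i) * th x A j
            + th x A i * (\<Sum>B\<in>UNIV. conn x k A B * th x B j)))
      = (\<Sum>A\<in>UNIV. \<Sum>B\<in>UNIV. (G x A * conn x k A B) * (th x B i * th x A j))
        + (\<Sum>A\<in>UNIV. \<Sum>B\<in>UNIV. (G x A * conn x k A B) * (th x A i * th x B j))"
    unfolding sum_distrib_left sum_distrib_right sum.distrib distrib_left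
    by (simp add: mult_ac)
  also have "(\<Sum>A\<in>UNIV. \<Sum>B\<in>UNIV. (G x A * conn x k A B) * (th x B i * th x A j))
      = (\<Sum>A\<in>UNIV. \<Sum>B\<in>UNIV. (G x B * conn x k B A) * (th x A i * th x B j))"
    by (rule sum.swap)
  also have "\<dots> + (\<Sum>A\<in>UNIV. \<Sum>B\<in>UNIV. (G x A * conn x k A B) * (th x A i * th x B j))
      = (\<Sum>A\<in>UNIV. \<Sum>B\<in>UNIV. (if A = B then ?cG A else 0) * (th x A i * th x B j))"
    unfolding comp[symmetric] sum.distrib[symmetric] by (simp add: algebra_simps)
  also have "\<dots> = (\<Sum>A\<in>UNIV. ?cG A * (th x A i * th x A j))"
  proof (rule sum.cong[OF refl])
    fix A :: 4
    show "(\<Sum>B\<in>UNIV. (if A = B then ?cG A else 0) * (th x A i * th x B j))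
        = ?cG A * (th x A i * th x A j)"
      using sum_delta_mult(2)[of A "\<lambda>_. ?cG A" "\<lambda>B. th x A i * th x B j"] by simp
  qed
  finally have "(\<Sum>A\<in>UNIV. ?cG A * (th x A i * th x A j)
        + G x A * (dth x k A i * th x A j + th x A i * dth x k A j))
      = (\<Sum>A\<in>UNIV. G x A * ((\<Sum>B\<in>UNIV. conn x k A B * th x B i) * th x A j
            + th x A i * (\<Sum>B\<in>UNIV. conn x k A B * th x B j)))
        + (\<Sum>A\<in>UNIV. G x A * (dth x k A i * th x A j + th x A i * dth x k A j))"
    by (simp only: sum.distrib)
  also have "\<dots>
      = (\<Sum>A\<in>UNIV. G x A * (frame_grad x A k i * th x A j + th x A i * frame_grad x A k j))"
    unfolding frame_grad_def sum.distrib[symmetric] by (simp add: algebra_simps)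
  finally have "(\<Sum>A\<in>UNIV. ?cG A * (th x A i * th x A j)
        + G x A * (dth x k A i * th x A j + th x A i * dth x k A j))
      = (\<Sum>A\<in>UNIV. G x A * (frame_grad x A k i * th x A j + th x A i * frame_grad x A k j))" .
  then show ?thesis
    using has_partial_deriv_cong[OF d open_S assms] metric by simp
qed

text \<open>By the symmetry of \<open>frame_grad\<close>, four of the six terms in the Christoffel
  formula cancel and the other two agree, as in the uniqueness proof for the Levi-Civita
  connection.\<close>

lemma christoffel_eq:
  assumes "x \<in> S"
  shows "christoffel g x i j k = Gam x i j k"
proof -
  let ?c = "\<lambda>l j k. \<Sum>A\<in>UNIV. G x A * (th x A l * frame_grad x A j k)"
  have pd: "partial_deriv k (\<lambda>y. g y $ i $ j) x = ?c j k i + ?c i k j" for i j k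
    using has_partial_deriv_imp[OF metric_deriv[OF assms, of i j k]]
    by (simp add: distrib_left sum.distrib mult_ac)
  have sym: "?c l j k = ?c l k j" for l j k
    by (simp add: frame_grad_sym[OF assms, of _ j k])
  have "christoffel g x i j k = (\<Sum>l\<in>UNIV. inv_metric g x i l * ?c l j k)"
  proof -
    have "partial_deriv j (\<lambda>y. g y $ l $ k) x + partial_deriv k (\<lambda>y. g y $ l $ j) x
        - partial_deriv l (\<lambda>y. g y $ j $ k) x = 2 * ?c l j k" for l
      unfolding pd using sym[of l j k] sym[of k j l] sym[of j k l] by simp
    then show ?thesis
      unfolding christoffel_def by (simp add: sum_distrib_left mult_ac)
  qed
  also have "\<dots> = (\<Sum>l\<in>UNIV. \<Sum>A\<in>UNIV. e x A i / G x A * (e x A l * ?c l j k))"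
    unfolding inv_metric_eq[OF assms] sum_distrib_right by (simp add: mult_ac)
  also have "\<dots> = (\<Sum>A\<in>UNIV. e x A i / G x A *
      (\<Sum>l\<in>UNIV. e x A l * (\<Sum>B\<in>UNIV. th x B l * (G x B * frame_grad x B j k))))"
    unfolding sum_distrib_left by (subst sum.swap) (simp add: mult_ac)
  also have "\<dots> = (\<Sum>A\<in>UNIV. e x A i * frame_grad x A j k)"
  proof (rule sum.cong[OF refl])
    fix A
    have "(\<Sum>l\<in>UNIV. e x A l * (\<Sum>B\<in>UNIV. th x B l * (G x B * frame_grad x B j k)))
        = (\<Sum>B\<in>UNIV. (\<Sum>l\<in>UNIV. th x B l * e x A l) * (G x B * frame_grad x B j k))"
      unfolding sum_distrib_left sum_distrib_right by (subst sum.swap) (simp add: mult_ac)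
    also have "\<dots> = G x A * frame_grad x A j k"
      by (simp add: th_e[OF assms] sum_delta_mult)
    finally show "e x A i / G x A *
      (\<Sum>l\<in>UNIV. e x A l * (\<Sum>B\<in>UNIV. th x B l * (G x B * frame_grad x B j k)))
        = e x A i * frame_grad x A j k"
      by (simp add: G_nonzero[OF assms])
  qed
  finally show ?thesis by (simp add: Gam_def)
qed

text \<open>After contraction with the coframe the formula involves only the connection forms:
  second derivatives of \<open>th\<close> cancel by symmetry, and the first derivatives left by
  \<open>leibniz\<close> cancel against those in \<open>quad\<close>.\<close>

lemma th_riemann_mixed:
  assumes "x \<in> S"
  shows "(\<Sum>i\<in>UNIV. th x A i * riemann_mixed g x i j k l)
    = (\<Sum>B\<in>UNIV. (dconn x k l A B - dconn x l k A B
        + (\<Sum>K\<in>UNIV. conn x k A K * conn x l K B - conn x l A K * conn x k K B)) * th x B j)"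
proof -
  define dfg where "dfg A k j l = ddth x l k A j
    + (\<Sum>B\<in>UNIV. dconn x l k A B * th x B j + conn x k A B * dth x l B j)" for A k j l
  have "\<forall>i k j l. \<exists>d. has_partial_deriv (\<lambda>y. Gam y i k j) d l x"
    using Gam_differentiable[OF assms] by blast
  then obtain dGam where dGam: "\<And>i k j l. has_partial_deriv (\<lambda>y. Gam y i k j) (dGam i k j l) l x"
    by metis
  have chr: "partial_deriv l (\<lambda>y. christoffel g y i j k) x = dGam i j k l" for i j k l
    by (rule has_partial_deriv_imp, rule has_partial_deriv_cong[OF dGam open_S assms])
      (simp add: christoffel_eq)
  have sym: "dGam i j k l = dGam i k j l" for i j k l
    by (rule has_partial_deriv_unique[OF dGam], rule has_partial_deriv_cong[OF dGam open_S assms])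
      (simp add: Gam_def frame_grad_sym)
  have leibniz: "(\<Sum>i\<in>UNIV. th x A i * dGam i k j l)
      = dfg A k j l - (\<Sum>i\<in>UNIV. dth x l A i * Gam x i k j)" for k j l
  proof -
    have "has_partial_deriv (\<lambda>y. \<Sum>i\<in>UNIV. th y A i * Gam y i k j)
        (\<Sum>i\<in>UNIV. dth x l A i * Gam x i k j + th x A i * dGam i k j l) l x"
      by (intro has_partial_deriv_sum has_partial_deriv_mult th_deriv dGam assms)
    then have "has_partial_deriv (\<lambda>y. frame_grad y A k j)
        (\<Sum>i\<in>UNIV. dth x l A i * Gam x i k j + th x A i * dGam i k j l) l x"
      by (rule has_partial_deriv_cong[OF _ open_S assms]) (rule th_Gam)
    from has_partial_deriv_unique[OF this frame_grad_deriv[OF assms]]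
    show ?thesis by (simp add: dfg_def sum.distrib)
  qed
  have quad: "(\<Sum>i\<in>UNIV. th x A i * (\<Sum>n\<in>UNIV. Gam x i k n * Gam x n l j))
      = (\<Sum>n\<in>UNIV. dth x k A n * Gam x n l j) + (\<Sum>B\<in>UNIV. conn x k A B * frame_grad x B l j)" for k l
  proof -
    have "(\<Sum>i\<in>UNIV. th x A i * (\<Sum>n\<in>UNIV. Gam x i k n * Gam x n l j))
        = (\<Sum>n\<in>UNIV. (\<Sum>i\<in>UNIV. th x A i * Gam x i k n) * Gam x n l j)"
      unfolding sum_distrib_left sum_distrib_right by (subst sum.swap) (simp add: mult.assoc)
    also have "\<dots> = (\<Sum>n\<in>UNIV. dth x k A n * Gam x n l j)
        + (\<Sum>n\<in>UNIV. \<Sum>B\<in>UNIV. conn x k A B * th x B n * Gam x n l j)"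
      unfolding th_Gam[OF assms] frame_grad_def
      by (simp add: distrib_right sum.distrib sum_distrib_right)
    also have "(\<Sum>n\<in>UNIV. \<Sum>B\<in>UNIV. conn x k A B * th x B n * Gam x n l j)
        = (\<Sum>B\<in>UNIV. conn x k A B * (\<Sum>n\<in>UNIV. th x B n * Gam x n l j))"
      unfolding sum_distrib_left by (subst sum.swap) (simp add: mult.assoc)
    finally show ?thesis by (simp add: th_Gam[OF assms])
  qed
  have swap: "(\<Sum>K\<in>UNIV. conn x k A K * (\<Sum>B\<in>UNIV. conn x l K B * th x B j))
      = (\<Sum>B\<in>UNIV. (\<Sum>K\<in>UNIV. conn x k A K * conn x l K B) * th x B j)" for k l
    unfolding sum_distrib_left sum_distrib_right by (subst sum.swap) (simp add: mult.assoc)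
  have "(\<Sum>i\<in>UNIV. th x A i * riemann_mixed g x i j k l)
     = (\<Sum>i\<in>UNIV. th x A i * dGam i l j k) - (\<Sum>i\<in>UNIV. th x A i * dGam i k j l)
       + (\<Sum>i\<in>UNIV. th x A i * (\<Sum>n\<in>UNIV. Gam x i k n * Gam x n l j))
       - (\<Sum>i\<in>UNIV. th x A i * (\<Sum>n\<in>UNIV. Gam x i l n * Gam x n k j))"
    unfolding riemann_mixed_def chr christoffel_eq[OF assms]
    by (simp add: sym[of _ j] Gam_def frame_grad_sym[OF assms, of _ j] algebra_simps
        sum.distrib sum_subtractf)
  also have "\<dots> = dfg A l j k - dfg A k j l
      + (\<Sum>B\<in>UNIV. conn x k A B * frame_grad x B l j) - (\<Sum>B\<in>UNIV. conn x l A B * frame_grad x B k j)"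
    unfolding leibniz quad by simp
  also have "\<dots> = (\<Sum>B\<in>UNIV. (dconn x k l A B - dconn x l k A B) * th x B j)
      + (\<Sum>K\<in>UNIV. conn x k A K * (\<Sum>B\<in>UNIV. conn x l K B * th x B j))
      - (\<Sum>K\<in>UNIV. conn x l A K * (\<Sum>B\<in>UNIV. conn x k K B * th x B j))"
    unfolding dfg_def frame_grad_def ddth_sym[OF assms, of l k]
    by (simp add: algebra_simps sum.distrib sum_subtractf)
  finally show ?thesis
    unfolding swap by (simp add: distrib_right left_diff_distrib sum.distrib sum_subtractf)
qed

text \<open>Coframe derivatives occur only antisymmetrised, and zero torsion turns them into the
  commutator term of \<open>frame_curvature\<close>.\<close>

lemma curvature_form_frame:
  assumes "x \<in> S"
  shows "dconn x k l A B - dconn x l k A B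
        + (\<Sum>K\<in>UNIV. conn x k A K * conn x l K B - conn x l A K * conn x k K B)
    = (\<Sum>C\<in>UNIV. \<Sum>D\<in>UNIV. frame_riemann x A B C D * (th x C k * th x D l))"
proof -
  let ?R = "\<lambda>f. \<Sum>C\<in>UNIV. \<Sum>D\<in>UNIV. f C D * (th x C k * th x D l)"
  have 1: "(\<Sum>C\<in>UNIV. th x C l * (\<Sum>D\<in>UNIV. th x D k * dM x D C A B)) = ?R (\<lambda>C D. dM x C D A B)"
    unfolding sum_distrib_left by (subst sum.swap) (simp add: mult_ac)
  have 2: "(\<Sum>C\<in>UNIV. th x C k * (\<Sum>D\<in>UNIV. th x D l * dM x D C A B)) = ?R (\<lambda>C D. dM x D C A B)"
    unfolding sum_distrib_left by (simp add: mult_ac)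
  have 3: "(\<Sum>K\<in>UNIV. (dth x k K l - dth x l K k) * M x K A B)
      = - ?R (\<lambda>C D. \<Sum>K\<in>UNIV. (M x C K D - M x D K C) * M x K A B)"
  proof -
    have "(\<Sum>K\<in>UNIV. (dth x k K l - dth x l K k) * M x K A B)
        = (\<Sum>K\<in>UNIV. ?R (\<lambda>C D. (M x D K C - M x C K D) * M x K A B))"
      unfolding torsion_free[OF assms] sum_distrib_right by (simp add: mult_ac)
    also have "\<dots> = ?R (\<lambda>C D. \<Sum>K\<in>UNIV. (M x D K C - M x C K D) * M x K A B)"
      unfolding sum_distrib_right
      by (subst sum.swap, rule sum.cong[OF refl], subst sum.swap, rule refl)
    finally show ?thesis
      by (simp add: sum_negf[symmetric] left_diff_distrib sum_subtractf)
  qed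
  have 4: "(\<Sum>K\<in>UNIV. conn x k A K * conn x l K B) = ?R (\<lambda>C D. \<Sum>K\<in>UNIV. M x C A K * M x D K B)"
  proof -
    have "(\<Sum>K\<in>UNIV. conn x k A K * conn x l K B)
        = (\<Sum>K\<in>UNIV. ?R (\<lambda>C D. M x C A K * M x D K B))"
      unfolding conn_def sum_product by (simp add: mult_ac)
    also have "\<dots> = ?R (\<lambda>C D. \<Sum>K\<in>UNIV. M x C A K * M x D K B)"
      unfolding sum_distrib_right
      by (subst sum.swap, rule sum.cong[OF refl], subst sum.swap, rule refl)
    finally show ?thesis .
  qed
  have 5: "(\<Sum>K\<in>UNIV. conn x l A K * conn x k K B) = ?R (\<lambda>C D. \<Sum>K\<in>UNIV. M x D A K * M x C K B)"
  proof -
    have "(\<Sum>K\<in>UNIV. conn x l A K * conn x k K B)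
        = (\<Sum>K\<in>UNIV. ?R (\<lambda>C D. M x D A K * M x C K B))"
      unfolding conn_def sum_product by (subst sum.swap) (simp add: mult_ac)
    also have "\<dots> = ?R (\<lambda>C D. \<Sum>K\<in>UNIV. M x D A K * M x C K B)"
      unfolding sum_distrib_right
      by (subst sum.swap, rule sum.cong[OF refl], subst sum.swap, rule refl)
    finally show ?thesis .
  qed
  have "dconn x k l A B - dconn x l k A B
      = (\<Sum>K\<in>UNIV. (dth x k K l - dth x l K k) * M x K A B)
        + (\<Sum>C\<in>UNIV. th x C l * (\<Sum>D\<in>UNIV. th x D k * dM x D C A B))
        - (\<Sum>C\<in>UNIV. th x C k * (\<Sum>D\<in>UNIV. th x D l * dM x D C A B))"
    unfolding dconn_def by (simp add: sum.distrib sum_subtractf left_diff_distrib)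
  then show ?thesis
    unfolding sum_subtractf 1 2 3 4 5 frame_riemann_def frame_curvature_def
    by (simp add: distrib_right left_diff_distrib sum.distrib sum_subtractf)
qed

lemma riemann_mixed_eq:
  assumes "x \<in> S"
  shows "riemann_mixed g x i j k l = (\<Sum>A\<in>UNIV. e x A i * (\<Sum>B\<in>UNIV. th x B j *
    (\<Sum>C\<in>UNIV. th x C k * (\<Sum>D\<in>UNIV. th x D l * frame_riemann x A B C D))))"
proof -
  have "riemann_mixed g x i j k l
      = (\<Sum>A\<in>UNIV. e x A i * (\<Sum>n\<in>UNIV. th x A n * riemann_mixed g x n j k l))"
    by (simp add: e_th_contract[OF assms])
  then show ?thesis
    unfolding th_riemann_mixed[OF assms] curvature_form_frame[OF assms]
    by (simp add: sum_distrib_left sum_distrib_right mult_ac)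
qed

end

section \<open>Type D Weyl tensors\<close>

definition frame_delta :: "(4 \<Rightarrow> real) \<Rightarrow> 4 \<Rightarrow> 4 \<Rightarrow> real" where
  "frame_delta G A B = (if A = B then G A else 0)"

text \<open>
  A type D Weyl tensor in a frame adapted to the two principal planes 12 and 34. For the
  normalisation $\sigma^2 = -G_1 G_2 G_3 G_4$, \<open>X + \<i> Z\<close> is twice the Weyl scalar $\Psi_2$
  up to sign and conjugation.
\<close>

definition plane_weight :: "4 \<Rightarrow> 4 \<Rightarrow> real" where
  "plane_weight A B = (if {A, B} = {1, 2} \<or> {A, B} = {3, 4} then 1 else -1/2)"

definition typeD_weyl :: "(4 \<Rightarrow> real) \<Rightarrow> real \<Rightarrow> real \<Rightarrow> real \<Rightarrow> 4 \<Rightarrow> 4 \<Rightarrow> 4 \<Rightarrow> 4 \<Rightarrow> real" where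
  "typeD_weyl G \<sigma> X Z A B C D = plane_weight A B *
     (Z * \<sigma> * levi_civita_symbol A B C D
      - X * (frame_delta G A C * frame_delta G B D - frame_delta G A D * frame_delta G B C))"

lemma plane_weight_values [simp]:
  "plane_weight 1 2 = 1" "plane_weight 2 1 = 1" "plane_weight 3 4 = 1" "plane_weight 4 3 = 1"
  "plane_weight 1 3 = -1/2" "plane_weight 1 4 = -1/2" "plane_weight 2 3 = -1/2"
  "plane_weight 2 4 = -1/2" "plane_weight 3 1 = -1/2" "plane_weight 4 1 = -1/2"
  "plane_weight 3 2 = -1/2" "plane_weight 4 2 = -1/2" "plane_weight A A = -1/2"
  by (auto simp: plane_weight_def doubleton_eq_iff)

lemma frame_delta_values [simp]:
  "frame_delta G A A = G A" "A \<noteq> B \<Longrightarrow> frame_delta G A B = 0"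
  by (auto simp: frame_delta_def)

lemma sum_distinct_4:
  fixes A B S T :: 4
  assumes "distinct [A, B, S, T]"
  shows "sum f UNIV = f A + f B + f S + (f T :: real)" "prod h UNIV = h A * h B * h S * (h T :: real)"
proof -
  have "card {A, B, S, T} = CARD(4)"
    using assms by simp
  then have "{A, B, S, T} = UNIV"
    by (intro card_subset_eq) auto
  then show "sum f UNIV = f A + f B + f S + f T" "prod h UNIV = h A * h B * h S * h T"
    using assms by (auto simp: ac_simps simp flip: \<open>{A, B, S, T} = UNIV\<close>)
qed

text \<open>Complementary pairs are either the two principal planes or both mixed. This is why the
  dual of a type D tensor has the same shape.\<close>

lemma plane_weight_complement:
  "distinct [A, B, S, T] \<Longrightarrow> plane_weight S T = plane_weight A B"
  using exhaust_4[of A] exhaust_4[of B] exhaust_4[of S] exhaust_4[of T]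
  by (elim disjE) simp_all

lemma levi_civita_symbol_nondistinct:
  "\<not> distinct [A, B, S, T] \<Longrightarrow> levi_civita_symbol A B S T = 0"
  by (auto simp: levi_civita_symbol_repeat)

text \<open>For fixed \<open>A \<noteq> B\<close> with complement S, T, the pairs (A,B), (B,A)
  contribute \<open>X\<^sup>2\<close> and (S,T), (T,S) contribute minus \<open>Z\<^sup>2\<close>,
  the sign coming from that of \<open>\<sigma>\<^sup>2\<close>. The squared weights of the ordered
  pairs sum to 4 + 8/4 = 6, which gives 12.\<close>

lemma typeD_weyl_square:
  assumes "\<And>A. G A \<noteq> 0" "\<sigma>\<^sup>2 = - (G 1 * G 2 * G 3 * G 4)"
  shows "(\<Sum>A\<in>UNIV. \<Sum>B\<in>UNIV. \<Sum>C\<in>UNIV. \<Sum>D\<in>UNIV.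
      typeD_weyl G \<sigma> X Z A B C D * (typeD_weyl G \<sigma> X Z A B C D / (G A * G B * G C * G D)))
      = 12 * (X\<^sup>2 - Z\<^sup>2)"
proof -
  have "(\<Sum>C\<in>UNIV. \<Sum>D\<in>UNIV.
      typeD_weyl G \<sigma> X Z A B C D * (typeD_weyl G \<sigma> X Z A B C D / (G A * G B * G C * G D)))
      = (if A = B then 0 else (plane_weight A B)\<^sup>2 * 2 * (X\<^sup>2 - Z\<^sup>2))" for A B
  proof (cases "A = B")
    case False
    have "\<exists>S T. distinct [A, B, S, T]"
      using False exhaust_4[of A] exhaust_4[of B]
      by (elim disjE) (simp_all, (rule exI[of _ 1] exI[of _ 2] exI[of _ 3] exI[of _ 4] | simp)+)
    then obtain S T where d: "distinct [A, B, S, T]" by blast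
    define \<epsilon> where "\<epsilon> = levi_civita_symbol A B S T"
    have lc: "levi_civita_symbol A B S T = \<epsilon>" "levi_civita_symbol A B T S = - \<epsilon>"
      using levi_civita_symbol_swap(3)[of A B S T] by (simp_all add: \<epsilon>_def)
    have "\<epsilon>\<^sup>2 = 1"
      using d exhaust_4[of A] exhaust_4[of B] exhaust_4[of S] exhaust_4[of T]
      unfolding \<epsilon>_def by (elim disjE) (simp_all add: levi_civita_symbol_values)
    then have eps: "\<epsilon> * (\<epsilon> * u) = u" for u
      by (simp add: power2_eq_square mult.assoc[symmetric])
    have "prod G UNIV = G 1 * G 2 * G 3 * G 4" by (rule prod_4)
    then have \<sigma>: "\<sigma>\<^sup>2 = - (G A * G B * G S * G T)"
      using assms(2) sum_distinct_4(2)[OF d, of G] by simp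
    then have s: "\<sigma> * (\<sigma> * u) = - (G A * G B * G S * G T) * u" for u
      by (simp add: power2_eq_square mult.assoc[symmetric])
    have ne: "B \<noteq> A" "S \<noteq> A" "T \<noteq> A" "S \<noteq> B" "T \<noteq> B" "T \<noteq> S"
      using d by auto
    show ?thesis
      using d ne assms(1)
      by (simp add: sum_distinct_4(1)[OF d] typeD_weyl_def lc levi_civita_symbol_repeat)
         (simp add: field_simps power2_eq_square s eps)
  qed (simp add: typeD_weyl_def levi_civita_symbol_repeat)
  then show ?thesis
    by (simp add: sum_4 power2_eq_square)
qed

text \<open>For each arrangement of distinct indices, four equal cross terms of an \<open>X\<close>
  part with a \<open>Z\<close> part survive. The 24 arrangements have total squared weight 2 * 6,
  hence 48.\<close>

lemma typeD_weyl_dual: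
  assumes "\<And>A. G A \<noteq> 0" "\<sigma>\<^sup>2 = - (G 1 * G 2 * G 3 * G 4)" "\<sigma> \<noteq> 0"
  shows "(\<Sum>A\<in>UNIV. \<Sum>B\<in>UNIV. \<Sum>S\<in>UNIV. \<Sum>T\<in>UNIV. levi_civita_symbol A B S T *
      (\<Sum>C\<in>UNIV. \<Sum>D\<in>UNIV. typeD_weyl G \<sigma> X Z S T C D / (G S * G T)
        * (typeD_weyl G \<sigma> X Z A B C D / (G A * G B * G C * G D))))
      = 48 * X * Z / \<sigma>"
proof -
  have "levi_civita_symbol A B S T * (\<Sum>C\<in>UNIV. \<Sum>D\<in>UNIV. typeD_weyl G \<sigma> X Z S T C D / (G S * G T)
        * (typeD_weyl G \<sigma> X Z A B C D / (G A * G B * G C * G D)))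
      = (levi_civita_symbol A B S T)\<^sup>2 * ((plane_weight A B)\<^sup>2 * (4 * X * Z / \<sigma>))" for A B S T
  proof (cases "distinct [A, B, S, T]")
    case True
    define \<epsilon> where "\<epsilon> = levi_civita_symbol A B S T"
    have lc: "levi_civita_symbol A B S T = \<epsilon>" "levi_civita_symbol A B T S = - \<epsilon>"
      "levi_civita_symbol S T A B = \<epsilon>" "levi_civita_symbol S T B A = - \<epsilon>"
      using levi_civita_symbol_swap(2)[of A S B T] levi_civita_symbol_swap(1)[of A S B T]
        levi_civita_symbol_swap(3)[of S A B T] levi_civita_symbol_swap(2)[of S A T B]
        levi_civita_symbol_swap(3)[of A B S T] levi_civita_symbol_swap(3)[of S T A B]
      by (simp_all add: \<epsilon>_def)
    have "prod G UNIV = G 1 * G 2 * G 3 * G 4" by (rule prod_4)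
    then have "\<sigma>\<^sup>2 = - (G A * G B * G S * G T)"
      using assms(2) sum_distinct_4(2)[OF True, of G] by simp
    \<comment> \<open>Solving for one squared length lets all of them cancel and leaves a single
      power of \<open>\<sigma>\<close> in the denominator.\<close>
    then have GT: "G T = - (\<sigma>\<^sup>2 / (G A * G B * G S))"
      using assms(1) by (simp add: field_simps)
    have ne: "B \<noteq> A" "S \<noteq> A" "T \<noteq> A" "S \<noteq> B" "T \<noteq> B" "T \<noteq> S"
      using True by auto
    show ?thesis
      using True ne assms(1) assms(3)
      by (simp add: sum_distinct_4(1)[OF True] typeD_weyl_def lc levi_civita_symbol_repeat
          plane_weight_complement[OF True] GT)
         (simp add: field_simps power2_eq_square power4_eq_xxxx)
  qed (simp add: levi_civita_symbol_nondistinct)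
  then show ?thesis
    by (simp add: sum_4 levi_civita_symbol_values levi_civita_symbol_repeat power2_eq_square)
qed

text \<open>The three planes through a frame vector have weights 1, -1/2 and -1/2, whose sum is 0;
  the \<open>Z\<close> part has a repeated index.\<close>

lemma typeD_weyl_trace:
  assumes "\<And>A. G A \<noteq> 0"
  shows "(\<Sum>A\<in>UNIV. typeD_weyl G \<sigma> X Z A B A D / G A) = 0"
  using exhaust_4[of B] exhaust_4[of D] assms
  by (auto simp: sum_4 typeD_weyl_def levi_civita_symbol_repeat)

section \<open>Ricci, scalar and Weyl curvature in frame components\<close>

context moving_frame begin

definition lower :: "real^4 \<Rightarrow> (4 \<Rightarrow> 4 \<Rightarrow> 4 \<Rightarrow> 4 \<Rightarrow> real) \<Rightarrow> 4 \<Rightarrow> 4 \<Rightarrow> 4 \<Rightarrow> 4 \<Rightarrow> real" where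
  "lower x f i j k l = (\<Sum>A\<in>UNIV. th x A i * (\<Sum>B\<in>UNIV. th x B j *
    (\<Sum>C\<in>UNIV. th x C k * (\<Sum>D\<in>UNIV. th x D l * f A B C D))))"

definition frame_ricci :: "real^4 \<Rightarrow> 4 \<Rightarrow> 4 \<Rightarrow> real" where
  "frame_ricci x B D = (\<Sum>A\<in>UNIV. frame_riemann x A B A D)"

definition frame_scalar :: "real^4 \<Rightarrow> real" where
  "frame_scalar x = (\<Sum>A\<in>UNIV. frame_ricci x A A / G x A)"

definition frame_weyl :: "real^4 \<Rightarrow> 4 \<Rightarrow> 4 \<Rightarrow> 4 \<Rightarrow> 4 \<Rightarrow> real" where
  "frame_weyl x A B C D = (let d = frame_delta (G x); R = frame_ricci x in
     G x A * frame_riemann x A B C D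
     - 1/2 * (d A C * R B D - d A D * R B C - R A D * d B C + R A C * d B D)
     + frame_scalar x / 6 * (d A C * d B D - d A D * d B C))"

lemma riemann_eq:
  assumes "x \<in> S"
  shows "riemann g x i j k l = lower x (\<lambda>A B C D. G x A * frame_riemann x A B C D) i j k l"
proof -
  let ?r = "\<lambda>A. \<Sum>B\<in>UNIV. th x B j * (\<Sum>C\<in>UNIV. th x C k * (\<Sum>D\<in>UNIV. th x D l * frame_riemann x A B C D))"
  have "riemann g x i j k l = (\<Sum>n\<in>UNIV. \<Sum>A\<in>UNIV. th x A i * (G x A * (th x A n * riemann_mixed g x n j k l)))"
    unfolding riemann_def metric[OF assms] sum_distrib_right by (simp add: mult_ac)
  also have "\<dots> = (\<Sum>A\<in>UNIV. th x A i * (G x A * (\<Sum>n\<in>UNIV. th x A n * riemann_mixed g x n j k l)))"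
    unfolding sum_distrib_left by (rule sum.swap)
  also have "\<dots> = (\<Sum>A\<in>UNIV. th x A i * (G x A * ?r A))"
    unfolding riemann_mixed_eq[OF assms] th_e_contract[OF assms] ..
  finally show ?thesis
    unfolding lower_def by (simp add: sum_distrib_left mult_ac)
qed

lemma e_contract:
  assumes "x \<in> S"
  shows "(\<Sum>n\<in>UNIV. e x A n * (\<Sum>C\<in>UNIV. th x C n * f C)) = f A"
proof -
  have "(\<Sum>n\<in>UNIV. e x A n * (\<Sum>C\<in>UNIV. th x C n * f C))
      = (\<Sum>C\<in>UNIV. (\<Sum>n\<in>UNIV. th x C n * e x A n) * f C)"
    unfolding sum_distrib_left sum_distrib_right by (subst sum.swap) (simp add: mult_ac)
  then show ?thesis by (simp add: th_e[OF assms] sum_delta_mult)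
qed

lemma ricci_eq:
  assumes "x \<in> S"
  shows "ricci g x j l = (\<Sum>B\<in>UNIV. th x B j * (\<Sum>D\<in>UNIV. th x D l * frame_ricci x B D))"
proof -
  let ?u = "\<lambda>A B C. \<Sum>D\<in>UNIV. th x D l * frame_riemann x A B C D"
  have trace: "(\<Sum>D\<in>UNIV. th x D l * frame_ricci x B D) = (\<Sum>A\<in>UNIV. ?u A B A)" for B
    unfolding frame_ricci_def sum_distrib_left by (rule sum.swap)
  have "ricci g x j l = (\<Sum>A\<in>UNIV. \<Sum>n\<in>UNIV. e x A n * (\<Sum>B\<in>UNIV. th x B j * (\<Sum>C\<in>UNIV. th x C n * ?u A B C)))"
    unfolding ricci_def riemann_mixed_eq[OF assms] by (rule sum.swap)
  also have "\<dots> = (\<Sum>A\<in>UNIV. \<Sum>B\<in>UNIV. th x B j * (\<Sum>n\<in>UNIV. e x A n * (\<Sum>C\<in>UNIV. th x C n * ?u A B C)))"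
  proof (rule sum.cong[OF refl])
    fix A
    have "(\<Sum>n\<in>UNIV. e x A n * (\<Sum>B\<in>UNIV. th x B j * v B n))
      = (\<Sum>B\<in>UNIV. th x B j * (\<Sum>n\<in>UNIV. e x A n * v B n))" for v
      unfolding sum_distrib_left by (subst sum.swap) (simp add: mult_ac)
    then show "(\<Sum>n\<in>UNIV. e x A n * (\<Sum>B\<in>UNIV. th x B j * (\<Sum>C\<in>UNIV. th x C n * ?u A B C)))
      = (\<Sum>B\<in>UNIV. th x B j * (\<Sum>n\<in>UNIV. e x A n * (\<Sum>C\<in>UNIV. th x C n * ?u A B C)))" .
  qed
  also have "\<dots> = (\<Sum>B\<in>UNIV. th x B j * (\<Sum>A\<in>UNIV. ?u A B A))"
    unfolding e_contract[OF assms] sum_distrib_left[of "th x _ j"] by (rule sum.swap)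
  finally show ?thesis
    unfolding trace .
qed

lemma raise:
  assumes "x \<in> S"
  shows "(\<Sum>p\<in>UNIV. inv_metric g x i p * (\<Sum>A\<in>UNIV. th x A p * f A)) = (\<Sum>A\<in>UNIV. e x A i * (f A / G x A))"
proof -
  have "(\<Sum>p\<in>UNIV. inv_metric g x i p * (\<Sum>A\<in>UNIV. th x A p * f A))
      = (\<Sum>B\<in>UNIV. e x B i / G x B * (\<Sum>p\<in>UNIV. e x B p * (\<Sum>A\<in>UNIV. th x A p * f A)))"
    unfolding inv_metric_eq[OF assms] sum_distrib_right sum_distrib_left[of "_ / _"]
    by (subst sum.swap) (simp add: mult_ac)
  then show ?thesis by (simp add: e_contract[OF assms])
qed

lemma scalar_curvature_eq:
  assumes "x \<in> S"
  shows "scalar_curvature g x = frame_scalar x"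
proof -
  have pull: "(\<Sum>i\<in>UNIV. \<Sum>A\<in>UNIV. e x A i * (F A i / G x A))
      = (\<Sum>A\<in>UNIV. (\<Sum>i\<in>UNIV. e x A i * F A i) / G x A)" for F
    by (subst sum.swap) (simp add: sum_divide_distrib)
  have "(\<Sum>B\<in>UNIV. th x B i * (\<Sum>D\<in>UNIV. th x D j * frame_ricci x B D))
      = (\<Sum>D\<in>UNIV. th x D j * (\<Sum>B\<in>UNIV. th x B i * frame_ricci x B D))" for i j
    unfolding sum_distrib_left by (subst sum.swap) (simp add: mult_ac)
  then have "scalar_curvature g x
      = (\<Sum>i\<in>UNIV. \<Sum>j\<in>UNIV. inv_metric g x i j * (\<Sum>D\<in>UNIV. th x D j * (\<Sum>B\<in>UNIV. th x B i * frame_ricci x B D)))"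
    unfolding scalar_curvature_def ricci_eq[OF assms] by simp
  also have "\<dots> = (\<Sum>i\<in>UNIV. \<Sum>A\<in>UNIV. e x A i * ((\<Sum>B\<in>UNIV. th x B i * frame_ricci x B A) / G x A))"
    by (simp add: raise[OF assms])
  also have "\<dots> = (\<Sum>A\<in>UNIV. (\<Sum>i\<in>UNIV. e x A i * (\<Sum>B\<in>UNIV. th x B i * frame_ricci x B A)) / G x A)"
    by (rule pull)
  finally show ?thesis
    by (simp add: e_contract[OF assms] frame_scalar_def)
qed

text \<open>The trace terms of the Weyl tensor are products of two-index tensors in this index
  pattern or in that of \<open>lower_product_14_23\<close>; in both, the conversion to coordinates
  factorises.\<close>

lemma lower_product_13_24:
  "lower x (\<lambda>A B C D. p A C * q B D) i j k l
   = (\<Sum>A\<in>UNIV. th x A i * (\<Sum>C\<in>UNIV. th x C k * p A C))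
     * (\<Sum>B\<in>UNIV. th x B j * (\<Sum>D\<in>UNIV. th x D l * q B D))"
proof -
  have 1: "(\<Sum>D\<in>UNIV. th x D l * (p A C * q B D)) = p A C * (\<Sum>D\<in>UNIV. th x D l * q B D)" for A B C
    by (simp add: sum_distrib_left mult_ac)
  have 2: "(\<Sum>C\<in>UNIV. th x C k * (p A C * u)) = (\<Sum>C\<in>UNIV. th x C k * p A C) * u" for A u
    unfolding sum_distrib_right by (simp add: mult_ac)
  have 3: "(\<Sum>B\<in>UNIV. th x B j * (v * w B)) = v * (\<Sum>B\<in>UNIV. th x B j * w B)" for v w
    by (simp add: sum_distrib_left mult_ac)
  show ?thesis
    unfolding lower_def 1 2 3 by (simp add: sum_distrib_right mult.assoc)
qed

lemma lower_product_14_23: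
  "lower x (\<lambda>A B C D. p A D * q B C) i j k l
   = (\<Sum>A\<in>UNIV. th x A i * (\<Sum>D\<in>UNIV. th x D l * p A D))
     * (\<Sum>B\<in>UNIV. th x B j * (\<Sum>C\<in>UNIV. th x C k * q B C))"
proof -
  have 1: "(\<Sum>D\<in>UNIV. th x D l * (p A D * u)) = (\<Sum>D\<in>UNIV. th x D l * p A D) * u" for A u
    unfolding sum_distrib_right by (simp add: mult_ac)
  have 3: "(\<Sum>B\<in>UNIV. th x B j * (v * w B)) = v * (\<Sum>B\<in>UNIV. th x B j * w B)" for v w j
    by (simp add: sum_distrib_left mult_ac)
  show ?thesis
    unfolding lower_def 1 3 by (simp add: sum_distrib_right mult.assoc)
qed

lemma metric_frame_delta:
  assumes "x \<in> S"
  shows "g x $ i $ j = (\<Sum>A\<in>UNIV. th x A i * (\<Sum>B\<in>UNIV. th x B j * frame_delta (G x) A B))"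
  unfolding metric[OF assms] frame_delta_def
  by (simp add: sum_delta_mult mult_ac)

lemma weyl_eq:
  assumes "x \<in> S"
  shows "weyl g x i j k l = lower x (frame_weyl x) i j k l"
proof -
  let ?d = "frame_delta (G x)" and ?R = "frame_ricci x"
  have linear: "lower x (\<lambda>A B C D. f1 A B C D
        - 1/2 * (f2 A B C D - f3 A B C D - f4 A B C D + f5 A B C D)
        + c * (f6 A B C D - f7 A B C D)) i j k l
      = lower x f1 i j k l - 1/2 * (lower x f2 i j k l - lower x f3 i j k l - lower x f4 i j k l
          + lower x f5 i j k l) + c * (lower x f6 i j k l - lower x f7 i j k l)"
    for f1 f2 f3 f4 f5 f6 f7 c
    unfolding lower_def by (simp add: algebra_simps sum.distrib sum_subtractf sum_distrib_left sum_divide_distrib)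
  show ?thesis
    unfolding weyl_def riemann_eq[OF assms] metric_frame_delta[OF assms] ricci_eq[OF assms]
      scalar_curvature_eq[OF assms] frame_weyl_def Let_def linear
      lower_product_13_24 lower_product_14_23
    by (simp only: mult.commute)
qed

text \<open>
  The Weyl tensor is the only trace-free part: the remainder of the curvature has the shape
  of the metric wedged with a symmetric tensor, which the trace terms in its definition cancel.
\<close>

lemma frame_weyl_typeD:
  assumes "x \<in> S" and sym: "\<And>A B. P A B = P B A"
    and riem: "\<And>A B C D. G x A * frame_riemann x A B C D = typeD_weyl (G x) \<sigma> X Z A B C D
       + (frame_delta (G x) A C * P B D - frame_delta (G x) A D * P B C
          - P A D * frame_delta (G x) B C + P A C * frame_delta (G x) B D)"
  shows "frame_weyl x A B C D = typeD_weyl (G x) \<sigma> X Z A B C D"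
proof -
  note nz = G_nonzero[OF \<open>x \<in> S\<close>]
  define \<tau> where "\<tau> = (\<Sum>A\<in>UNIV. P A A / G x A)"
  \<comment> \<open>In dimension 4 the trace of the metric wedged with \<open>P\<close> is (4 - 2)
    \<open>P\<close> plus the trace of \<open>P\<close> times the metric; tracing again gives (2 +
    4) \<open>\<tau>\<close>. Thus \<open>P\<close> is the Schouten tensor.\<close>
  have ric: "frame_ricci x B D = 2 * P B D + \<tau> * frame_delta (G x) B D" for B D
  proof -
    have "frame_ricci x B D = (\<Sum>A\<in>UNIV. typeD_weyl (G x) \<sigma> X Z A B A D / G x A
        + (frame_delta (G x) A A * P B D - frame_delta (G x) A D * P B A
          - P A D * frame_delta (G x) B A + P A A * frame_delta (G x) B D) / G x A)"
      unfolding frame_ricci_def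
    proof (rule sum.cong[OF refl])
      fix A
      show "frame_riemann x A B A D = typeD_weyl (G x) \<sigma> X Z A B A D / G x A
        + (frame_delta (G x) A A * P B D - frame_delta (G x) A D * P B A
          - P A D * frame_delta (G x) B A + P A A * frame_delta (G x) B D) / G x A"
        using riem[of A B A D] nz[of A] by (simp add: field_simps)
    qed
    also have "\<dots> = (\<Sum>A\<in>UNIV. (frame_delta (G x) A A * P B D - frame_delta (G x) A D * P B A
          - P A D * frame_delta (G x) B A + P A A * frame_delta (G x) B D) / G x A)"
      by (simp only: sum.distrib typeD_weyl_trace[OF nz])
    also have "\<dots> = 2 * P B D + \<tau> * frame_delta (G x) B D"
      using exhaust_4[of B] exhaust_4[of D] nz
      by (elim disjE) (simp_all add: \<tau>_def sum_4 sym diff_divide_distrib add_divide_distrib distrib_right)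
    finally show ?thesis .
  qed
  have "frame_scalar x = (\<Sum>A\<in>UNIV. 2 * (P A A / G x A) + \<tau>)"
    unfolding frame_scalar_def ric by (simp add: nz add_divide_distrib)
  also have "\<dots> = 6 * \<tau>"
    by (simp add: \<tau>_def sum_4)
  finally have sc: "frame_scalar x = 6 * \<tau>" .
  show ?thesis
    unfolding frame_weyl_def Let_def riem ric sc by (simp add: algebra_simps)
qed

end

section \<open>The invariants in a moving frame\<close>

lemma sum_swap_out_2:
  fixes f :: "4 \<Rightarrow> 4 \<Rightarrow> 4 \<Rightarrow> real"
  shows "(\<Sum>k\<in>UNIV. \<Sum>l\<in>UNIV. \<Sum>A\<in>UNIV. f k l A) = (\<Sum>A\<in>UNIV. \<Sum>k\<in>UNIV. \<Sum>l\<in>UNIV. f k l A)"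
proof -
  have "(\<Sum>k\<in>UNIV. \<Sum>l\<in>UNIV. \<Sum>A\<in>UNIV. f k l A) = (\<Sum>k\<in>UNIV. \<Sum>A\<in>UNIV. \<Sum>l\<in>UNIV. f k l A)"
    by (intro sum.cong refl sum.swap)
  then show ?thesis using sum.swap by (rule trans)
qed

lemma sum_swap_2_2:
  fixes f :: "4 \<Rightarrow> 4 \<Rightarrow> 4 \<Rightarrow> 4 \<Rightarrow> real"
  shows "(\<Sum>k\<in>UNIV. \<Sum>l\<in>UNIV. \<Sum>A\<in>UNIV. \<Sum>B\<in>UNIV. f k l A B)
    = (\<Sum>A\<in>UNIV. \<Sum>B\<in>UNIV. \<Sum>k\<in>UNIV. \<Sum>l\<in>UNIV. f k l A B)"
  by (subst sum_swap_out_2, rule sum.cong[OF refl], rule sum_swap_out_2)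

lemma sum_swap_out_4:
  fixes f :: "4 \<Rightarrow> 4 \<Rightarrow> 4 \<Rightarrow> 4 \<Rightarrow> 4 \<Rightarrow> real"
  shows "(\<Sum>i\<in>UNIV. \<Sum>j\<in>UNIV. \<Sum>k\<in>UNIV. \<Sum>l\<in>UNIV. \<Sum>A\<in>UNIV. f i j k l A)
    = (\<Sum>A\<in>UNIV. \<Sum>i\<in>UNIV. \<Sum>j\<in>UNIV. \<Sum>k\<in>UNIV. \<Sum>l\<in>UNIV. f i j k l A)"
proof -
  have "(\<Sum>i\<in>UNIV. \<Sum>j\<in>UNIV. \<Sum>k\<in>UNIV. \<Sum>l\<in>UNIV. \<Sum>A\<in>UNIV. f i j k l A)
      = (\<Sum>i\<in>UNIV. \<Sum>j\<in>UNIV. \<Sum>A\<in>UNIV. \<Sum>k\<in>UNIV. \<Sum>l\<in>UNIV. f i j k l A)"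
    by (intro sum.cong refl sum_swap_out_2)
  then show ?thesis using sum_swap_out_2 by (rule trans)
qed

lemma sum_swap_4_4:
  fixes f :: "4 \<Rightarrow> 4 \<Rightarrow> 4 \<Rightarrow> 4 \<Rightarrow> 4 \<Rightarrow> 4 \<Rightarrow> 4 \<Rightarrow> 4 \<Rightarrow> real"
  shows "(\<Sum>i\<in>UNIV. \<Sum>j\<in>UNIV. \<Sum>k\<in>UNIV. \<Sum>l\<in>UNIV.
      \<Sum>A\<in>UNIV. \<Sum>B\<in>UNIV. \<Sum>C\<in>UNIV. \<Sum>D\<in>UNIV. f i j k l A B C D)
    = (\<Sum>A\<in>UNIV. \<Sum>B\<in>UNIV. \<Sum>C\<in>UNIV. \<Sum>D\<in>UNIV.
      \<Sum>i\<in>UNIV. \<Sum>j\<in>UNIV. \<Sum>k\<in>UNIV. \<Sum>l\<in>UNIV. f i j k l A B C D)"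
  by (rule trans[OF sum_swap_out_4], rule sum.cong[OF refl], rule trans[OF sum_swap_out_4],
      rule sum.cong[OF refl], rule trans[OF sum_swap_out_4], rule sum.cong[OF refl],
      rule sum_swap_out_4)

context moving_frame begin

definition upper :: "real^4 \<Rightarrow> (4 \<Rightarrow> 4 \<Rightarrow> 4 \<Rightarrow> 4 \<Rightarrow> real) \<Rightarrow> 4 \<Rightarrow> 4 \<Rightarrow> 4 \<Rightarrow> 4 \<Rightarrow> real" where
  "upper x f i j k l = (\<Sum>A\<in>UNIV. e x A i * (\<Sum>B\<in>UNIV. e x B j *
    (\<Sum>C\<in>UNIV. e x C k * (\<Sum>D\<in>UNIV. e x D l * f A B C D))))"

lemma raise2:
  assumes "x \<in> S"
  shows "(\<Sum>p\<in>UNIV. \<Sum>q\<in>UNIV. inv_metric g x i p * inv_metric g x j q *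
      (\<Sum>A\<in>UNIV. th x A p * (\<Sum>B\<in>UNIV. th x B q * f A B)))
    = (\<Sum>A\<in>UNIV. e x A i * (\<Sum>B\<in>UNIV. e x B j * (f A B / (G x A * G x B))))"
proof -
  have "(\<Sum>q\<in>UNIV. inv_metric g x j q * (\<Sum>A\<in>UNIV. th x A p * (\<Sum>B\<in>UNIV. th x B q * f A B)))
      = (\<Sum>A\<in>UNIV. th x A p * (\<Sum>q\<in>UNIV. inv_metric g x j q * (\<Sum>B\<in>UNIV. th x B q * f A B)))" for p
  proof -
    have "(\<Sum>q\<in>UNIV. inv_metric g x j q * (\<Sum>A\<in>UNIV. th x A p * v A q))
        = (\<Sum>A\<in>UNIV. th x A p * (\<Sum>q\<in>UNIV. inv_metric g x j q * v A q))" for v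
      unfolding sum_distrib_left by (subst sum.swap) (simp add: mult_ac)
    then show ?thesis .
  qed
  then have "(\<Sum>p\<in>UNIV. \<Sum>q\<in>UNIV. inv_metric g x i p * inv_metric g x j q *
      (\<Sum>A\<in>UNIV. th x A p * (\<Sum>B\<in>UNIV. th x B q * f A B)))
      = (\<Sum>A\<in>UNIV. e x A i * ((\<Sum>B\<in>UNIV. e x B j * (f A B / G x B)) / G x A))"
    by (simp add: mult.assoc sum_distrib_left[symmetric] raise[OF assms])
  then show ?thesis
    by (simp add: sum_divide_distrib mult.commute)
qed

lemma weyl_mixed_eq:
  assumes "x \<in> S"
  shows "weyl_mixed g x i j k l = (\<Sum>A\<in>UNIV. e x A i * (\<Sum>B\<in>UNIV. e x B j *
    (\<Sum>C\<in>UNIV. th x C k * (\<Sum>D\<in>UNIV. th x D l * (frame_weyl x A B C D / (G x A * G x B))))))"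
  unfolding weyl_mixed_def weyl_eq[OF assms] lower_def raise2[OF assms]
  by (simp only: sum_divide_distrib times_divide_eq_right[symmetric])

lemma weyl_up_eq:
  assumes "x \<in> S"
  shows "weyl_up g x i j k l
    = upper x (\<lambda>A B C D. frame_weyl x A B C D / (G x A * G x B * G x C * G x D)) i j k l"
proof -
  let ?u = "\<lambda>A B p q. \<Sum>C\<in>UNIV. th x C p * (\<Sum>D\<in>UNIV. th x D q * (frame_weyl x A B C D / (G x A * G x B)))"
  have dist: "c * (\<Sum>A\<in>UNIV. e x A i * (\<Sum>B\<in>UNIV. e x B j * v A B))
      = (\<Sum>A\<in>UNIV. \<Sum>B\<in>UNIV. e x A i * e x B j * (c * v A B))" for c v
    by (simp add: sum_distrib_left mult_ac)
  have "weyl_up g x i j k l = (\<Sum>p\<in>UNIV. \<Sum>q\<in>UNIV. \<Sum>A\<in>UNIV. \<Sum>B\<in>UNIV.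
      e x A i * e x B j * (inv_metric g x k p * inv_metric g x l q * ?u A B p q))"
    unfolding weyl_up_def weyl_mixed_eq[OF assms]
    by (simp only: dist)
  also have "\<dots> = (\<Sum>A\<in>UNIV. \<Sum>B\<in>UNIV. \<Sum>p\<in>UNIV. \<Sum>q\<in>UNIV.
      e x A i * e x B j * (inv_metric g x k p * inv_metric g x l q * ?u A B p q))"
    by (rule sum_swap_2_2)
  also have "\<dots> = (\<Sum>A\<in>UNIV. \<Sum>B\<in>UNIV. e x A i * e x B j * (\<Sum>p\<in>UNIV. \<Sum>q\<in>UNIV.
      inv_metric g x k p * inv_metric g x l q * ?u A B p q))"
    by (simp only: sum_distrib_left)
  finally show ?thesis
    unfolding raise2[OF assms] upper_def by (simp add: sum_distrib_left mult_ac)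
qed

lemma pair:
  assumes "x \<in> S"
  shows "(\<Sum>i\<in>UNIV. (\<Sum>A\<in>UNIV. th x A i * f A) * (\<Sum>B\<in>UNIV. e x B i * h B)) = (\<Sum>A\<in>UNIV. f A * h A)"
proof -
  have "(\<Sum>i\<in>UNIV. (\<Sum>A\<in>UNIV. th x A i * f A) * (\<Sum>B\<in>UNIV. e x B i * h B))
      = (\<Sum>A\<in>UNIV. f A * (\<Sum>i\<in>UNIV. th x A i * (\<Sum>B\<in>UNIV. e x B i * h B)))"
    unfolding sum_distrib_left[of "f _"] sum_distrib_right by (subst sum.swap) (simp add: mult_ac)
  then show ?thesis by (simp add: th_e_contract[OF assms])
qed

lemma pair2:
  assumes "x \<in> S"
  shows "(\<Sum>k\<in>UNIV. \<Sum>l\<in>UNIV. (\<Sum>C\<in>UNIV. th x C k * (\<Sum>D\<in>UNIV. th x D l * f C D))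
      * (\<Sum>C\<in>UNIV. e x C k * (\<Sum>D\<in>UNIV. e x D l * h C D)))
    = (\<Sum>C\<in>UNIV. \<Sum>D\<in>UNIV. f C D * h C D)"
proof -
  have "(\<Sum>k\<in>UNIV. \<Sum>l\<in>UNIV. (\<Sum>C\<in>UNIV. th x C k * (\<Sum>D\<in>UNIV. th x D l * f C D))
      * (\<Sum>C\<in>UNIV. e x C k * (\<Sum>D\<in>UNIV. e x D l * h C D)))
    = (\<Sum>l\<in>UNIV. \<Sum>C\<in>UNIV. (\<Sum>D\<in>UNIV. th x D l * f C D) * (\<Sum>D\<in>UNIV. e x D l * h C D))"
    by (subst sum.swap) (simp add: pair[OF assms])
  also have "\<dots> = (\<Sum>C\<in>UNIV. \<Sum>D\<in>UNIV. f C D * h C D)"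
    by (subst sum.swap) (simp add: pair[OF assms])
  finally show ?thesis .
qed

lemma pair4:
  assumes "x \<in> S"
  shows "(\<Sum>i\<in>UNIV. \<Sum>j\<in>UNIV. \<Sum>k\<in>UNIV. \<Sum>l\<in>UNIV. lower x f i j k l * upper x h i j k l)
    = (\<Sum>A\<in>UNIV. \<Sum>B\<in>UNIV. \<Sum>C\<in>UNIV. \<Sum>D\<in>UNIV. f A B C D * h A B C D)"
proof -
  have "(\<Sum>i\<in>UNIV. \<Sum>j\<in>UNIV. \<Sum>k\<in>UNIV. \<Sum>l\<in>UNIV. lower x f i j k l * upper x h i j k l)
    = (\<Sum>k\<in>UNIV. \<Sum>l\<in>UNIV. \<Sum>i\<in>UNIV. \<Sum>j\<in>UNIV. lower x f i j k l * upper x h i j k l)"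
    by (rule sum_swap_2_2)
  also have "\<dots> = (\<Sum>k\<in>UNIV. \<Sum>l\<in>UNIV. \<Sum>A\<in>UNIV. \<Sum>B\<in>UNIV.
      (\<Sum>C\<in>UNIV. th x C k * (\<Sum>D\<in>UNIV. th x D l * f A B C D))
      * (\<Sum>C\<in>UNIV. e x C k * (\<Sum>D\<in>UNIV. e x D l * h A B C D)))"
    unfolding lower_def upper_def by (simp only: pair2[OF assms])
  also have "\<dots> = (\<Sum>A\<in>UNIV. \<Sum>B\<in>UNIV. \<Sum>k\<in>UNIV. \<Sum>l\<in>UNIV.
      (\<Sum>C\<in>UNIV. th x C k * (\<Sum>D\<in>UNIV. th x D l * f A B C D))
      * (\<Sum>C\<in>UNIV. e x C k * (\<Sum>D\<in>UNIV. e x D l * h A B C D)))"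
    by (rule sum_swap_2_2)
  finally show ?thesis
    by (simp only: pair2[OF assms])
qed

lemma I1_eq:
  assumes "x \<in> S"
  shows "I1 g x = (\<Sum>A\<in>UNIV. \<Sum>B\<in>UNIV. \<Sum>C\<in>UNIV. \<Sum>D\<in>UNIV.
    frame_weyl x A B C D * (frame_weyl x A B C D / (G x A * G x B * G x C * G x D)))"
  unfolding I1_def weyl_eq[OF assms] weyl_up_eq[OF assms] by (rule pair4[OF assms])

lemma abs_det_metric:
  assumes "x \<in> S"
  shows "\<bar>det (g x)\<bar> = \<bar>G x 1 * G x 2 * G x 3 * G x 4\<bar> * (det (\<chi> A i. th x A i))\<^sup>2"
    and "det (\<chi> A i. th x A i) * det (\<chi> A i. e x A i) = 1"
proof -
  let ?T = "\<chi> A i. th x A i" and ?E = "\<chi> A i. e x A i" and ?D = "\<chi> A B. if A = B then G x A else 0"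
  have "g x = transpose ?T ** (?D ** ?T)"
    by (simp add: vec_eq_iff matrix_matrix_mult_def transpose_def metric[OF assms] sum_delta_mult mult_ac)
  then have "det (g x) = det ?T * (det ?D * det ?T)"
    by (simp add: det_mul)
  moreover have "det ?D = G x 1 * G x 2 * G x 3 * G x 4"
    by (subst det_diagonal) (simp_all add: prod_4)
  ultimately show "\<bar>det (g x)\<bar> = \<bar>G x 1 * G x 2 * G x 3 * G x 4\<bar> * (det ?T)\<^sup>2"
    by (simp add: abs_mult power2_eq_square)
  have "?T ** transpose ?E = mat 1"
    by (simp add: vec_eq_iff matrix_matrix_mult_def transpose_def mat_def th_e[OF assms])
  then have "det (?T ** transpose ?E) = 1" by simp
  then show "det ?T * det ?E = 1" by (simp add: det_mul)
qed

text \<open>The symbol contracted with the frame produces \<open>det e\<close>, while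
  \<open>sqrt |det g|\<close> contains \<open>|det th|\<close>. As the two determinants are inverse
  to each other, only the orientation sign of the coframe and the frame lengths remain.\<close>

lemma I2_eq:
  assumes "x \<in> S"
  shows "I2 \<epsilon> g x = 1/2 * \<epsilon> * sqrt \<bar>G x 1 * G x 2 * G x 3 * G x 4\<bar> * sgn (det (\<chi> A i. th x A i))
    * (\<Sum>A\<in>UNIV. \<Sum>B\<in>UNIV. \<Sum>S\<in>UNIV. \<Sum>T\<in>UNIV. levi_civita_symbol A B S T *
      (\<Sum>C\<in>UNIV. \<Sum>D\<in>UNIV. frame_weyl x S T C D / (G x S * G x T)
        * (frame_weyl x A B C D / (G x A * G x B * G x C * G x D))))"
proof -
  define W where "W S T C D = frame_weyl x S T C D / (G x S * G x T)" for S T C D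
  define U where "U A B C D = frame_weyl x A B C D / (G x A * G x B * G x C * G x D)" for A B C D
  define N where "N A B S T = (\<Sum>C\<in>UNIV. \<Sum>D\<in>UNIV. W S T C D * U A B C D)" for A B S T
  let ?c = "1/2 * (\<epsilon> * sqrt \<bar>det (g x)\<bar>)"
  have contr: "(\<Sum>k\<in>UNIV. \<Sum>l\<in>UNIV. weyl_mixed g x s t k l * weyl_up g x i j k l)
      = (\<Sum>A\<in>UNIV. \<Sum>B\<in>UNIV. \<Sum>S\<in>UNIV. \<Sum>T\<in>UNIV. e x A i * e x B j * e x S s * e x T t * N A B S T)"
    for i j s t
  proof -
    let ?w = "\<lambda>S T k l. \<Sum>C\<in>UNIV. th x C k * (\<Sum>D\<in>UNIV. th x D l * W S T C D)"
    let ?u = "\<lambda>A B k l. \<Sum>C\<in>UNIV. e x C k * (\<Sum>D\<in>UNIV. e x D l * U A B C D)"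
    have dist: "(\<Sum>S\<in>UNIV. e x S s * (\<Sum>T\<in>UNIV. e x T t * w S T)) * (\<Sum>A\<in>UNIV. e x A i * (\<Sum>B\<in>UNIV. e x B j * u A B))
      = (\<Sum>A\<in>UNIV. \<Sum>B\<in>UNIV. \<Sum>S\<in>UNIV. \<Sum>T\<in>UNIV. e x A i * e x B j * e x S s * e x T t * (w S T * u A B))"
      for w u
      unfolding sum_distrib_left sum_distrib_right by (simp add: mult_ac)
    have "(\<Sum>k\<in>UNIV. \<Sum>l\<in>UNIV. weyl_mixed g x s t k l * weyl_up g x i j k l)
      = (\<Sum>k\<in>UNIV. \<Sum>l\<in>UNIV. \<Sum>A\<in>UNIV. \<Sum>B\<in>UNIV. \<Sum>S\<in>UNIV. \<Sum>T\<in>UNIV.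
          e x A i * e x B j * e x S s * e x T t * (?w S T k l * ?u A B k l))"
      unfolding weyl_mixed_eq[OF assms] weyl_up_eq[OF assms] upper_def W_def[symmetric] U_def[symmetric] dist ..
    also have "\<dots> = (\<Sum>A\<in>UNIV. \<Sum>B\<in>UNIV. \<Sum>S\<in>UNIV. \<Sum>T\<in>UNIV. \<Sum>k\<in>UNIV. \<Sum>l\<in>UNIV.
          e x A i * e x B j * e x S s * e x T t * (?w S T k l * ?u A B k l))"
      by (rule trans[OF sum_swap_2_2], rule sum.cong[OF refl], rule sum.cong[OF refl], rule sum_swap_2_2)
    finally show ?thesis
      by (simp only: sum_distrib_left[symmetric] pair2[OF assms] N_def)
  qed
  have "I2 \<epsilon> g x = (\<Sum>i\<in>UNIV. \<Sum>j\<in>UNIV. \<Sum>k\<in>UNIV. \<Sum>l\<in>UNIV. \<Sum>s\<in>UNIV. \<Sum>t\<in>UNIV.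
      ?c * levi_civita_symbol i j s t * (weyl_mixed g x s t k l * weyl_up g x i j k l))"
    unfolding I2_def dual_weyl_def levi_civita_def
    by (simp add: sum_distrib_left sum_distrib_right mult_ac)
  also have "\<dots> = (\<Sum>i\<in>UNIV. \<Sum>j\<in>UNIV. \<Sum>s\<in>UNIV. \<Sum>t\<in>UNIV. \<Sum>k\<in>UNIV. \<Sum>l\<in>UNIV.
      ?c * levi_civita_symbol i j s t * (weyl_mixed g x s t k l * weyl_up g x i j k l))"
    by (rule sum.cong[OF refl], rule sum.cong[OF refl], rule sum_swap_2_2)
  also have "\<dots> = (\<Sum>i\<in>UNIV. \<Sum>j\<in>UNIV. \<Sum>s\<in>UNIV. \<Sum>t\<in>UNIV. \<Sum>A\<in>UNIV. \<Sum>B\<in>UNIV. \<Sum>S\<in>UNIV. \<Sum>T\<in>UNIV.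
      ?c * N A B S T * (levi_civita_symbol i j s t * (e x A i * e x B j * e x S s * e x T t)))"
    unfolding sum_distrib_left[symmetric] contr
    by (simp add: sum_distrib_left mult_ac)
  also have "\<dots> = (\<Sum>A\<in>UNIV. \<Sum>B\<in>UNIV. \<Sum>S\<in>UNIV. \<Sum>T\<in>UNIV. \<Sum>i\<in>UNIV. \<Sum>j\<in>UNIV. \<Sum>s\<in>UNIV. \<Sum>t\<in>UNIV.
      ?c * N A B S T * (levi_civita_symbol i j s t * (e x A i * e x B j * e x S s * e x T t)))"
    by (rule sum_swap_4_4)
  also have "\<dots> = (\<Sum>A\<in>UNIV. \<Sum>B\<in>UNIV. \<Sum>S\<in>UNIV. \<Sum>T\<in>UNIV.
      ?c * det (\<chi> A i. e x A i) * (levi_civita_symbol A B S T * N A B S T))"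
    by (rule sum.cong[OF refl], rule sum.cong[OF refl], rule sum.cong[OF refl], rule sum.cong[OF refl],
        simp only: sum_distrib_left[symmetric] levi_civita_symbol_frame) simp
  also have "\<dots> = ?c * det (\<chi> A i. e x A i) *
      (\<Sum>A\<in>UNIV. \<Sum>B\<in>UNIV. \<Sum>S\<in>UNIV. \<Sum>T\<in>UNIV. levi_civita_symbol A B S T * N A B S T)"
    by (simp only: sum_distrib_left)
  also have "?c * det (\<chi> A i. e x A i) = 1/2 * \<epsilon> * sqrt \<bar>G x 1 * G x 2 * G x 3 * G x 4\<bar>
      * (\<bar>det (\<chi> A i. th x A i)\<bar> * det (\<chi> A i. e x A i))"
    unfolding abs_det_metric(1)[OF assms] real_sqrt_mult by simp
  also have "\<bar>det (\<chi> A i. th x A i)\<bar> * det (\<chi> A i. e x A i) = sgn (det (\<chi> A i. th x A i))"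
    using abs_det_metric(2)[OF assms] by (simp add: abs_sgn mult_ac)
  finally show ?thesis
    unfolding N_def W_def U_def by simp
qed

end

section \<open>Curvature of Carter's form of the metric\<close>

definition carter_gram :: "real \<Rightarrow> real \<Rightarrow> 4 \<Rightarrow> real" where
  "carter_gram f e A = (vector [- f, 1 / f, 1 / e, e] :: real^4) $ A"

text \<open>
  Connection coefficients of $\Omega^{-2}(-f\eta_1^2 + f^{-1}\eta_2^2 + e^{-1}\eta_3^2 + e\eta_4^2)$
  with $\eta_1 = dt - a(1-c^2)\,d\phi$, $\eta_2 = dr$, $\eta_3 = dc$,
  $\eta_4 = a\,dt - (r^2+a^2)\,d\phi$, $c = \cos\theta$. With $R = r^2+a^2c^2$, $f = Q(r)/R$
  and $e = Y(c)/R$ the remaining symbols are $h = Q'/2Q$, $k = Y'/2Y$, $u = r/R$, $v = ac/R$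
  and the components $y$, $z$ of $-d\ln\Omega$ along $dr$, $dc$. Their derivatives are
  polynomials in the same symbols, see \<open>carter_curvature\<close>, which turns the curvature into
  polynomial algebra.
\<close>

definition carter_conn ::
  "real \<Rightarrow> real \<Rightarrow> real \<Rightarrow> real \<Rightarrow> real \<Rightarrow> real \<Rightarrow> real \<Rightarrow> real \<Rightarrow> real \<Rightarrow> 4 \<Rightarrow> 4 \<Rightarrow> 4 \<Rightarrow> real" where
  "carter_conn f e h k y z a u v C A B = (vector
    [vector
      [vector [0, h + y - u, z + a * v, 0],
       vector [f\<^sup>2 * (h + y - u), 0, 0, a * u * (f * e)],
       vector [f * e * (z + a * v), 0, 0, - v * (f * e)],
       vector [0, - a * u, v * (f / e), 0]],
     vector
      [vector [h + y - u, 0, 0, a * u * (e / f)],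
       vector [0, - h + y + u, z + a * v, 0],
       vector [0, - (e / f) * (z + a * v), y + u, 0],
       vector [a * u, 0, 0, y - u]],
     vector
      [vector [z - a * v, 0, 0, v],
       vector [0, z + a * v, - (f / e) * (y + u), 0],
       vector [0, y + u, - k + z + a * v, 0],
       vector [v * (f / e), 0, 0, k + z - a * v]],
     vector
      [vector [0, a * u * (e / f), - v, 0],
       vector [a * u * (f * e), 0, 0, - (f * e) * (y + u)],
       vector [- v * (f * e), 0, 0, - e\<^sup>2 * (k + z - a * v)],
       vector [0, y + u, k + z - a * v, 0]]] :: real^4^4^4) $ C $ A $ B"

text \<open>Entrywise product rule for \<open>carter_conn\<close> with primed arguments as
  derivatives of the symbols and \<open>a\<close> constant; one table serves both the
  \<open>r\<close> and the \<open>c\<close> direction.\<close>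

definition carter_dconn ::
  "real \<Rightarrow> real \<Rightarrow> real \<Rightarrow> real \<Rightarrow> real \<Rightarrow> real \<Rightarrow> real \<Rightarrow> real \<Rightarrow> real \<Rightarrow>
   real \<Rightarrow> real \<Rightarrow> real \<Rightarrow> real \<Rightarrow> real \<Rightarrow> real \<Rightarrow> real \<Rightarrow> real \<Rightarrow> 4 \<Rightarrow> 4 \<Rightarrow> 4 \<Rightarrow> real" where
  "carter_dconn f e h k y z a u v f' e' h' k' y' z' u' v' C A B =
    (let fe = f' * e + f * e'; foe = (f' * e - f * e') / e\<^sup>2; eof = (e' * f - e * f') / f\<^sup>2 in (vector
    [vector
      [vector [0, h' + y' - u', z' + a * v', 0],
       vector [2 * f * f' * (h + y - u) + f\<^sup>2 * (h' + y' - u'), 0, 0, a * u' * (f * e) + a * u * fe],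
       vector [fe * (z + a * v) + f * e * (z' + a * v'), 0, 0, - v' * (f * e) - v * fe],
       vector [0, - a * u', v' * (f / e) + v * foe, 0]],
     vector
      [vector [h' + y' - u', 0, 0, a * u' * (e / f) + a * u * eof],
       vector [0, - h' + y' + u', z' + a * v', 0],
       vector [0, - eof * (z + a * v) - (e / f) * (z' + a * v'), y' + u', 0],
       vector [a * u', 0, 0, y' - u']],
     vector
      [vector [z' - a * v', 0, 0, v'],
       vector [0, z' + a * v', - foe * (y + u) - (f / e) * (y' + u'), 0],
       vector [0, y' + u', - k' + z' + a * v', 0],
       vector [v' * (f / e) + v * foe, 0, 0, k' + z' - a * v']],
     vector
      [vector [0, a * u' * (e / f) + a * u * eof, - v', 0],
       vector [a * u' * (f * e) + a * u * fe, 0, 0, - fe * (y + u) - (f * e) * (y' + u')],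
       vector [- v' * (f * e) - v * fe, 0, 0, - 2 * e * e' * (k + z - a * v) - e\<^sup>2 * (k' + z' - a * v')],
       vector [0, y' + u', k' + z' - a * v', 0]]] :: real^4^4^4) $ C $ A $ B)"

lemma carter_conn_deriv:
  fixes f e h k y z u v :: "real \<Rightarrow> real"
  assumes "f t \<noteq> 0" "e t \<noteq> 0"
    and [derivative_intros]: "(f has_real_derivative f') (at t)" "(e has_real_derivative e') (at t)"
    "(h has_real_derivative h') (at t)" "(k has_real_derivative k') (at t)"
    "(y has_real_derivative y') (at t)" "(z has_real_derivative z') (at t)"
    "(u has_real_derivative u') (at t)" "(v has_real_derivative v') (at t)"
  shows "((\<lambda>s. carter_conn (f s) (e s) (h s) (k s) (y s) (z s) a (u s) (v s) C A B)
    has_real_derivative carter_dconn (f t) (e t) (h t) (k t) (y t) (z t) a (u t) (v t)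
      f' e' h' k' y' z' u' v' C A B) (at t)"
proof -
  have "\<forall>C A B. ((\<lambda>s. carter_conn (f s) (e s) (h s) (k s) (y s) (z s) a (u s) (v s) C A B)
    has_real_derivative carter_dconn (f t) (e t) (h t) (k t) (y t) (z t) a (u t) (v t)
      f' e' h' k' y' z' u' v' C A B) (at t)"
    unfolding forall_4 carter_conn_def carter_dconn_def Let_def vector_4
    by (intro conjI) (use assms(1,2) in \<open>auto intro!: derivative_eq_intros simp: power2_eq_square field_simps\<close>)
  then show ?thesis by blast
qed

text \<open>
  The Schouten tensor. It absorbs every term that contains the conformal factor, in accordance
  with the conformal invariance of the Weyl tensor.
\<close>

definition carter_schouten ::
  "real \<Rightarrow> real \<Rightarrow> real \<Rightarrow> real \<Rightarrow> real \<Rightarrow> real \<Rightarrow> real \<Rightarrow> real \<Rightarrow> real \<Rightarrow> real \<Rightarrow> real \<Rightarrow> real \<Rightarrow> 4 \<Rightarrow> 4 \<Rightarrow> real" where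
  "carter_schouten f e h k y z a u v h' k' w A B =
    (let H = (h' + 2 * h\<^sup>2) / 6; K = (k' + 2 * k\<^sup>2) / 6; R = u\<^sup>2 + v\<^sup>2;
         s = f * (2 * H + R / 2 + h * y + y\<^sup>2 / 2 - h * u - u * y)
              + e * (- K + z\<^sup>2 / 2 - a\<^sup>2 * R / 2 + k * (a * v) + a * v * z);
         t = e * (- 2 * K - k * z - z\<^sup>2 / 2 - a\<^sup>2 * R / 2 + k * (a * v) + a * v * z)
              + f * (H + R / 2 - y\<^sup>2 / 2 - h * u - u * y)
     in (vector
      [vector [f * s, 0, 0, f * e * (a * u * y - v * z)],
       vector [0, - s / f, y * z - w + u * z + a * v * y, 0],
       vector [0, y * z - w + u * z + a * v * y, t / e, 0],
       vector [f * e * (a * u * y - v * z), 0, 0, e * t]] :: real^4^4) $ A $ B)"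

text \<open>Frame vectors 2 and 3 are the derivatives in \<open>r\<close> and \<open>c\<close>, and
  the arguments of \<open>carter_dconn\<close> are the derivative rules of the symbols; vectors 1
  and 4 annihilate functions of \<open>r\<close> and \<open>c\<close>. The Gram values omit the
  conformal factor and have product -1, hence \<open>\<sigma> = 1\<close>; the factor itself acts
  only through \<open>y\<close>, \<open>z\<close> and \<open>w\<close>, all of which end up in
  \<open>P\<close>.\<close>

lemma carter_curvature:
  fixes f e h k y z a u v h' k' w :: real
  defines "M \<equiv> carter_conn f e h k y z a u v"
    and "dr \<equiv> carter_dconn f e h k y z a u v (2 * f * (h - u)) (- 2 * u * e) h' 0 (y\<^sup>2) w
              (v\<^sup>2 - u\<^sup>2) (- 2 * u * v)"
    and "dc \<equiv> carter_dconn f e h k y z a u v (- 2 * (a * v) * f) (2 * e * (k - a * v)) 0 k' w (z\<^sup>2)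
              (- 2 * a * u * v) (a * (u\<^sup>2 - v\<^sup>2))"
    and "X \<equiv> f * ((h' + 2 * h\<^sup>2) / 3 - 2 * h * u + 2 * u\<^sup>2 - 2 * v\<^sup>2)
            + e * ((k' + 2 * k\<^sup>2) / 3 - 2 * k * (a * v) + 2 * a\<^sup>2 * (v\<^sup>2 - u\<^sup>2))"
    and "Z \<equiv> f * (2 * h * v - 4 * u * v) + e * (4 * a\<^sup>2 * u * v - 2 * k * (a * u))"
    and "P \<equiv> carter_schouten f e h k y z a u v h' k' w"
    and "G \<equiv> carter_gram f e"
  assumes "f \<noteq> 0" "e \<noteq> 0"
  shows "G A * frame_curvature M (\<lambda>D. if D = 2 then dr else if D = 3 then dc else (\<lambda>C A B. 0)) A B C D
    = typeD_weyl G 1 X Z A B C D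
       + (frame_delta G A C * P B D - frame_delta G A D * P B C
          - P A D * frame_delta G B C + P A C * frame_delta G B D)"
proof -
  let ?claim = "\<lambda>A B C D. G A * frame_curvature M (\<lambda>D. if D = 2 then dr else if D = 3 then dc else (\<lambda>C A B. 0)) A B C D
    = typeD_weyl G 1 X Z A B C D
       + (frame_delta G A C * P B D - frame_delta G A D * P B C
          - P A D * frame_delta G B C + P A C * frame_delta G B D)"
  \<comment> \<open>Antisymmetry in the last index pair reduces the claim to six pairs, each a
    polynomial identity once \<open>f\<close> and \<open>e\<close> are cleared from
    denominators.\<close>
  have ant: "?claim A B D C" if "?claim A B C D" for A B C D
  proof -
    have "frame_curvature N dN A B D C = - frame_curvature N dN A B C D" for N dN
      unfolding frame_curvature_def by (simp add: sum_subtractf left_diff_distrib)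
    then show ?thesis
      using that levi_civita_symbol_swap(3)[of A B C D] by (simp add: typeD_weyl_def algebra_simps)
  qed
  have dia: "?claim A B C C" for A B C
    by (simp add: frame_curvature_def typeD_weyl_def levi_civita_symbol_repeat)
  note defs = frame_curvature_def sum_4 typeD_weyl_def G_def carter_gram_def P_def carter_schouten_def
    M_def carter_conn_def dr_def dc_def carter_dconn_def Let_def X_def Z_def
    levi_civita_symbol_values levi_civita_symbol_repeat
  have 12: "\<forall>A B. ?claim A B 1 2"
    unfolding forall_4 using assms(8,9)
    by (intro conjI; simp add: defs; simp add: field_simps power2_eq_square power4_eq_xxxx)
  have 13: "\<forall>A B. ?claim A B 1 3"
    unfolding forall_4 using assms(8,9)
    by (intro conjI; simp add: defs; simp add: field_simps power2_eq_square power4_eq_xxxx)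
  have 14: "\<forall>A B. ?claim A B 1 4"
    unfolding forall_4 using assms(8,9)
    by (intro conjI; simp add: defs; simp add: field_simps power2_eq_square power4_eq_xxxx)
  have 23: "\<forall>A B. ?claim A B 2 3"
    unfolding forall_4 using assms(8,9)
    by (intro conjI; simp add: defs; simp add: field_simps power2_eq_square power4_eq_xxxx)
  have 24: "\<forall>A B. ?claim A B 2 4"
    unfolding forall_4 using assms(8,9)
    by (intro conjI; simp add: defs; simp add: field_simps power2_eq_square power4_eq_xxxx)
  have 34: "\<forall>A B. ?claim A B 3 4"
    unfolding forall_4 using assms(8,9)
    by (intro conjI; simp add: defs; simp add: field_simps power2_eq_square power4_eq_xxxx)
  show ?thesis
    using exhaust_4[of C] exhaust_4[of D] 12 13 14 23 24 34 dia ant by blast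
qed

section \<open>Carter's coframe as a moving frame in the coordinate chart\<close>

lemma has_partial_deriv_rc:
  assumes "((\<lambda>r. F r (cos (x $ 3))) has_real_derivative Fr) (at (x $ 2))"
    and "((\<lambda>c. F (x $ 2) c) has_real_derivative Fc) (at (cos (x $ 3)))"
  shows "has_partial_deriv (\<lambda>y. F (y $ 2) (cos (y $ 3)))
    (if k = 2 then Fr else if k = 3 then - sin (x $ 3) * Fc else 0) k x"
proof -
  have "((\<lambda>s. F (x $ 2 + s) (cos (x $ 3))) has_real_derivative Fr) (at 0)"
    using DERIV_shift[of "\<lambda>r. F r (cos (x $ 3))" Fr 0 "x $ 2"] assms(1) by (simp add: add.commute)
  moreover have "((\<lambda>s. F (x $ 2) (cos (x $ 3 + s))) has_real_derivative Fc * (- sin (x $ 3))) (at 0)"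
  proof -
    have "((\<lambda>c. F (x $ 2) c) has_real_derivative Fc) (at (cos (x $ 3 + 0)))"
      using assms(2) by simp
    moreover have "((\<lambda>s. cos (x $ 3 + s)) has_real_derivative - sin (x $ 3)) (at 0)"
      by (auto intro!: derivative_eq_intros)
    ultimately show ?thesis by (rule DERIV_chain2)
  qed
  ultimately show ?thesis
    using exhaust_4[of k] unfolding has_partial_deriv_def
    by (elim disjE) (simp_all add: axis_def mult.commute)
qed

lemma DERIV_divide_eq:
  fixes f g :: "real \<Rightarrow> real"
  assumes "(f has_real_derivative f') (at t)" "(g has_real_derivative g') (at t)" "g t \<noteq> 0"
    and "D = (f' * g t - f t * g') / (g t)\<^sup>2"
  shows "((\<lambda>s. f s / g s) has_real_derivative D) (at t)"
  using DERIV_divide[OF assms(1-3)] assms(4) by (simp add: power2_eq_square)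

lemma carter_conn_compatible:
  assumes "f \<noteq> 0" "e \<noteq> 0"
  shows "carter_gram f e A * carter_conn f e h k y z a u v C A B
      + carter_gram f e B * carter_conn f e h k y z a u v C B A
    = (if A = B then 2 * carter_gram f e A * carter_conn f e h k y z a u v C A A else 0)"
proof (cases "A = B")
  case False
  then show ?thesis
    using exhaust_4[of A] exhaust_4[of B] exhaust_4[of C] assms
    unfolding carter_gram_def carter_conn_def
    by (elim disjE) (simp_all add: field_simps power2_eq_square)
qed simp

text \<open>Structure equations of the coframe: the second and third forms are closed, and the
  exterior derivatives of the others, 2ac dc wedge dphi and -2r dr wedge dphi, become these
  coefficients when dphi is written as (a eta_1 - eta_4) / R.\<close>

lemma carter_conn_torsion:
  "carter_conn f e h k y z a u v B A C - carter_conn f e h k y z a u v C A B =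
    (if A = 1 then 
       (if C = 3 \<and> B = 1 then 2 * a * v else if C = 1 \<and> B = 3 then - 2 * a * v
        else if C = 3 \<and> B = 4 then - 2 * v else if C = 4 \<and> B = 3 then 2 * v else 0)
     else if A = 4 then
       (if C = 2 \<and> B = 1 then - 2 * a * u else if C = 1 \<and> B = 2 then 2 * a * u
        else if C = 2 \<and> B = 4 then 2 * u else if C = 4 \<and> B = 2 then - 2 * u else 0)
     else 0)"
  using exhaust_4[of A] exhaust_4[of B] exhaust_4[of C]
  unfolding carter_conn_def by (elim disjE) simp_all

text \<open>
  \<open>sg\<close> is the sign of $\sin\theta$ on the domain; it fixes the orientation of the coframe and
  thus the sign of the second invariant.
\<close>

locale carter_metric =
  fixes a \<alpha> sg :: real and Q Q' Q'' Y Y' Y'' :: "real \<Rightarrow> real" and g :: metric_field and S :: "(real^4) set"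
  assumes dQ: "\<And>r. (Q has_real_derivative Q' r) (at r)"
    and dQ': "\<And>r. (Q' has_real_derivative Q'' r) (at r)"
    and dY: "\<And>c. (Y has_real_derivative Y' c) (at c)"
    and dY': "\<And>c. (Y' has_real_derivative Y'' c) (at c)"
    and sg: "sg = 1 \<or> sg = -1"
    and open_S: "open S"
    and S: "x \<in> S \<Longrightarrow> sg * sin (x $ 3) > 0 \<and> 1 - \<alpha> * x $ 2 * cos (x $ 3) \<noteq> 0
      \<and> (x $ 2)\<^sup>2 + a\<^sup>2 * (cos (x $ 3))\<^sup>2 \<noteq> 0 \<and> Q (x $ 2) \<noteq> 0 \<and> Y (cos (x $ 3)) \<noteq> 0"
begin

definition R :: "real \<Rightarrow> real \<Rightarrow> real" where "R r c = r\<^sup>2 + a\<^sup>2 * c\<^sup>2"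
definition Om :: "real \<Rightarrow> real \<Rightarrow> real" where "Om r c = 1 - \<alpha> * r * c"
definition f where "f r c = Q r / R r c"
definition e where "e r c = Y c / R r c"
definition h where "h r = Q' r / (2 * Q r)"
definition k where "k c = Y' c / (2 * Y c)"
definition y where "y r c = \<alpha> * c / Om r c"
definition z where "z r c = \<alpha> * r / Om r c"
definition u where "u r c = r / R r c"
definition v where "v r c = a * c / R r c"
definition h' where "h' r = Q'' r / (2 * Q r) - 2 * (h r)\<^sup>2"
definition k' where "k' c = Y'' c / (2 * Y c) - 2 * (k c)\<^sup>2"
definition w where "w r c = \<alpha> / (Om r c)\<^sup>2"

definition conn_rc where
  "conn_rc r c = carter_conn (f r c) (e r c) (h r) (k c) (y r c) (z r c) a (u r c) (v r c)"

definition conn_dr where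
  "conn_dr r c = carter_dconn (f r c) (e r c) (h r) (k c) (y r c) (z r c) a (u r c) (v r c)
     (2 * f r c * (h r - u r c)) (- 2 * u r c * e r c) (h' r) 0 ((y r c)\<^sup>2) (w r c)
     ((v r c)\<^sup>2 - (u r c)\<^sup>2) (- 2 * u r c * v r c)"

definition conn_dc where
  "conn_dc r c = carter_dconn (f r c) (e r c) (h r) (k c) (y r c) (z r c) a (u r c) (v r c)
     (- 2 * (a * v r c) * f r c) (2 * e r c * (k c - a * v r c)) 0 (k' c) (w r c) ((z r c)\<^sup>2)
     (- 2 * a * u r c * v r c) (a * ((u r c)\<^sup>2 - (v r c)\<^sup>2))"

definition G_rc where "G_rc r c A = carter_gram (f r c) (e r c) A / (Om r c)\<^sup>2"

context
  fixes r c :: real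
  assumes nz: "Om r c \<noteq> 0" "R r c \<noteq> 0" "Q r \<noteq> 0" "Y c \<noteq> 0"
begin

lemma R_deriv:
  "((\<lambda>r. R r c) has_real_derivative 2 * r) (at r)"
  "((\<lambda>c. R r c) has_real_derivative 2 * a\<^sup>2 * c) (at c)"
  unfolding R_def by (auto intro!: derivative_eq_intros)

lemma Om_deriv:
  "((\<lambda>r. Om r c) has_real_derivative - \<alpha> * c) (at r)"
  "((\<lambda>c. Om r c) has_real_derivative - \<alpha> * r) (at c)"
  unfolding Om_def by (auto intro!: derivative_eq_intros)

lemma Q_deriv: "(Q has_real_derivative 2 * h r * Q r) (at r)"
  "(Y has_real_derivative 2 * k c * Y c) (at c)"
  using dQ[of r] dY[of c] nz by (simp_all add: h_def k_def)

text \<open>This removes the last explicit \<open>1 / R\<close> and so closes the derivative rules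
  of \<open>u\<close> and \<open>v\<close> within the symbols.\<close>

lemma uv_R: "1 / R r c = (u r c)\<^sup>2 + (v r c)\<^sup>2"
proof -
  have "(u r c)\<^sup>2 + (v r c)\<^sup>2 = R r c / (R r c)\<^sup>2"
    unfolding u_def v_def by (simp add: R_def power_divide power_mult_distrib add_divide_distrib)
  then show ?thesis using nz by (simp add: power2_eq_square)
qed

lemma f_deriv:
  "((\<lambda>r. f r c) has_real_derivative 2 * f r c * (h r - u r c)) (at r)"
  "((\<lambda>c. f r c) has_real_derivative - 2 * (a * v r c) * f r c) (at c)"
  unfolding f_def using nz
  by (auto intro!: DERIV_divide_eq R_deriv Q_deriv DERIV_const simp: u_def v_def field_simps power2_eq_square)

lemma e_deriv:
  "((\<lambda>r. e r c) has_real_derivative - 2 * u r c * e r c) (at r)"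
  "((\<lambda>c. e r c) has_real_derivative 2 * e r c * (k c - a * v r c)) (at c)"
  unfolding e_def using nz
  by (auto intro!: DERIV_divide_eq R_deriv Q_deriv DERIV_const simp: u_def v_def field_simps power2_eq_square)

lemma u_deriv:
  "((\<lambda>r. u r c) has_real_derivative (v r c)\<^sup>2 - (u r c)\<^sup>2) (at r)"
  "((\<lambda>c. u r c) has_real_derivative - 2 * a * u r c * v r c) (at c)"
proof -
  have "((\<lambda>r. r / R r c) has_real_derivative 1 / R r c - 2 * (u r c)\<^sup>2) (at r)"
    using nz by (auto intro!: DERIV_divide_eq R_deriv derivative_eq_intros simp: u_def field_simps power2_eq_square)
  then show "((\<lambda>r. u r c) has_real_derivative (v r c)\<^sup>2 - (u r c)\<^sup>2) (at r)"
    unfolding uv_R by (simp add: u_def[abs_def])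
  show "((\<lambda>c. u r c) has_real_derivative - 2 * a * u r c * v r c) (at c)"
    unfolding u_def using nz
    by (auto intro!: DERIV_divide_eq R_deriv DERIV_const simp: u_def v_def field_simps power2_eq_square)
qed

lemma v_deriv:
  "((\<lambda>r. v r c) has_real_derivative - 2 * u r c * v r c) (at r)"
  "((\<lambda>c. v r c) has_real_derivative a * ((u r c)\<^sup>2 - (v r c)\<^sup>2)) (at c)"
proof -
  show "((\<lambda>r. v r c) has_real_derivative - 2 * u r c * v r c) (at r)"
    unfolding v_def using nz
    by (auto intro!: DERIV_divide_eq R_deriv DERIV_const simp: u_def v_def field_simps power2_eq_square)
  have "((\<lambda>c. a * c / R r c) has_real_derivative a * (1 / R r c - 2 * (v r c)\<^sup>2)) (at c)"
    using nz by (auto intro!: DERIV_divide_eq R_deriv derivative_eq_intros simp: v_def field_simps power2_eq_square)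
  then show "((\<lambda>c. v r c) has_real_derivative a * ((u r c)\<^sup>2 - (v r c)\<^sup>2)) (at c)"
    unfolding uv_R by (simp add: v_def[abs_def])
qed

text \<open>As \<open>y\<close> and \<open>z\<close> are the partial derivatives of -ln Omega, their
  cross derivatives agree; \<open>w\<close> is this common value.\<close>

lemma yz_deriv:
  "((\<lambda>r. y r c) has_real_derivative (y r c)\<^sup>2) (at r)"
  "((\<lambda>c. y r c) has_real_derivative w r c) (at c)"
  "((\<lambda>r. z r c) has_real_derivative w r c) (at r)"
  "((\<lambda>c. z r c) has_real_derivative (z r c)\<^sup>2) (at c)"
  unfolding y_def z_def w_def using nz
  by (auto intro!: DERIV_divide_eq Om_deriv derivative_eq_intros simp: field_simps power2_eq_square)
     (simp_all add: Om_def algebra_simps)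

lemma hk_deriv:
  "(h has_real_derivative h' r) (at r)" "(k has_real_derivative k' c) (at c)"
proof -
  have "((\<lambda>r. Q' r / (2 * Q r)) has_real_derivative h' r) (at r)"
    using nz by (auto intro!: DERIV_divide_eq dQ' dQ derivative_eq_intros simp: h'_def h_def field_simps power2_eq_square)
  then show "(h has_real_derivative h' r) (at r)" by (simp add: h_def[abs_def])
  have "((\<lambda>r. Y' r / (2 * Y r)) has_real_derivative k' c) (at c)"
    using nz by (auto intro!: DERIV_divide_eq dY' dY derivative_eq_intros simp: k'_def k_def field_simps power2_eq_square)
  then show "(k has_real_derivative k' c) (at c)" by (simp add: k_def[abs_def])
qed

lemma fe_nz: "f r c \<noteq> 0" "e r c \<noteq> 0"
  using nz by (simp_all add: f_def e_def)

lemma conn_rc_deriv: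
  "((\<lambda>r. conn_rc r c C A B) has_real_derivative conn_dr r c C A B) (at r)"
  "((\<lambda>c. conn_rc r c C A B) has_real_derivative conn_dc r c C A B) (at c)"
  unfolding conn_rc_def conn_dr_def conn_dc_def
  by (rule carter_conn_deriv; (intro fe_nz f_deriv e_deriv u_deriv v_deriv yz_deriv hk_deriv DERIV_const)?)+

lemma G_rc_deriv:
  "((\<lambda>r. G_rc r c A) has_real_derivative 2 * G_rc r c A * conn_rc r c 2 A A) (at r)"
  "((\<lambda>c. G_rc r c A) has_real_derivative 2 * G_rc r c A * conn_rc r c 3 A A) (at c)"
proof -
  note d = f_deriv[THEN DERIV_cong] e_deriv[THEN DERIV_cong] Om_deriv[THEN DERIV_cong]
  show "((\<lambda>r. G_rc r c A) has_real_derivative 2 * G_rc r c A * conn_rc r c 2 A A) (at r)"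
    using exhaust_4[of A] nz fe_nz unfolding G_rc_def carter_gram_def conn_rc_def carter_conn_def
    by (elim disjE) (auto intro!: derivative_eq_intros d simp: y_def field_simps power2_eq_square)
  show "((\<lambda>c. G_rc r c A) has_real_derivative 2 * G_rc r c A * conn_rc r c 3 A A) (at c)"
    using exhaust_4[of A] nz fe_nz unfolding G_rc_def carter_gram_def conn_rc_def carter_conn_def
    by (elim disjE) (auto intro!: derivative_eq_intros d simp: z_def field_simps power2_eq_square)
qed

end

text \<open>The third row is dc = -sin(theta) dtheta. The frame thus differentiates in
  \<open>c\<close>, although the chart coordinate is theta.\<close>

definition th :: "real^4 \<Rightarrow> 4 \<Rightarrow> 4 \<Rightarrow> real" where
  "th x A i = (let r = x $ 2; c = cos (x $ 3); s = sin (x $ 3) in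
    (vector [vector [1, 0, 0, - a * (1 - c\<^sup>2)], vector [0, 1, 0, 0], vector [0, 0, - s, 0],
       vector [a, 0, 0, - (r\<^sup>2 + a\<^sup>2)]] :: real^4^4) $ A $ i)"

definition ev :: "real^4 \<Rightarrow> 4 \<Rightarrow> 4 \<Rightarrow> real" where
  "ev x A i = (let r = x $ 2; c = cos (x $ 3); s = sin (x $ 3) in
    (vector [vector [(r\<^sup>2 + a\<^sup>2) / R r c, 0, 0, a / R r c], vector [0, 1, 0, 0], vector [0, 0, - 1 / s, 0],
       vector [- a * (1 - c\<^sup>2) / R r c, 0, 0, - 1 / R r c]] :: real^4^4) $ A $ i)"

definition dth :: "real^4 \<Rightarrow> 4 \<Rightarrow> 4 \<Rightarrow> 4 \<Rightarrow> real" where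
  "dth x l A i = (let r = x $ 2; c = cos (x $ 3); s = sin (x $ 3) in
    if l = 2 then (if A = 4 \<and> i = 4 then - 2 * r else 0)
    else if l = 3 then (if A = 1 \<and> i = 4 then - 2 * a * c * s else if A = 3 \<and> i = 3 then - c else 0)
    else 0)"

definition ddth :: "real^4 \<Rightarrow> 4 \<Rightarrow> 4 \<Rightarrow> 4 \<Rightarrow> 4 \<Rightarrow> real" where
  "ddth x l l' A i = (let c = cos (x $ 3); s = sin (x $ 3) in
    if l = 2 \<and> l' = 2 then (if A = 4 \<and> i = 4 then - 2 else 0)
    else if l = 3 \<and> l' = 3 then
      (if A = 1 \<and> i = 4 then - 2 * a * (c\<^sup>2 - s\<^sup>2) else if A = 3 \<and> i = 3 then s else 0)
    else 0)"

definition G :: "real^4 \<Rightarrow> 4 \<Rightarrow> real" where "G x A = G_rc (x $ 2) (cos (x $ 3)) A"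
definition M :: "real^4 \<Rightarrow> 4 \<Rightarrow> 4 \<Rightarrow> 4 \<Rightarrow> real" where "M x = conn_rc (x $ 2) (cos (x $ 3))"
definition dM :: "real^4 \<Rightarrow> 4 \<Rightarrow> 4 \<Rightarrow> 4 \<Rightarrow> 4 \<Rightarrow> real" where
  "dM x D = (if D = 2 then conn_dr (x $ 2) (cos (x $ 3)) else if D = 3 then conn_dc (x $ 2) (cos (x $ 3))
     else (\<lambda>C A B. 0))"

lemma S_nz:
  assumes "x \<in> S"
  shows "Om (x $ 2) (cos (x $ 3)) \<noteq> 0" "R (x $ 2) (cos (x $ 3)) \<noteq> 0" "Q (x $ 2) \<noteq> 0" "Y (cos (x $ 3)) \<noteq> 0"
    "sin (x $ 3) \<noteq> 0"
  using S[OF assms] by (auto simp: Om_def R_def)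

lemma frame_sum:
  "(\<Sum>C\<in>UNIV. th x C l * (if C = 2 then p else if C = 3 then q else 0))
    = (if l = 2 then p else if l = 3 then - sin (x $ 3) * q else 0)"
  using exhaust_4[of l] by (elim disjE) (simp_all add: sum_4 th_def Let_def)

lemma th_has_partial_deriv: "has_partial_deriv (\<lambda>y. th y A i) (dth x l A i) l x"
  using exhaust_4[of A] exhaust_4[of i] exhaust_4[of l]
  unfolding has_partial_deriv_def th_def dth_def Let_def
  by (elim disjE) (auto simp: axis_def intro!: derivative_eq_intros)

lemma dth_has_partial_deriv: "has_partial_deriv (\<lambda>y. dth y l A i) (ddth x l' l A i) l' x"
  using exhaust_4[of A] exhaust_4[of i] exhaust_4[of l] exhaust_4[of l']
  unfolding has_partial_deriv_def ddth_def dth_def Let_def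
  by (elim disjE) (auto simp: axis_def power2_eq_square algebra_simps intro!: derivative_eq_intros)

lemma ev_differentiable: "x \<in> S \<Longrightarrow> \<exists>d. has_partial_deriv (\<lambda>y. ev y A i) d l x"
proof -
  assume "x \<in> S"
  note nz = S_nz[OF this]
  define X where "X t = x + t *\<^sub>R axis l 1" for t :: real
  define r c s where "r t = X t $ 2" and "c t = cos (X t $ 3)" and "s t = sin (X t $ 3)" for t
  have X0: "X 0 = x" by (simp add: X_def)
  have "((\<lambda>t. X t $ 2) has_real_derivative axis l 1 $ 2) (at 0)"
    and D: "((\<lambda>t. X t $ 3) has_real_derivative axis l 1 $ 3) (at 0)"
    unfolding X_def by (auto intro!: derivative_eq_intros)
  then have d [simp]: "r differentiable (at 0)" "c differentiable (at 0)" "s differentiable (at 0)"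
    using DERIV_fun_cos[OF D] DERIV_fun_sin[OF D]
    unfolding r_def c_def s_def real_differentiable_def by blast+
  have R0: "(r 0)\<^sup>2 + a\<^sup>2 * (c 0)\<^sup>2 \<noteq> 0" and s0: "s 0 \<noteq> 0"
    using nz by (simp_all add: r_def c_def s_def X0 R_def)
  have "(\<lambda>t. ev (X t) A i) differentiable (at 0)"
    using exhaust_4[of A] exhaust_4[of i] R0 s0
    unfolding ev_def Let_def R_def r_def[symmetric] c_def[symmetric] s_def[symmetric]
    by (elim disjE) simp_all
  then have "(\<lambda>t. ev (x + t *\<^sub>R axis l 1) A i) differentiable (at 0)"
    by (simp add: X_def)
  then show ?thesis
    unfolding has_partial_deriv_def by (simp add: real_differentiable_def)
qed

lemma th_ev:
  assumes "x \<in> S"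
  shows "(\<Sum>i\<in>UNIV. th x A i * ev x B i) = (if A = B then 1 else 0)"
  using exhaust_4[of A] exhaust_4[of B] S_nz(5)[OF assms] S_nz(2)[OF assms, unfolded R_def]
  by (elim disjE) (simp_all add: sum_4 th_def ev_def Let_def R_def divide_simps, simp_all add: algebra_simps power2_eq_square)

lemma ev_th:
  assumes "x \<in> S"
  shows "(\<Sum>A\<in>UNIV. ev x A i * th x A j) = (if i = j then 1 else 0)"
proof -
  have "(\<chi> A i. th x A i) ** transpose (\<chi> A i. ev x A i) = mat 1"
    by (simp add: vec_eq_iff matrix_matrix_mult_def transpose_def mat_def th_ev[OF assms])
  then have "transpose (\<chi> A i. ev x A i) ** (\<chi> A i. th x A i) = mat 1"
    by (simp add: matrix_left_right_inverse)
  then show ?thesis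
    by (simp add: vec_eq_iff matrix_matrix_mult_def transpose_def mat_def)
qed

lemma G_nz: "x \<in> S \<Longrightarrow> G x A \<noteq> 0"
  using exhaust_4[of A] fe_nz[OF S_nz(1-4)] S_nz(1)
  by (auto simp: G_def G_rc_def carter_gram_def)

text \<open>The diagonal connection coefficients are half the logarithmic derivatives of the squared
  lengths; along vectors 1 and 4 both vanish, since nothing depends on t or phi.\<close>

lemma G_has_partial_deriv:
  assumes "x \<in> S"
  shows "has_partial_deriv (\<lambda>y. G y A) (\<Sum>C\<in>UNIV. th x C l * (2 * G x A * M x C A A)) l x"
proof -
  have "M x 1 A A = 0" "M x 4 A A = 0"
    using exhaust_4[of A] by (auto simp: M_def conn_rc_def carter_conn_def)
  then have "th x C l * (2 * G x A * M x C A A)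
      = th x C l * (if C = 2 then 2 * G x A * M x 2 A A else if C = 3 then 2 * G x A * M x 3 A A else 0)" for C
    using exhaust_4[of C] by auto
  then have eq: "(\<Sum>C\<in>UNIV. th x C l * (2 * G x A * M x C A A))
      = (if l = 2 then 2 * G x A * M x 2 A A else if l = 3 then - sin (x $ 3) * (2 * G x A * M x 3 A A) else 0)"
    unfolding frame_sum[symmetric] by (rule sum.cong[OF refl])
  show ?thesis
    unfolding eq unfolding G_def M_def
    by (rule has_partial_deriv_rc) (rule G_rc_deriv S_nz assms)+
qed

lemma M_has_partial_deriv:
  assumes "x \<in> S"
  shows "has_partial_deriv (\<lambda>y. M y C A B) (\<Sum>D\<in>UNIV. th x D l * dM x D C A B) l x"
proof -
  have "dM x D C A B = (if D = 2 then conn_dr (x $ 2) (cos (x $ 3)) C A B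
      else if D = 3 then conn_dc (x $ 2) (cos (x $ 3)) C A B else 0)" for D
    by (simp add: dM_def)
  then show ?thesis
    by (simp only: frame_sum)
      (unfold M_def, rule has_partial_deriv_rc, (rule conn_rc_deriv S_nz assms)+)
qed

lemma M_compatible:
  assumes "x \<in> S"
  shows "G x A * M x C A B + G x B * M x C B A = (if A = B then 2 * G x A * M x C A A else 0)"
  using carter_conn_compatible[OF fe_nz[OF S_nz(1-4)[OF assms]]] S_nz(1)[OF assms]
  by (simp add: G_def G_rc_def M_def conn_rc_def add_divide_distrib[symmetric])

lemma M_torsion_free:
  assumes "x \<in> S"
  shows "dth x l A j - dth x j A l
      = (\<Sum>C\<in>UNIV. \<Sum>B\<in>UNIV. (M x B A C - M x C A B) * (th x C l * th x B j))"
proof -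
  let ?r = "x $ 2" and ?c = "cos (x $ 3)"
  \<comment> \<open>This combination is R dphi, so both nontrivial structure equations become wedge
    products with dphi.\<close>
  define \<phi> where "\<phi> i = a * th x 1 i - th x 4 i" for i
  have \<phi>: "\<phi> i = (if i = 4 then R ?r ?c else 0)" for i
    using exhaust_4[of i] by (auto simp: \<phi>_def th_def Let_def R_def power2_eq_square algebra_simps)
  have uv: "u ?r ?c * R ?r ?c = ?r" "v ?r ?c * R ?r ?c = a * ?c"
    using S_nz(2)[OF assms] by (simp_all add: u_def v_def)
  have "(\<Sum>C\<in>UNIV. \<Sum>B\<in>UNIV. (M x B A C - M x C A B) * (th x C l * th x B j))
      = (if A = 1 then 2 * v ?r ?c * (th x 3 l * \<phi> j - \<phi> l * th x 3 j)
         else if A = 4 then 2 * u ?r ?c * (\<phi> l * th x 2 j - th x 2 l * \<phi> j) else 0)"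
    using exhaust_4[of A] unfolding M_def conn_rc_def carter_conn_torsion \<phi>_def
    by (elim disjE) (simp_all add: sum_4 algebra_simps)
  also have "\<dots> = dth x l A j - dth x j A l"
    using exhaust_4[of A] exhaust_4[of l] exhaust_4[of j] uv
    unfolding \<phi> by (elim disjE) (simp_all add: dth_def th_def Let_def mult.assoc)
  finally show ?thesis ..
qed

end

text \<open>Conformal weights, applied with \<open>c\<close> the square of Omega: dividing the
  metric by \<open>c\<close> divides the covariant Weyl tensor by \<open>c\<close> and multiplies
  its scalars by \<open>c\<close>.\<close>

lemma typeD_weyl_scale:
  assumes "c \<noteq> 0"
  shows "typeD_weyl (\<lambda>A. G A / c) (1 / c\<^sup>2) (c * X) (c * Z) A B C D = typeD_weyl G 1 X Z A B C D / c"
  using assms by (simp add: typeD_weyl_def frame_delta_def field_simps power2_eq_square)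

text \<open>A separate locale because the assumption on \<open>g\<close> mentions \<open>G\<close>
  and \<open>th\<close>, which are defined inside \<open>carter_metric\<close>.\<close>

locale carter_spacetime = carter_metric +
  assumes metric: "x \<in> S \<Longrightarrow> g x $ i $ j = (\<Sum>A\<in>UNIV. G x A * (th x A i * th x A j))"
begin

lemma ddth_commute: "ddth x l l' A i = ddth x l' l A i"
  by (auto simp: ddth_def Let_def)

sublocale moving_frame g S ev th dth ddth G "\<lambda>x C A. 2 * G x A * M x C A A" M dM
  by (unfold_locales; (rule open_S ev_th th_ev metric G_nz ev_differentiable th_has_partial_deriv
      dth_has_partial_deriv G_has_partial_deriv M_has_partial_deriv M_compatible M_torsion_free; assumption)?;
      (rule ddth_commute)?)

text \<open>\<open>Xw\<close> and \<open>Zw\<close> are the scalars of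
  \<open>carter_curvature\<close> rewritten in terms of the metric functions, times the square of
  Omega as their conformal weight.\<close>

definition Xw :: "real \<Rightarrow> real \<Rightarrow> real" where
  "Xw r c = (Om r c)\<^sup>2 * (((Q'' r + Y'' c) / 6 - (r * Q' r + a\<^sup>2 * c * Y' c) / R r c
     + 2 * (Q r - a\<^sup>2 * Y c) * (r\<^sup>2 - a\<^sup>2 * c\<^sup>2) / (R r c)\<^sup>2) / R r c)"

definition Zw :: "real \<Rightarrow> real \<Rightarrow> real" where
  "Zw r c = (Om r c)\<^sup>2 * ((a * (c * Q' r - r * Y' c) / R r c
     - 4 * a * r * c * (Q r - a\<^sup>2 * Y c) / (R r c)\<^sup>2) / R r c)"

lemma frame_weyl_eq:
  assumes "x \<in> S"
  shows "frame_weyl x A B C D = typeD_weyl (G x) (1 / (Om (x $ 2) (cos (x $ 3)))^4)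
     (Xw (x $ 2) (cos (x $ 3))) (Zw (x $ 2) (cos (x $ 3))) A B C D"
proof -
  define r c where "r = x $ 2" and "c = cos (x $ 3)"
  have nz: "Om r c \<noteq> 0" "R r c \<noteq> 0" "Q r \<noteq> 0" "Y c \<noteq> 0"
    unfolding r_def c_def using S_nz[OF assms] by auto
  define X where "X = f r c * ((h' r + 2 * (h r)\<^sup>2) / 3 - 2 * h r * u r c + 2 * (u r c)\<^sup>2 - 2 * (v r c)\<^sup>2)
            + e r c * ((k' c + 2 * (k c)\<^sup>2) / 3 - 2 * k c * (a * v r c) + 2 * a\<^sup>2 * ((v r c)\<^sup>2 - (u r c)\<^sup>2))"
  define Z where "Z = f r c * (2 * h r * v r c - 4 * u r c * v r c)
            + e r c * (4 * a\<^sup>2 * u r c * v r c - 2 * k c * (a * u r c))"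
  define P where "P = carter_schouten (f r c) (e r c) (h r) (k c) (y r c) (z r c) a (u r c) (v r c) (h' r) (k' c) (w r c)"
  let ?G = "carter_gram (f r c) (e r c)" and ?O = "(Om r c)\<^sup>2"
  have G: "G x = (\<lambda>A. ?G A / ?O)"
    by (rule ext) (simp add: G_def G_rc_def r_def c_def)
  have X: "?O * X = Xw r c"
  proof -
    \<comment> \<open>The logarithmic derivatives occur only in combinations from which the
      denominators \<open>Q\<close> and \<open>Y\<close> drop out; this is the linearity of the Weyl
      scalar in \<open>Q\<close> and \<open>Y\<close>.\<close>
    have eqs: "f r c * ((h' r + 2 * (h r)\<^sup>2) / 3) = Q'' r / 6 / R r c" "e r c * ((k' c + 2 * (k c)\<^sup>2) / 3) = Y'' c / 6 / R r c"
      "f r c * (2 * h r) = Q' r / R r c" "e r c * (2 * k c) = Y' c / R r c"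
      using nz by (simp_all add: f_def e_def h'_def k'_def h_def k_def)
    have "X = f r c * ((h' r + 2 * (h r)\<^sup>2) / 3) - f r c * (2 * h r) * u r c + 2 * f r c * ((u r c)\<^sup>2 - (v r c)\<^sup>2)
       + (e r c * ((k' c + 2 * (k c)\<^sup>2) / 3) - e r c * (2 * k c) * (a * v r c) - 2 * a\<^sup>2 * e r c * ((u r c)\<^sup>2 - (v r c)\<^sup>2))"
      unfolding X_def by (simp add: algebra_simps)
    then have hX: "X = Q'' r / 6 / R r c - Q' r / R r c * u r c + 2 * f r c * ((u r c)\<^sup>2 - (v r c)\<^sup>2)
       + (Y'' c / 6 / R r c - Y' c / R r c * (a * v r c) - 2 * a\<^sup>2 * e r c * ((u r c)\<^sup>2 - (v r c)\<^sup>2))"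
      unfolding eqs .
    define D where "D = r\<^sup>2 - a\<^sup>2 * c\<^sup>2"
    have T: "(u r c)\<^sup>2 - (v r c)\<^sup>2 = D / (R r c)\<^sup>2"
      by (simp add: D_def u_def v_def power_divide power_mult_distrib diff_divide_distrib)
    have "X = ((Q'' r + Y'' c) / 6 - (r * Q' r + a\<^sup>2 * c * Y' c) / R r c
       + 2 * (Q r - a\<^sup>2 * Y c) * D / (R r c)\<^sup>2) / R r c"
      unfolding hX T by (simp add: u_def v_def f_def e_def add_divide_distrib diff_divide_distrib algebra_simps power2_eq_square)
    then show ?thesis
      unfolding Xw_def D_def by simp
  qed
  have Z: "?O * Z = Zw r c"
  proof -
    have eqs: "f r c * (2 * h r) = Q' r / R r c" "e r c * (2 * k c) = Y' c / R r c"
      using nz by (simp_all add: f_def e_def h_def k_def)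
    have "Z = f r c * (2 * h r) * v r c - e r c * (2 * k c) * (a * u r c) - 4 * f r c * u r c * v r c
         + 4 * a\<^sup>2 * e r c * u r c * v r c"
      unfolding Z_def by (simp add: algebra_simps)
    then have "Z = Q' r / R r c * v r c - Y' c / R r c * (a * u r c) - 4 * f r c * u r c * v r c
         + 4 * a\<^sup>2 * e r c * u r c * v r c"
      unfolding eqs .
    then have "Z = (a * (c * Q' r - r * Y' c) / R r c
       - 4 * a * r * c * (Q r - a\<^sup>2 * Y c) / (R r c)\<^sup>2) / R r c"
      by (simp add: u_def v_def f_def e_def add_divide_distrib diff_divide_distrib algebra_simps power2_eq_square)
    then show ?thesis
      unfolding Zw_def by simp
  qed
  have dM: "dM x = (\<lambda>D. if D = 2 then conn_dr r c else if D = 3 then conn_dc r c else (\<lambda>C A B. 0))"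
    by (rule ext) (simp add: dM_def r_def c_def)
  have Mx: "M x = conn_rc r c" by (simp add: M_def r_def c_def)
  have fr: "frame_riemann x A B C D = frame_curvature (M x) (dM x) A B C D" for A B C D
    unfolding frame_riemann_def ..
  have curv: "?G A * frame_riemann x A B C D = typeD_weyl ?G 1 X Z A B C D
       + (frame_delta ?G A C * P B D - frame_delta ?G A D * P B C
          - P A D * frame_delta ?G B C + P A C * frame_delta ?G B D)" for A B C D
    unfolding fr Mx dM conn_rc_def conn_dr_def conn_dc_def X_def Z_def P_def
    by (rule carter_curvature[OF fe_nz[OF nz]])
  have P: "P A B = P B A" for A B
    using exhaust_4[of A] exhaust_4[of B] by (auto simp: P_def carter_schouten_def Let_def)
  have "frame_weyl x A B C D = typeD_weyl (G x) (1 / ?O\<^sup>2) (?O * X) (?O * Z) A B C D"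
  proof (rule frame_weyl_typeD[OF assms P])
    fix A B C D
    have d: "frame_delta (\<lambda>A. ?G A / ?O) A B = frame_delta ?G A B / ?O" for A B
      by (simp add: frame_delta_def)
    have "G x A * frame_riemann x A B C D = (?G A * frame_riemann x A B C D) / ?O"
      by (simp add: G)
    then show "G x A * frame_riemann x A B C D = typeD_weyl (G x) (1 / ?O\<^sup>2) (?O * X) (?O * Z) A B C D
       + (frame_delta (G x) A C * P B D - frame_delta (G x) A D * P B C
          - P A D * frame_delta (G x) B C + P A C * frame_delta (G x) B D)"
      unfolding curv G using typeD_weyl_scale[of ?O ?G X Z A B C D] nz(1)
      by (simp add: d add_divide_distrib diff_divide_distrib)
  qed
  then show ?thesis
    unfolding X Z by (simp add: r_def c_def power_mult[symmetric])
qed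

lemma sigma:
  assumes "x \<in> S"
  shows "(1 / (Om (x $ 2) (cos (x $ 3)))^4)\<^sup>2 = - (G x 1 * G x 2 * G x 3 * G x 4)"
  using S_nz[OF assms] fe_nz[OF S_nz(1-4)[OF assms]]
  by (simp add: G_def G_rc_def carter_gram_def power_divide power_mult[symmetric] power_add[symmetric])

lemma I1_carter:
  assumes "x \<in> S"
  shows "I1 g x = 12 * ((Xw (x $ 2) (cos (x $ 3)))\<^sup>2 - (Zw (x $ 2) (cos (x $ 3)))\<^sup>2)"
  unfolding I1_eq[OF assms] frame_weyl_eq[OF assms]
  by (rule typeD_weyl_square[OF G_nz[OF assms] sigma[OF assms]])

text \<open>The transformation law of the symbol at 1, 2, 3, 4 serves as the expansion of the
  determinant.\<close>

lemma det_th: "det (\<chi> A i. th x A i) = sin (x $ 3) * R (x $ 2) (cos (x $ 3))"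
  using levi_civita_symbol_frame[of "th x" 1 2 3 4]
  by (simp add: sum_4 th_def Let_def levi_civita_symbol_values levi_civita_symbol_repeat R_def
      algebra_simps power2_eq_square)

text \<open>The root of the Gram product equals \<open>\<sigma>\<close> and cancels the
  \<open>1 / \<sigma>\<close> of \<open>typeD_weyl_dual\<close>; half of 48 remains. Since
  \<open>R\<close> is positive, the orientation sign is that of sin theta.\<close>

lemma I2_carter:
  assumes "x \<in> S"
  shows "I2 \<epsilon> g x = 24 * \<epsilon> * sg * Xw (x $ 2) (cos (x $ 3)) * Zw (x $ 2) (cos (x $ 3))"
proof -
  let ?\<sigma> = "1 / (Om (x $ 2) (cos (x $ 3)))^4"
  have pos: "?\<sigma> > 0" using S_nz(1)[OF assms] by simp
  have "sqrt \<bar>G x 1 * G x 2 * G x 3 * G x 4\<bar> = sqrt (?\<sigma>\<^sup>2)"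
    using sigma[OF assms] by (metis abs_minus_cancel abs_power2 minus_minus)
  also have "\<dots> = ?\<sigma>" using pos by (simp add: real_sqrt_abs)
  finally have s: "sqrt \<bar>G x 1 * G x 2 * G x 3 * G x 4\<bar> = ?\<sigma>" .
  have "R (x $ 2) (cos (x $ 3)) > 0"
    using S_nz(2)[OF assms] by (simp add: R_def order_le_neq_trans)
  then have d: "sgn (det (\<chi> A i. th x A i)) = sg"
    using S[OF assms] sg by (auto simp: det_th sgn_mult)
  show ?thesis
    unfolding I2_eq[OF assms] s d frame_weyl_eq[OF assms]
      typeD_weyl_dual[OF G_nz[OF assms] sigma[OF assms] less_imp_neq[OF pos, symmetric]]
    using pos by simp
qed

end

section \<open>The complex Weyl scalar\<close>

text \<open>The quotient rule with the common factor of numerator and denominator removed;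
  \<open>E\<close> is left free so that it can be supplied in factored form.\<close>

lemma DERIV_quotient_pattern:
  fixes \<omega> n \<zeta> \<eta> :: "complex \<Rightarrow> complex"
  assumes "(\<omega> has_field_derivative \<omega>') (at t)" "(n has_field_derivative n') (at t)"
    "(\<zeta> has_field_derivative \<zeta>') (at t)" "(\<eta> has_field_derivative \<eta>') (at t)"
    and "\<zeta> t \<noteq> 0" "\<eta> t \<noteq> 0"
    and "E = 3 * \<omega>' * n t * (\<zeta> t * \<eta> t) + \<omega> t * (n' * (\<zeta> t * \<eta> t) - 3 * n t * \<zeta>' * \<eta> t - n t * \<zeta> t * \<eta>')"
  shows "((\<lambda>t. 2 * (\<omega> t)^3 * n t / ((\<zeta> t)^3 * \<eta> t)) has_field_derivative
    2 * (\<omega> t)\<^sup>2 * E / ((\<zeta> t)^4 * (\<eta> t)\<^sup>2)) (at t)"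
proof -
  have "((\<lambda>t. 2 * (\<omega> t)^3 * n t / ((\<zeta> t)^3 * \<eta> t)) has_field_derivative
    ((2 * (3 * (\<omega> t)\<^sup>2 * \<omega>') * n t + 2 * (\<omega> t)^3 * n') * ((\<zeta> t)^3 * \<eta> t)
      - 2 * (\<omega> t)^3 * n t * (3 * (\<zeta> t)\<^sup>2 * \<zeta>' * \<eta> t + (\<zeta> t)^3 * \<eta>')) / ((\<zeta> t)^3 * \<eta> t)\<^sup>2) (at t)"
    using assms(5,6)
    by (auto intro!: derivative_eq_intros assms(1-4) simp: power2_eq_square algebra_simps)
  also have "((2 * (3 * (\<omega> t)\<^sup>2 * \<omega>') * n t + 2 * (\<omega> t)^3 * n') * ((\<zeta> t)^3 * \<eta> t)
      - 2 * (\<omega> t)^3 * n t * (3 * (\<zeta> t)\<^sup>2 * \<zeta>' * \<eta> t + (\<zeta> t)^3 * \<eta>'))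
      = (\<zeta> t)\<^sup>2 * (2 * (\<omega> t)\<^sup>2 * E)"
    unfolding assms(7) by (simp add: algebra_simps power2_eq_square power3_eq_cube)
  also have "((\<zeta> t)^3 * \<eta> t)\<^sup>2 = (\<zeta> t)\<^sup>2 * ((\<zeta> t)^4 * (\<eta> t)\<^sup>2)"
    by (simp add: power_mult_distrib power_mult[symmetric] power_add[symmetric])
  also have "(\<zeta> t)\<^sup>2 * (2 * (\<omega> t)\<^sup>2 * E) / ((\<zeta> t)\<^sup>2 * ((\<zeta> t)^4 * (\<eta> t)\<^sup>2))
      = 2 * (\<omega> t)\<^sup>2 * E / ((\<zeta> t)^4 * (\<eta> t)\<^sup>2)"
    by (rule mult_divide_mult_cancel_left) (simp add: assms(5))
  finally show ?thesis .
qed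

text \<open>
  With $b = ia$ and $p = q^2$, \<open>W_fun\<close> is
  $2\Omega^3\zeta^{-3}\bar\zeta^{-1}(-m(1-i\alpha a)\bar\zeta + q^2(1+\alpha r c))$ where
  $\zeta = r+iac$; replacing $b$ by $-b$ is complex conjugation. The numerators of both partial
  derivatives factor because $n_r\bar\zeta - n = -q^2(1+i\alpha a c^2)$ and
  $n_c\bar\zeta + ia\,n = q^2(\alpha r^2+ia)$ for $n$ the last factor.
\<close>

definition W_num :: "complex \<Rightarrow> complex \<Rightarrow> complex \<Rightarrow> complex \<Rightarrow> complex \<Rightarrow> complex \<Rightarrow> complex" where
  "W_num b \<alpha> m p r c = - m * (1 - \<alpha> * b) * (r - b * c) + p * (1 + \<alpha> * r * c)"

definition W_fun :: "complex \<Rightarrow> complex \<Rightarrow> complex \<Rightarrow> complex \<Rightarrow> complex \<Rightarrow> complex \<Rightarrow> complex" where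
  "W_fun b \<alpha> m p r c = 2 * (1 - \<alpha> * r * c)^3 * W_num b \<alpha> m p r c / ((r + b * c)^3 * (r - b * c))"

definition W_r :: "complex \<Rightarrow> complex \<Rightarrow> complex \<Rightarrow> complex \<Rightarrow> complex \<Rightarrow> complex \<Rightarrow> complex" where
  "W_r b \<alpha> m p r c = 2 * (1 - \<alpha> * r * c)\<^sup>2 * (- (1 + \<alpha> * b * c\<^sup>2) *
     (3 * (r - b * c) * W_num b \<alpha> m p r c + p * (1 - \<alpha> * r * c) * (r + b * c))) / ((r + b * c)^4 * (r - b * c)\<^sup>2)"

definition W_c :: "complex \<Rightarrow> complex \<Rightarrow> complex \<Rightarrow> complex \<Rightarrow> complex \<Rightarrow> complex \<Rightarrow> complex" where
  "W_c b \<alpha> m p r c = 2 * (1 - \<alpha> * r * c)\<^sup>2 * (- (\<alpha> * r\<^sup>2 + b) *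
     (3 * (r - b * c) * W_num b \<alpha> m p r c - p * (1 - \<alpha> * r * c) * (r + b * c))) / ((r + b * c)^4 * (r - b * c)\<^sup>2)"

lemma W_fun_deriv:
  assumes "r + b * c \<noteq> 0" "r - b * c \<noteq> 0"
  shows "((\<lambda>r. W_fun b \<alpha> m p r c) has_field_derivative W_r b \<alpha> m p r c) (at r)"
    and "((\<lambda>c. W_fun b \<alpha> m p r c) has_field_derivative W_c b \<alpha> m p r c) (at c)"
proof -
  have "((\<lambda>r. W_num b \<alpha> m p r c) has_field_derivative - m * (1 - \<alpha> * b) + p * \<alpha> * c) (at r)"
    "((\<lambda>c. W_num b \<alpha> m p r c) has_field_derivative m * (1 - \<alpha> * b) * b + p * \<alpha> * r) (at c)"
    "((\<lambda>r. 1 - \<alpha> * r * c) has_field_derivative - \<alpha> * c) (at r)"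
    "((\<lambda>c. 1 - \<alpha> * r * c) has_field_derivative - \<alpha> * r) (at c)"
    "((\<lambda>r. r + b * c) has_field_derivative 1) (at r)" "((\<lambda>r. r - b * c) has_field_derivative 1) (at r)"
    "((\<lambda>c. r + b * c) has_field_derivative b) (at c)" "((\<lambda>c. r - b * c) has_field_derivative - b) (at c)"
    unfolding W_num_def by (auto intro!: derivative_eq_intros)
  note d = this
  show "((\<lambda>r. W_fun b \<alpha> m p r c) has_field_derivative W_r b \<alpha> m p r c) (at r)"
    unfolding W_fun_def W_r_def
    by (rule DERIV_quotient_pattern[OF d(3,1,5,6) assms])
      (simp add: W_num_def algebra_simps power2_eq_square)
  show "((\<lambda>c. W_fun b \<alpha> m p r c) has_field_derivative W_c b \<alpha> m p r c) (at c)"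
    unfolding W_fun_def W_c_def
    by (rule DERIV_quotient_pattern[OF d(4,2,7,8) assms])
      (simp add: W_num_def algebra_simps power2_eq_square)
qed

text \<open>The squared polynomial of the theorem, with \<open>a2\<close> and \<open>p\<close> for
  the squares of \<open>a\<close> and \<open>q\<close>. It is polymorphic because the identities are
  proved over the complex numbers and then read over the reals.\<close>

definition wronskian_poly :: "'a::field \<Rightarrow> 'a \<Rightarrow> 'a \<Rightarrow> 'a \<Rightarrow> 'a \<Rightarrow> 'a \<Rightarrow> 'a" where
  "wronskian_poly a2 \<alpha> m p r c =
     \<alpha> * ((a2^2 * m^2 * r + 2 * a2 * m * p * r^2 + 8/9 * p^2 * r^3) * \<alpha>^2
              + a2 * m * (m * r - 2 * p / 3)) * c^3
         + ((a2^2 * m^2 + 2 * a2 * m * p * r - 2 * m * p * r^3 + 16/9 * p^2 * r^2) * \<alpha>^2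
            + a2 * m^2) * c^2
         + \<alpha> * (a2 * \<alpha>^2 * m^2 * r^3 + 2 * a2 * m * p + r^3 * m^2 - 2 * m * p * r^2
                + 16/9 * p^2 * r) * c
         + m * r^2 * (a2 * m + 2 * p * r / 3) * \<alpha>^2
         + r^2 * m^2 - 2 * m * p * r + 8 * p^2 / 9"

text \<open>The right-hand side is what is left of the numerator in \<open>W_wronskian\<close> once
  8 \<open>\<omega>^5\<close> and one factor \<open>\<zeta> * \<eta>\<close> are taken out.\<close>

lemma wronskian_poly_eq:
  fixes b \<alpha> m p r c :: complex
  defines "N \<equiv> W_num b \<alpha> m p r c" and "N' \<equiv> W_num (- b) \<alpha> m p r c" and "\<omega> \<equiv> 1 - \<alpha> * r * c"
  shows "9 * b * wronskian_poly (- b\<^sup>2) \<alpha> m p r c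
    = b * (1 + \<alpha> * r * c) * (9 * (N * N') - p\<^sup>2 * \<omega>\<^sup>2) + 3 * \<alpha> * p * ((r - b * c)\<^sup>2 * N - (r + b * c)\<^sup>2 * N')"
  unfolding wronskian_poly_def N_def N'_def \<omega>_def W_num_def
  by (simp add: algebra_simps power2_eq_square power3_eq_cube)

text \<open>For \<open>b\<^sup>2 = - a\<^sup>2\<close> this is the squared modulus of
  \<open>W_num\<close>, the polynomial cubed in the denominator of the theorem.\<close>

lemma W_num_norm:
  fixes b \<alpha> m p r c :: complex
  shows "W_num b \<alpha> m p r c * W_num (- b) \<alpha> m p r c
    = ((- b\<^sup>2 * m + p * r)\<^sup>2 * \<alpha>\<^sup>2 - b\<^sup>2 * m\<^sup>2) * c\<^sup>2
              + 2 * p * \<alpha> * (- b\<^sup>2 * m - m * r\<^sup>2 + p * r) * c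
              - r\<^sup>2 * m\<^sup>2 * \<alpha>\<^sup>2 * b\<^sup>2 + (m * r - p)\<^sup>2"
  unfolding W_num_def by (simp add: algebra_simps power2_eq_square)

text \<open>With \<open>-b\<close> as conjugate of \<open>b\<close>, the left-hand side is 2i times
  Im(conj W_r W_c), stated algebraically so that no conjugation occurs in the computation.\<close>

lemma W_wronskian:
  fixes b \<alpha> m p r c :: complex
  assumes "r + b * c \<noteq> 0" "r - b * c \<noteq> 0"
  shows "W_r (- b) \<alpha> m p r c * W_c b \<alpha> m p r c - W_r b \<alpha> m p r c * W_c (- b) \<alpha> m p r c
    = 72 * b * (1 - \<alpha> * r * c)^5 * wronskian_poly (- b\<^sup>2) \<alpha> m p r c / ((r + b * c) * (r - b * c))^5"
proof -
  define N N' \<omega> \<zeta> \<eta> where "N = W_num b \<alpha> m p r c" and "N' = W_num (- b) \<alpha> m p r c" and "\<omega> = 1 - \<alpha> * r * c"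
    and "\<zeta> = r + b * c" and "\<eta> = r - b * c"
  \<comment> \<open>Each product is split into its even and odd parts under the exchange of
    \<open>b\<close> and \<open>-b\<close>; \<open>F\<close> is even and \<open>D\<close> is
    odd.\<close>
  have f1: "(1 - \<alpha> * b * c\<^sup>2) * (\<alpha> * r\<^sup>2 + b) = \<alpha> * (\<zeta> * \<eta>) + b * \<omega> * (1 + \<alpha> * r * c)"
    "(1 + \<alpha> * b * c\<^sup>2) * (\<alpha> * r\<^sup>2 - b) = \<alpha> * (\<zeta> * \<eta>) - b * \<omega> * (1 + \<alpha> * r * c)"
    by (simp_all add: \<omega>_def \<zeta>_def \<eta>_def algebra_simps power2_eq_square)
  define F where "F = 9 * (\<zeta> * \<eta>) * (N * N') - p\<^sup>2 * \<omega>\<^sup>2 * (\<zeta> * \<eta>)"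
  define D where "D = \<eta>\<^sup>2 * N - \<zeta>\<^sup>2 * N'"
  have f2: "(3 * \<zeta> * N' + p * \<omega> * \<eta>) * (3 * \<eta> * N - p * \<omega> * \<zeta>) = F + 3 * p * \<omega> * D"
    "(3 * \<eta> * N + p * \<omega> * \<zeta>) * (3 * \<zeta> * N' - p * \<omega> * \<eta>) = F - 3 * p * \<omega> * D"
    by (simp_all add: F_def D_def algebra_simps power2_eq_square)
  have prod: "2 * \<omega>\<^sup>2 * (- P * X) / (x^4 * y\<^sup>2) * (2 * \<omega>\<^sup>2 * (- P' * X') / (y^4 * x\<^sup>2))
      = 4 * \<omega>^4 * ((P * P') * (X * X')) / (x * y)^6" for P P' X X' x y
    by (simp add: eval_nat_numeral mult_ac)
  have w: "W_r (- b) \<alpha> m p r c = 2 * \<omega>\<^sup>2 * (- (1 - \<alpha> * b * c\<^sup>2) * (3 * \<zeta> * N' + p * \<omega> * \<eta>)) / (\<eta>^4 * \<zeta>\<^sup>2)"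
    "W_c b \<alpha> m p r c = 2 * \<omega>\<^sup>2 * (- (\<alpha> * r\<^sup>2 + b) * (3 * \<eta> * N - p * \<omega> * \<zeta>)) / (\<zeta>^4 * \<eta>\<^sup>2)"
    "W_r b \<alpha> m p r c = 2 * \<omega>\<^sup>2 * (- (1 + \<alpha> * b * c\<^sup>2) * (3 * \<eta> * N + p * \<omega> * \<zeta>)) / (\<zeta>^4 * \<eta>\<^sup>2)"
    "W_c (- b) \<alpha> m p r c = 2 * \<omega>\<^sup>2 * (- (\<alpha> * r\<^sup>2 - b) * (3 * \<zeta> * N' - p * \<omega> * \<eta>)) / (\<eta>^4 * \<zeta>\<^sup>2)"
    by (simp_all add: W_r_def W_c_def N_def N'_def \<omega>_def \<zeta>_def \<eta>_def)
  have "W_r (- b) \<alpha> m p r c * W_c b \<alpha> m p r c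
      = 4 * \<omega>^4 * (((1 - \<alpha> * b * c\<^sup>2) * (\<alpha> * r\<^sup>2 + b)) * ((3 * \<zeta> * N' + p * \<omega> * \<eta>) * (3 * \<eta> * N - p * \<omega> * \<zeta>))) / (\<zeta> * \<eta>)^6"
    unfolding w prod by (simp only: mult.commute)
  moreover have "W_r b \<alpha> m p r c * W_c (- b) \<alpha> m p r c
      = 4 * \<omega>^4 * (((1 + \<alpha> * b * c\<^sup>2) * (\<alpha> * r\<^sup>2 - b)) * ((3 * \<eta> * N + p * \<omega> * \<zeta>) * (3 * \<zeta> * N' - p * \<omega> * \<eta>))) / (\<zeta> * \<eta>)^6"
    unfolding w prod by (simp only: mult.commute)
  \<comment> \<open>Only the products of an even with an odd part survive the subtraction. Each odd
    part carries one more \<open>\<omega>\<close>, and each even part a factor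
    \<open>\<zeta> * \<eta>\<close>, which lowers the power in the denominator to 5.\<close>
  moreover have num: "4 * \<omega>^4 * ((\<alpha> * (\<zeta> * \<eta>) + b * \<omega> * (1 + \<alpha> * r * c)) * (F + 3 * p * \<omega> * D))
      - 4 * \<omega>^4 * ((\<alpha> * (\<zeta> * \<eta>) - b * \<omega> * (1 + \<alpha> * r * c)) * (F - 3 * p * \<omega> * D))
      = 8 * \<omega>^5 * (b * (1 + \<alpha> * r * c) * F + 3 * \<alpha> * p * (\<zeta> * \<eta>) * D)"
    by (simp add: algebra_simps eval_nat_numeral)
  ultimately have "W_r (- b) \<alpha> m p r c * W_c b \<alpha> m p r c - W_r b \<alpha> m p r c * W_c (- b) \<alpha> m p r c
      = 8 * \<omega>^5 * (b * (1 + \<alpha> * r * c) * F + 3 * \<alpha> * p * (\<zeta> * \<eta>) * D) / (\<zeta> * \<eta>)^6"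
    unfolding f1 f2 by (simp only: diff_divide_distrib[symmetric] num)
  also have "b * (1 + \<alpha> * r * c) * F + 3 * \<alpha> * p * (\<zeta> * \<eta>) * D
      = (\<zeta> * \<eta>) * (9 * b * wronskian_poly (- b\<^sup>2) \<alpha> m p r c)"
    unfolding wronskian_poly_eq F_def D_def N_def N'_def \<omega>_def \<zeta>_def \<eta>_def by (simp add: algebra_simps)
  finally show ?thesis
    using assms unfolding \<omega>_def \<zeta>_def \<eta>_def by (simp add: eval_nat_numeral mult_ac)
qed

section \<open>The invariant for the accelerating Kerr-Newman metric\<close>

context carter_spacetime begin

lemma covector_inner_carter:
  assumes "x \<in> S" "p 1 = 0" "p 4 = 0"
  shows "covector_inner g x p p' = p 2 * p' 2 / G x 2 + p 3 * p' 3 / ((sin (x $ 3))\<^sup>2 * G x 3)"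
  unfolding covector_inner_def
  by (simp add: sum_4 assms inv_metric_eq[OF assms(1)] ev_def Let_def power2_eq_square mult_ac)

text \<open>Both gradients lie in the \<open>r\<close>, \<open>c\<close> plane, where the metric is
  diagonal, so their Gram determinant is the squared Jacobian over
  \<open>G x 2 * G x 3\<close>.\<close>

lemma Q2_carter:
  assumes "x \<in> S" "\<epsilon>\<^sup>2 = 1"
    and r: "r = x $ 2" and c: "c = cos (x $ 3)"
    and dX: "((\<lambda>r. Xw r c) has_real_derivative Xr) (at r)" "((\<lambda>c. Xw r c) has_real_derivative Xc) (at c)"
    and dZ: "((\<lambda>r. Zw r c) has_real_derivative Zr) (at r)" "((\<lambda>c. Zw r c) has_real_derivative Zc) (at c)"
    and t: "t = (Xw r c)\<^sup>2 + (Zw r c)\<^sup>2" "t > 0"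
  shows "(I1 g x)\<^sup>2 + (I2 \<epsilon> g x)\<^sup>2 = 144 * t\<^sup>2"
    and "Q2 \<epsilon> g x = 4 / 81 * (Q r * Y c / (R r c)\<^sup>2 * (Om r c)^4) * (Xr * Zc - Xc * Zr)\<^sup>2 / t^3"
proof -
  let ?X = "Xw r c" and ?Z = "Zw r c"
  note nz = S_nz[OF assms(1), folded r c]
  have sg2: "sg\<^sup>2 = 1" using sg by auto
  have "has_partial_deriv (\<lambda>x. 12 * ((Xw (x $ 2) (cos (x $ 3)))\<^sup>2 - (Zw (x $ 2) (cos (x $ 3)))\<^sup>2))
     (if i = 2 then 24 * (?X * Xr - ?Z * Zr) else if i = 3 then - sin (x $ 3) * (24 * (?X * Xc - ?Z * Zc)) else 0) i x" for i
    using dX dZ unfolding r c by (intro has_partial_deriv_rc) (auto intro!: derivative_eq_intros)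
  then have "has_partial_deriv (I1 g)
     (if i = 2 then 24 * (?X * Xr - ?Z * Zr) else if i = 3 then - sin (x $ 3) * (24 * (?X * Xc - ?Z * Zc)) else 0) i x" for i
    by (rule has_partial_deriv_cong[OF _ open_S assms(1)]) (simp add: I1_carter)
  note k = has_partial_deriv_imp[OF this]
  have "has_partial_deriv (\<lambda>x. 24 * \<epsilon> * sg * Xw (x $ 2) (cos (x $ 3)) * Zw (x $ 2) (cos (x $ 3)))
     (if i = 2 then 24 * \<epsilon> * sg * (Xr * ?Z + ?X * Zr)
      else if i = 3 then - sin (x $ 3) * (24 * \<epsilon> * sg * (Xc * ?Z + ?X * Zc)) else 0) i x" for i
    using dX dZ unfolding r c
    by (intro has_partial_deriv_rc) (auto intro!: derivative_eq_intros simp: algebra_simps)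
  then have "has_partial_deriv (I2 \<epsilon> g)
     (if i = 2 then 24 * \<epsilon> * sg * (Xr * ?Z + ?X * Zr)
      else if i = 3 then - sin (x $ 3) * (24 * \<epsilon> * sg * (Xc * ?Z + ?X * Zc)) else 0) i x" for i
    by (rule has_partial_deriv_cong[OF _ open_S assms(1)]) (simp add: I2_carter)
  note l = has_partial_deriv_imp[OF this]
  define k2 k3 l2 l3 where "k2 = 24 * (?X * Xr - ?Z * Zr)" and "k3 = 24 * (?X * Xc - ?Z * Zc)"
    and "l2 = 24 * \<epsilon> * sg * (Xr * ?Z + ?X * Zr)" and "l3 = 24 * \<epsilon> * sg * (Xc * ?Z + ?X * Zc)"
  have kl: "k_covector g x 1 = 0" "k_covector g x 4 = 0" "k_covector g x 2 = - k2" "k_covector g x 3 = sin (x $ 3) * k3"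
    "l_covector \<epsilon> g x 1 = 0" "l_covector \<epsilon> g x 4 = 0" "l_covector \<epsilon> g x 2 = - l2" "l_covector \<epsilon> g x 3 = sin (x $ 3) * l3"
    by (simp_all add: k_covector_def l_covector_def k l k2_def k3_def l2_def l3_def)
  have I567: "I5 g x = k2\<^sup>2 / G x 2 + k3\<^sup>2 / G x 3" "I6 \<epsilon> g x = l2\<^sup>2 / G x 2 + l3\<^sup>2 / G x 3"
    "I7 \<epsilon> g x = k2 * l2 / G x 2 + k3 * l3 / G x 3"
    using nz(5) unfolding I5_def I6_def I7_def
    by (simp_all add: covector_inner_carter[OF assms(1)] kl power2_eq_square)
  have gram: "I5 g x * I6 \<epsilon> g x - (I7 \<epsilon> g x)\<^sup>2 = (k2 * l3 - k3 * l2)\<^sup>2 / (G x 2 * G x 3)"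
    unfolding I567 using G_nz[OF assms(1)] by (simp add: field_simps power2_eq_square)
  \<comment> \<open>Up to the orientation sign, both gradient components are 24 times W times a
    derivative of W, and multiplication by W is a plane map of determinant |W|^2 =
    \<open>t\<close>.\<close>
  have J: "k2 * l3 - k3 * l2 = 576 * \<epsilon> * sg * (t * (Xr * Zc - Xc * Zr))"
    unfolding k2_def k3_def l2_def l3_def t by (simp add: algebra_simps power2_eq_square)
  have GG: "1 / (G x 2 * G x 3) = Q r * Y c / (R r c)\<^sup>2 * (Om r c)^4"
    using nz by (simp add: G_def G_rc_def carter_gram_def f_def e_def r[symmetric] c[symmetric] power2_eq_square power4_eq_xxxx)
  have "(I1 g x)\<^sup>2 + (I2 \<epsilon> g x)\<^sup>2 = 144 * (?X\<^sup>2 - ?Z\<^sup>2)\<^sup>2 + 576 * (\<epsilon>\<^sup>2 * sg\<^sup>2 * ?X\<^sup>2 * ?Z\<^sup>2)"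
    unfolding I1_carter[OF assms(1)] I2_carter[OF assms(1)] r c by (simp only: power_mult_distrib) simp
  also have "\<dots> = 144 * t\<^sup>2"
    unfolding sg2 assms(2) t by (simp add: algebra_simps power2_eq_square)
  finally show I12: "(I1 g x)\<^sup>2 + (I2 \<epsilon> g x)\<^sup>2 = 144 * t\<^sup>2" .
  \<comment> \<open>Positivity of \<open>t\<close> makes the half-integer power of the square an
    ordinary fifth power.\<close>
  have "(144 * t\<^sup>2) powr (5/2) = ((12 * t) powr 2) powr (5/2)"
    using t(2) by (simp add: power_mult_distrib)
  also have "\<dots> = (12 * t)^5"
    using t(2) unfolding powr_powr by simp
  also have "\<dots> = 248832 * t^5"
    by (simp add: power_mult_distrib)
  finally have powr: "(144 * t\<^sup>2) powr (5/2) = 248832 * t^5" .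
  have t5: "t^5 = t\<^sup>2 * t^3"
    by (simp add: power_add[symmetric])
  have t2: "t\<^sup>2 \<noteq> 0" using t(2) by simp
  \<comment> \<open>Here 331776 = 576^2 and 248832 = 12^5, with quotient 4/3.\<close>
  have cancel: "1/27 * ((331776 * p * j * u) / (248832 * (p * p'))) = 4 / 81 * u * j / p'" if "p \<noteq> 0" for p p' j u :: real
    using that by simp
  have fin: "1/27 * ((331776 * t\<^sup>2 * j * u) / (248832 * t^5)) = 4 / 81 * u * j / t^3" for j u
    unfolding t5 by (rule cancel[OF t2])
  have "Q2 \<epsilon> g x = 1/27 * (((k2 * l3 - k3 * l2)\<^sup>2 * (1 / (G x 2 * G x 3))) / (248832 * t^5))"
    unfolding Q2_def gram I12 powr by simp
  also have "(k2 * l3 - k3 * l2)\<^sup>2 = 331776 * t\<^sup>2 * (Xr * Zc - Xc * Zr)\<^sup>2"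
    unfolding J by (simp add: power_mult_distrib assms(2) sg2)
  finally show "Q2 \<epsilon> g x = 4 / 81 * (Q r * Y c / (R r c)\<^sup>2 * (Om r c)^4) * (Xr * Zc - Xc * Zr)\<^sup>2 / t^3"
    unfolding GG fin .
qed

end

section \<open>The metric functions and the closed form of the Weyl scalar\<close>

definition Q_fun1 :: "real \<Rightarrow> real \<Rightarrow> real \<Rightarrow> real \<Rightarrow> real \<Rightarrow> real \<Rightarrow> real" where
  "Q_fun1 a m q \<Lambda> \<alpha> r = (2 * r - 2 * m) * (1 - \<alpha>\<^sup>2 * r\<^sup>2)
     - 2 * \<alpha>\<^sup>2 * r * (a\<^sup>2 + q\<^sup>2 - 2 * m * r + r\<^sup>2) - \<Lambda> / 3 * (2 * a\<^sup>2 * r + 4 * r^3)"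

definition Q_fun2 :: "real \<Rightarrow> real \<Rightarrow> real \<Rightarrow> real \<Rightarrow> real \<Rightarrow> real \<Rightarrow> real" where
  "Q_fun2 a m q \<Lambda> \<alpha> r = 2 * (1 - \<alpha>\<^sup>2 * r\<^sup>2) - 4 * \<alpha>\<^sup>2 * r * (2 * r - 2 * m)
     - 2 * \<alpha>\<^sup>2 * (a\<^sup>2 + q\<^sup>2 - 2 * m * r + r\<^sup>2) - \<Lambda> / 3 * (2 * a\<^sup>2 + 12 * r\<^sup>2)"

definition P_poly :: "real \<Rightarrow> real \<Rightarrow> real \<Rightarrow> real \<Rightarrow> real \<Rightarrow> real \<Rightarrow> real" where
  "P_poly a m q \<Lambda> \<alpha> c = 1 - 2 * \<alpha> * m * c + (\<alpha>\<^sup>2 * (a\<^sup>2 + q\<^sup>2) + 1/3 * \<Lambda> * a\<^sup>2) * c\<^sup>2"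

definition P_poly1 :: "real \<Rightarrow> real \<Rightarrow> real \<Rightarrow> real \<Rightarrow> real \<Rightarrow> real \<Rightarrow> real" where
  "P_poly1 a m q \<Lambda> \<alpha> c = - 2 * \<alpha> * m + 2 * (\<alpha>\<^sup>2 * (a\<^sup>2 + q\<^sup>2) + 1/3 * \<Lambda> * a\<^sup>2) * c"

definition Y_fun where "Y_fun a m q \<Lambda> \<alpha> c = P_poly a m q \<Lambda> \<alpha> c * (1 - c\<^sup>2)"
definition Y_fun1 where
  "Y_fun1 a m q \<Lambda> \<alpha> c = P_poly1 a m q \<Lambda> \<alpha> c * (1 - c\<^sup>2) - 2 * c * P_poly a m q \<Lambda> \<alpha> c"
definition Y_fun2 where
  "Y_fun2 a m q \<Lambda> \<alpha> c = 2 * (\<alpha>\<^sup>2 * (a\<^sup>2 + q\<^sup>2) + 1/3 * \<Lambda> * a\<^sup>2) * (1 - c\<^sup>2)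
     - 4 * c * P_poly1 a m q \<Lambda> \<alpha> c - 2 * P_poly a m q \<Lambda> \<alpha> c"

lemma Q_fun_deriv:
  "(Q_fun a m q \<Lambda> \<alpha> has_real_derivative Q_fun1 a m q \<Lambda> \<alpha> r) (at r)"
  "(Q_fun1 a m q \<Lambda> \<alpha> has_real_derivative Q_fun2 a m q \<Lambda> \<alpha> r) (at r)"
  unfolding Q_fun_def[abs_def] Q_fun1_def[abs_def] Q_fun2_def
  by (auto intro!: derivative_eq_intros simp: algebra_simps power2_eq_square power3_eq_cube)

lemma Y_fun_deriv:
  "(Y_fun a m q \<Lambda> \<alpha> has_real_derivative Y_fun1 a m q \<Lambda> \<alpha> c) (at c)"
  "(Y_fun1 a m q \<Lambda> \<alpha> has_real_derivative Y_fun2 a m q \<Lambda> \<alpha> c) (at c)"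
  unfolding Y_fun_def[abs_def] Y_fun1_def[abs_def] Y_fun2_def P_poly_def P_poly1_def
  by (auto intro!: derivative_eq_intros simp: algebra_simps power2_eq_square add_divide_distrib diff_divide_distrib)

text \<open>The bracket of \<open>complex_weyl_scalar\<close> for the actual metric functions:
  \<open>\<Lambda>\<close> cancels and one factor Omega splits off, which joins the conformal weight
  to give the cube in \<open>W_fun\<close>.\<close>

lemma weyl_scalar_identity:
  fixes a m q \<Lambda> \<alpha> r c :: real
  defines "b \<equiv> \<i> * of_real a"
  shows "of_real (Q_fun2 a m q \<Lambda> \<alpha> r + Y_fun2 a m q \<Lambda> \<alpha> c) / 6 * (of_real r + b * of_real c)\<^sup>2
      - (of_real (Q_fun1 a m q \<Lambda> \<alpha> r) + b * of_real (Y_fun1 a m q \<Lambda> \<alpha> c)) * (of_real r + b * of_real c)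
      + 2 * of_real (Q_fun a m q \<Lambda> \<alpha> r - a\<^sup>2 * Y_fun a m q \<Lambda> \<alpha> c)
    = 2 * of_real (1 - \<alpha> * r * c) * W_num b (of_real \<alpha>) (of_real m) (of_real (q\<^sup>2)) (of_real r) (of_real c)"
proof -
  define L where "L = \<Lambda> / 3"
  then have L: "\<Lambda> = 3 * L" by simp
  \<comment> \<open>Clearing the 6, and the thirds through \<open>L\<close>, leaves a polynomial
    identity with integer coefficients.\<close>
  have cancel6: "S * z - 6 * T + 12 * U = 12 * V \<Longrightarrow> S / 6 * z - T + 2 * U = 2 * V" for S T U V z :: complex
    by (simp add: field_simps)
  show ?thesis
    unfolding mult.assoc[of 2 "of_real (1 - \<alpha> * r * c)"]
  proof (rule cancel6)
    show "of_real (Q_fun2 a m q \<Lambda> \<alpha> r + Y_fun2 a m q \<Lambda> \<alpha> c) * (of_real r + b * of_real c)\<^sup>2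
      - 6 * ((of_real (Q_fun1 a m q \<Lambda> \<alpha> r) + b * of_real (Y_fun1 a m q \<Lambda> \<alpha> c)) * (of_real r + b * of_real c))
      + 12 * of_real (Q_fun a m q \<Lambda> \<alpha> r - a\<^sup>2 * Y_fun a m q \<Lambda> \<alpha> c)
      = 12 * (of_real (1 - \<alpha> * r * c) * W_num b (of_real \<alpha>) (of_real m) (of_real (q\<^sup>2)) (of_real r) (of_real c))"
      unfolding Q_fun_def Q_fun1_def Q_fun2_def Y_fun_def Y_fun1_def Y_fun2_def P_poly_def P_poly1_def W_num_def L b_def
      by (simp add: algebra_simps power2_eq_square power3_eq_cube)
  qed
qed


lemma W_fun_real_deriv:
  fixes b \<alpha> m p :: complex and r c :: real
  assumes "of_real r + b * of_real c \<noteq> 0" "of_real r - b * of_real c \<noteq> 0"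
  defines "W \<equiv> \<lambda>r c. W_fun b \<alpha> m p (of_real r) (of_real c)"
    and "Wr \<equiv> W_r b \<alpha> m p (of_real r) (of_real c)" and "Wc \<equiv> W_c b \<alpha> m p (of_real r) (of_real c)"
  shows "((\<lambda>r. Re (W r c)) has_real_derivative Re Wr) (at r)" "((\<lambda>c. Re (W r c)) has_real_derivative Re Wc) (at c)"
    "((\<lambda>r. Im (W r c)) has_real_derivative Im Wr) (at r)" "((\<lambda>c. Im (W r c)) has_real_derivative Im Wc) (at c)"
proof -
  have "((\<lambda>r. W r c) has_vector_derivative Wr) (at r)" "((\<lambda>c. W r c) has_vector_derivative Wc) (at c)"
    unfolding W_def Wr_def Wc_def
    using W_fun_deriv[OF assms(1,2)] by (auto intro: has_vector_derivative_real_field)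
  note d = this
  show "((\<lambda>r. Re (W r c)) has_real_derivative Re Wr) (at r)" "((\<lambda>c. Re (W r c)) has_real_derivative Re Wc) (at c)"
    "((\<lambda>r. Im (W r c)) has_real_derivative Im Wr) (at r)" "((\<lambda>c. Im (W r c)) has_real_derivative Im Wc) (at c)"
    unfolding has_real_derivative_iff_has_vector_derivative
    using d by (auto intro: bounded_linear.has_vector_derivative[OF bounded_linear_Re]
        bounded_linear.has_vector_derivative[OF bounded_linear_Im])
qed

lemma W_cnj:
  assumes "cnj b = - b" "\<alpha> \<in> \<real>" "m \<in> \<real>" "p \<in> \<real>" "r \<in> \<real>" "c \<in> \<real>"
  shows "cnj (W_r b \<alpha> m p r c) = W_r (- b) \<alpha> m p r c" "cnj (W_c b \<alpha> m p r c) = W_c (- b) \<alpha> m p r c"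
    "cnj (W_num b \<alpha> m p r c) = W_num (- b) \<alpha> m p r c"
  using assms by (simp_all add: W_r_def W_c_def W_num_def Reals_cnj_iff)

context
  fixes a m q \<alpha> r c :: real and b :: complex
  assumes b: "b = \<i> * of_real a" and R: "r\<^sup>2 + a\<^sup>2 * c\<^sup>2 \<noteq> 0"
begin

lemma b_square: "b\<^sup>2 = - of_real (a\<^sup>2)"
  by (simp add: b power_mult_distrib)

lemma b_cnj: "cnj b = - b"
  by (simp add: b)

lemma zeta_mult_cnj:
  "(of_real r + b * of_real c) * (of_real r - b * of_real c) = of_real (r\<^sup>2 + a\<^sup>2 * c\<^sup>2)"
proof -
  have "(of_real r + b * of_real c) * (of_real r - b * of_real c) = (of_real r)\<^sup>2 - b\<^sup>2 * (of_real c)\<^sup>2"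
    by (simp add: algebra_simps power2_eq_square)
  then show ?thesis unfolding b_square by simp
qed

lemma zeta_nonzero: "of_real r + b * of_real c \<noteq> 0" "of_real r - b * of_real c \<noteq> 0"
proof -
  have "(of_real r + b * of_real c) * (of_real r - b * of_real c) \<noteq> 0"
    unfolding zeta_mult_cnj of_real_eq_0_iff by (rule R)
  then show "of_real r + b * of_real c \<noteq> 0" "of_real r - b * of_real c \<noteq> 0"
    by auto
qed

text \<open>The Jacobian of the real and imaginary parts is Im(conj W_r W_c), half the imaginary
  part of the Wronskian; hence 36 from 72.\<close>

lemma W_jacobian:
  fixes \<alpha>' m' p' r' c' :: complex
  defines "\<alpha>' \<equiv> of_real \<alpha>" and "m' \<equiv> of_real m" and "p' \<equiv> of_real (q\<^sup>2)" and "r' \<equiv> of_real r" and "c' \<equiv> of_real c"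
  shows "Re (W_r b \<alpha>' m' p' r' c') * Im (W_c b \<alpha>' m' p' r' c') - Re (W_c b \<alpha>' m' p' r' c') * Im (W_r b \<alpha>' m' p' r' c')
    = 36 * a * (1 - \<alpha> * r * c)^5 * wronskian_poly (a\<^sup>2) \<alpha> m (q\<^sup>2) r c / (r\<^sup>2 + a\<^sup>2 * c\<^sup>2)^5"
proof -
  let ?w = "1 - \<alpha> * r * c"
  let ?Wr = "W_r b \<alpha>' m' p' r' c'" and ?Wc = "W_c b \<alpha>' m' p' r' c'"
  have nz: "r' + b * c' \<noteq> 0" "r' - b * c' \<noteq> 0"
    unfolding r'_def c'_def by (fact zeta_nonzero)+
  have poly: "wronskian_poly (of_real (a\<^sup>2)) \<alpha>' m' p' r' c' = of_real (wronskian_poly (a\<^sup>2) \<alpha> m (q\<^sup>2) r c)"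
    by (simp add: wronskian_poly_def \<alpha>'_def m'_def p'_def r'_def c'_def)
  have cnj: "cnj ?Wr = W_r (- b) \<alpha>' m' p' r' c'" "cnj ?Wc = W_c (- b) \<alpha>' m' p' r' c'"
    by (rule W_cnj[OF b_cnj]; simp add: \<alpha>'_def m'_def p'_def r'_def c'_def)+
  have Im_i: "Im (of_real X * \<i>) = X" for X
    by simp
  have "cnj ?Wr * ?Wc - ?Wr * cnj ?Wc
      = 72 * b * (1 - \<alpha>' * r' * c')^5 * of_real (wronskian_poly (a\<^sup>2) \<alpha> m (q\<^sup>2) r c) / of_real (r\<^sup>2 + a\<^sup>2 * c\<^sup>2)^5"
    unfolding cnj W_wronskian[OF nz] b_square minus_minus poly zeta_mult_cnj[folded r'_def c'_def] ..
  also have "\<dots> = of_real (72 * a * ?w^5 * wronskian_poly (a\<^sup>2) \<alpha> m (q\<^sup>2) r c / (r\<^sup>2 + a\<^sup>2 * c\<^sup>2)^5) * \<i>"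
    unfolding b \<alpha>'_def r'_def c'_def by simp
  finally have "Im (cnj ?Wr * ?Wc - ?Wr * cnj ?Wc)
      = 72 * a * ?w^5 * wronskian_poly (a\<^sup>2) \<alpha> m (q\<^sup>2) r c / (r\<^sup>2 + a\<^sup>2 * c\<^sup>2)^5"
    by (simp only: Im_i)
  then have "2 * (Re ?Wr * Im ?Wc - Re ?Wc * Im ?Wr)
      = 2 * (36 * a * ?w^5 * wronskian_poly (a\<^sup>2) \<alpha> m (q\<^sup>2) r c / (r\<^sup>2 + a\<^sup>2 * c\<^sup>2)^5)"
    by (simp add: algebra_simps)
  then show ?thesis by simp
qed

text \<open>The denominator of \<open>W_fun\<close> has squared modulus R^4, because both of its
  linear factors have squared modulus R = r^2 + a^2 c^2.\<close>

lemma W_norm: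
  fixes \<alpha>' m' p' r' c' :: complex
  defines "\<alpha>' \<equiv> of_real \<alpha>" and "m' \<equiv> of_real m" and "p' \<equiv> of_real (q\<^sup>2)" and "r' \<equiv> of_real r" and "c' \<equiv> of_real c"
    and "base \<equiv> ((a^2 * m + q^2 * r)^2 * \<alpha>^2 + a^2 * m^2) * c^2
              + 2 * q^2 * \<alpha> * (a^2 * m - m * r^2 + q^2 * r) * c
              + r^2 * m^2 * \<alpha>^2 * a^2 + (m * r - q^2)^2"
  shows "(Re (W_fun b \<alpha>' m' p' r' c'))\<^sup>2 + (Im (W_fun b \<alpha>' m' p' r' c'))\<^sup>2
    = 4 * (1 - \<alpha> * r * c)^6 * base / (r\<^sup>2 + a\<^sup>2 * c\<^sup>2)^4"
proof -
  let ?w = "1 - \<alpha>' * r' * c'" and ?n = "W_num b \<alpha>' m' p' r' c'" and ?W = "W_fun b \<alpha>' m' p' r' c'"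
  let ?z = "r' + b * c'" and ?y = "r' - b * c'"
  have cn: "cnj ?n = W_num (- b) \<alpha>' m' p' r' c'"
    by (rule W_cnj[OF b_cnj]; simp add: \<alpha>'_def m'_def p'_def r'_def c'_def)+
  have n: "?n * cnj ?n = of_real base"
    unfolding cn W_num_norm b_square by (simp add: base_def \<alpha>'_def m'_def p'_def r'_def c'_def)
  have cc: "cnj ?w = ?w" "cnj ?z = ?y" "cnj ?y = ?z"
    by (simp_all add: b_cnj \<alpha>'_def m'_def p'_def r'_def c'_def)
  have prod: "2 * w^3 * n / (z^3 * y) * (2 * w^3 * n' / (y^3 * z)) = 4 * w^6 * (n * n') / (z * y)^4" for w n z y n' :: complex
    by (simp add: eval_nat_numeral mult_ac)
  have "?W * cnj ?W = 4 * ?w^6 * (?n * cnj ?n) / (?z * ?y)^4"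
    unfolding prod[symmetric] W_fun_def by (simp only: complex_cnj_divide complex_cnj_mult complex_cnj_power cc complex_cnj_numeral)
  also have "\<dots> = of_real (4 * (1 - \<alpha> * r * c)^6 * base / (r\<^sup>2 + a\<^sup>2 * c\<^sup>2)^4)"
    unfolding n zeta_mult_cnj[folded r'_def c'_def] by (simp add: \<alpha>'_def r'_def c'_def)
  finally have "Re (?W * cnj ?W) = 4 * (1 - \<alpha> * r * c)^6 * base / (r\<^sup>2 + a\<^sup>2 * c\<^sup>2)^4"
    by (simp only: Re_complex_of_real)
  then show ?thesis by (simp add: power2_eq_square)
qed

end


section \<open>Identification of the metric with Carter's form\<close>

lemma accel_KN_metric_nth:
  fixes x :: "real^4"
  defines "r \<equiv> x $ 2" and "\<theta> \<equiv> x $ 3"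
  shows "accel_KN_metric a m q \<Lambda> \<alpha> x $ i $ j = 1 / (conf_factor \<alpha> r \<theta>)\<^sup>2 *
    (let w1 = axis 1 1 - (a * (sin \<theta>)\<^sup>2) *\<^sub>R axis 4 1; w4 = a *\<^sub>R axis 1 1 - (r\<^sup>2 + a\<^sup>2) *\<^sub>R axis 4 1 :: real^4;
         w2 = axis 2 1; w3 = axis 3 1 in
     - (Q_fun a m q \<Lambda> \<alpha> r / rho_sq a r \<theta>) * (w1 $ i * w1 $ j)
     + rho_sq a r \<theta> / Q_fun a m q \<Lambda> \<alpha> r * (w2 $ i * w2 $ j)
     + rho_sq a r \<theta> / P_fun a m q \<Lambda> \<alpha> \<theta> * (w3 $ i * w3 $ j)
     + P_fun a m q \<Lambda> \<alpha> \<theta> / rho_sq a r \<theta> * (sin \<theta>)\<^sup>2 * (w4 $ i * w4 $ j))"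
  unfolding accel_KN_metric_def Let_def tensor_square_def r_def \<theta>_def by simp

text \<open>Fixing the sign of sin theta keeps the set open and the orientation of the coframe
  constant, so a single formula for \<open>I2\<close> can be differentiated on it.\<close>

definition regular_domain :: "real \<Rightarrow> real \<Rightarrow> real \<Rightarrow> real \<Rightarrow> real \<Rightarrow> real \<Rightarrow> (real^4) set" where
  "regular_domain sg a m q \<Lambda> \<alpha> = {x. sg * sin (x $ 3) > 0 \<and> conf_factor \<alpha> (x $ 2) (x $ 3) > 0
     \<and> rho_sq a (x $ 2) (x $ 3) \<noteq> 0 \<and> Q_fun a m q \<Lambda> \<alpha> (x $ 2) \<noteq> 0 \<and> P_fun a m q \<Lambda> \<alpha> (x $ 3) > 0}"

lemma open_regular_domain: "open (regular_domain sg a m q \<Lambda> \<alpha>)"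
  unfolding regular_domain_def conf_factor_def rho_sq_def Q_fun_def P_fun_def
  by (intro open_Collect_conj open_Collect_less open_Collect_neq continuous_intros)

lemma Y_fun_cos: "Y_fun a m q \<Lambda> \<alpha> (cos \<theta>) = P_fun a m q \<Lambda> \<alpha> \<theta> * (sin \<theta>)\<^sup>2"
  by (simp add: Y_fun_def P_poly_def P_fun_def sin_squared_eq)

lemma accel_KN_carter_metric:
  assumes "sg = 1 \<or> sg = -1"
  shows "carter_metric a \<alpha> sg (Q_fun a m q \<Lambda> \<alpha>) (Q_fun1 a m q \<Lambda> \<alpha>) (Q_fun2 a m q \<Lambda> \<alpha>)
    (Y_fun a m q \<Lambda> \<alpha>) (Y_fun1 a m q \<Lambda> \<alpha>) (Y_fun2 a m q \<Lambda> \<alpha>) (regular_domain sg a m q \<Lambda> \<alpha>)"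
proof unfold_locales
  fix x assume "x \<in> regular_domain sg a m q \<Lambda> \<alpha>"
  then show "0 < sg * sin (x $ 3) \<and> 1 - \<alpha> * x $ 2 * cos (x $ 3) \<noteq> 0 \<and> (x $ 2)\<^sup>2 + a\<^sup>2 * (cos (x $ 3))\<^sup>2 \<noteq> 0
      \<and> Q_fun a m q \<Lambda> \<alpha> (x $ 2) \<noteq> 0 \<and> Y_fun a m q \<Lambda> \<alpha> (cos (x $ 3)) \<noteq> 0"
    unfolding Y_fun_cos by (auto simp: regular_domain_def conf_factor_def rho_sq_def)
qed (use assms in \<open>auto intro: Q_fun_deriv Y_fun_deriv open_regular_domain\<close>)

text \<open>The coefficient R/Y of dc^2 turns into R/P for dtheta^2, since dc^2 carries the sin^2
  contained in Y = P sin^2; in the fourth term that factor stays.\<close>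

lemma accel_KN_carter_spacetime:
  assumes "sg = 1 \<or> sg = -1"
  shows "carter_spacetime a \<alpha> sg (Q_fun a m q \<Lambda> \<alpha>) (Q_fun1 a m q \<Lambda> \<alpha>) (Q_fun2 a m q \<Lambda> \<alpha>)
    (Y_fun a m q \<Lambda> \<alpha>) (Y_fun1 a m q \<Lambda> \<alpha>) (Y_fun2 a m q \<Lambda> \<alpha>) (accel_KN_metric a m q \<Lambda> \<alpha>)
    (regular_domain sg a m q \<Lambda> \<alpha>)"
proof -
  interpret carter_metric a \<alpha> sg "Q_fun a m q \<Lambda> \<alpha>" "Q_fun1 a m q \<Lambda> \<alpha>" "Q_fun2 a m q \<Lambda> \<alpha>"
    "Y_fun a m q \<Lambda> \<alpha>" "Y_fun1 a m q \<Lambda> \<alpha>" "Y_fun2 a m q \<Lambda> \<alpha>" "accel_KN_metric a m q \<Lambda> \<alpha>"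
    "regular_domain sg a m q \<Lambda> \<alpha>"
    using assms by (rule accel_KN_carter_metric)
  show ?thesis
  proof unfold_locales
    fix x i j assume x: "x \<in> regular_domain sg a m q \<Lambda> \<alpha>"
    define c s where "c = cos (x $ 3)" and "s = sin (x $ 3)"
    have P: "P_fun a m q \<Lambda> \<alpha> (x $ 3) \<noteq> 0" "s \<noteq> 0"
      using x by (auto simp: regular_domain_def s_def)
    have eq: "Om (x $ 2) c = conf_factor \<alpha> (x $ 2) (x $ 3)" "R (x $ 2) c = rho_sq a (x $ 2) (x $ 3)"
      "Y_fun a m q \<Lambda> \<alpha> c = P_fun a m q \<Lambda> \<alpha> (x $ 3) * s\<^sup>2" "1 - c\<^sup>2 = s\<^sup>2"
      by (simp_all add: Om_def conf_factor_def R_def rho_sq_def c_def s_def Y_fun_cos sin_squared_eq)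
    have "(\<Sum>A\<in>UNIV. G x A * (th x A i * th x A j)) = 1 / (conf_factor \<alpha> (x $ 2) (x $ 3))\<^sup>2 *
        (\<Sum>A\<in>UNIV. carter_gram (f (x $ 2) c) (e (x $ 2) c) A * (th x A i * th x A j))"
      by (simp add: sum_distrib_left G_def G_rc_def c_def[symmetric] eq)
    then show "accel_KN_metric a m q \<Lambda> \<alpha> x $ i $ j = (\<Sum>A\<in>UNIV. G x A * (th x A i * th x A j))"
      using exhaust_4[of i] exhaust_4[of j] P
      unfolding accel_KN_metric_nth carter_gram_def f_def e_def th_def Let_def
        c_def[symmetric] s_def[symmetric] eq
      by (elim disjE) (simp_all add: sum_4 axis_def power2_eq_square algebra_simps
          add_divide_distrib diff_divide_distrib)
  qed
qed

text \<open>The pieces of \<open>Xw\<close> and \<open>Zw\<close> are, up to sign, the real and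
  imaginary parts of \<open>T * \<eta>\<close> and \<open>\<eta>\<^sup>2\<close>. With R =
  \<open>\<zeta> * \<eta>\<close> the bracket then depends on \<open>\<zeta>\<close> alone.\<close>

lemma (in carter_spacetime) complex_weyl_scalar:
  fixes r c :: real
  defines "b \<equiv> \<i> * complex_of_real a"
  shows "of_real (Xw r c) + \<i> * of_real (Zw r c) = (of_real (Om r c))\<^sup>2 *
     (of_real (Q'' r + Y'' c) / 6 * (of_real r + b * of_real c)\<^sup>2
      - (of_real (Q' r) + b * of_real (Y' c)) * (of_real r + b * of_real c) + 2 * of_real (Q r - a\<^sup>2 * Y c))
     / ((of_real r + b * of_real c)^3 * (of_real r - b * of_real c))"
proof -
  define \<zeta> \<eta> where "\<zeta> = of_real r + b * of_real c" and "\<eta> = of_real r - b * of_real c"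
  define S' T U where "S' = complex_of_real (Q'' r + Y'' c)" and "T = of_real (Q' r) + b * of_real (Y' c)"
    and "U = complex_of_real (Q r - a\<^sup>2 * Y c)"
  let ?w = "(complex_of_real (Om r c))\<^sup>2" and ?R = "complex_of_real (R r c)"
  have R: "?R = \<zeta> * \<eta>"
    by (simp add: R_def \<zeta>_def \<eta>_def b_def algebra_simps power2_eq_square)
  have T: "T * \<eta> = of_real (r * Q' r + a\<^sup>2 * c * Y' c) - \<i> * of_real (a * (c * Q' r - r * Y' c))"
    by (simp add: T_def \<eta>_def b_def algebra_simps power2_eq_square)
  have E: "\<eta>\<^sup>2 = of_real (r\<^sup>2 - a\<^sup>2 * c\<^sup>2) - \<i> * of_real (2 * a * r * c)"
    by (simp add: \<eta>_def b_def algebra_simps power2_eq_square)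
  have "of_real (Xw r c) + \<i> * of_real (Zw r c) = ?w * ((S' / 6 - T * \<eta> / ?R + 2 * U * \<eta>\<^sup>2 / ?R\<^sup>2) / ?R)"
    unfolding Xw_def Zw_def T E S'_def U_def
    by (simp add: algebra_simps add_divide_distrib diff_divide_distrib)
  also have "\<dots> = ?w * (S' / 6 * \<zeta>\<^sup>2 - T * \<zeta> + 2 * U) / (\<zeta>^3 * \<eta>)"
  \<comment> \<open>Where a factor vanishes, both sides are 0 by the convention for division by
    zero. The identity thus holds for all \<open>r\<close> and \<open>c\<close> and gives an
    equality of functions.\<close>
  proof (cases "\<zeta> = 0 \<or> \<eta> = 0")
    case False
    then show ?thesis
      unfolding R by (simp add: field_simps power2_eq_square power3_eq_cube)
  qed (auto simp: R)
  finally show ?thesis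
    unfolding \<zeta>_def \<eta>_def S'_def T_def U_def .
qed

theorem theorem54:
  fixes a m q \<Lambda> \<alpha> \<epsilon> t r \<theta> \<phi> :: real
  assumes "\<epsilon> = 1 \<or> \<epsilon> = -1"
    and "conf_factor \<alpha> r \<theta> > 0"
    and "rho_sq a r \<theta> \<noteq> 0"
    and "Q_fun a m q \<Lambda> \<alpha> r \<noteq> 0"
    and "P_fun a m q \<Lambda> \<alpha> \<theta> > 0"
    and "sin \<theta> \<noteq> 0"
    and "(I1 (accel_KN_metric a m q \<Lambda> \<alpha>) (vector [t, r, \<theta>, \<phi>]))\<^sup>2
         + (I2 \<epsilon> (accel_KN_metric a m q \<Lambda> \<alpha>) (vector [t, r, \<theta>, \<phi>]))\<^sup>2 \<noteq> 0"
  shows "Q2 \<epsilon> (accel_KN_metric a m q \<Lambda> \<alpha>) (vector [t, r, \<theta>, \<phi>]) =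
    (let c = cos \<theta>;
         A = (\<alpha> * r * c - 1)^4 *
             (((a^2 * m + q^2 * r)^2 * \<alpha>^2 + a^2 * m^2) * c^2
              + 2 * q^2 * \<alpha> * (a^2 * m - m * r^2 + q^2 * r) * c
              + r^2 * m^2 * \<alpha>^2 * a^2 + (m * r - q^2)^2)^3
     in (-1) / A *
        (\<alpha> * ((a^4 * m^2 * r + 2 * a^2 * m * q^2 * r^2 + 8/9 * q^4 * r^3) * \<alpha>^2
              + a^2 * m * (m * r - 2 * q^2 / 3)) * c^3
         + ((a^4 * m^2 + 2 * a^2 * m * q^2 * r - 2 * m * q^2 * r^3 + 16/9 * q^4 * r^2) * \<alpha>^2
            + a^2 * m^2) * c^2
         + \<alpha> * (a^2 * \<alpha>^2 * m^2 * r^3 + 2 * a^2 * m * q^2 + r^3 * m^2 - 2 * m * q^2 * r^2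
                + 16/9 * q^4 * r) * c
         + m * r^2 * (a^2 * m + 2 * q^2 * r / 3) * \<alpha>^2
         + r^2 * m^2 - 2 * m * q^2 * r + 8 * q^4 / 9)^2
        * (r^2 * (a^2 - 2 * m * r + q^2 + r^2) * \<alpha>^2 + \<Lambda> * r^4 / 3
           + (\<Lambda> * a^2 / 3 - 1) * r^2 + 2 * m * r - a^2 - q^2)
        * (a^2 * (sin \<theta>)^2
           * (1 - 2 * \<alpha> * m * c + (\<alpha>^2 * (a^2 + q^2) + \<Lambda> * a^2 / 3) * c^2)))"
proof -
  define x :: "real^4" where "x = vector [t, r, \<theta>, \<phi>]"
  define c where "c = cos \<theta>"
  define sg where "sg = sgn (sin \<theta>)"
  have sg: "sg = 1 \<or> sg = -1" "sg * sin \<theta> > 0"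
    using assms(6) by (auto simp: sg_def sgn_if)
  define g where "g = accel_KN_metric a m q \<Lambda> \<alpha>"
  define S where "S = regular_domain sg a m q \<Lambda> \<alpha>"
  have x: "x $ 2 = r" "x $ 3 = \<theta>"
    by (simp_all add: x_def)
  have "x \<in> S"
    using assms sg(2) by (simp add: S_def regular_domain_def x)
  interpret carter_spacetime a \<alpha> sg "Q_fun a m q \<Lambda> \<alpha>" "Q_fun1 a m q \<Lambda> \<alpha>" "Q_fun2 a m q \<Lambda> \<alpha>"
    "Y_fun a m q \<Lambda> \<alpha>" "Y_fun1 a m q \<Lambda> \<alpha>" "Y_fun2 a m q \<Lambda> \<alpha>" g S
    unfolding g_def S_def using sg(1) by (rule accel_KN_carter_spacetime)
  define b where "b = \<i> * complex_of_real a"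
  define W where "W r c = W_fun b (of_real \<alpha>) (of_real m) (of_real (q\<^sup>2)) (of_real r) (of_real c)" for r c :: real
  define Wr Wc where "Wr = W_r b (of_real \<alpha>) (of_real m) (of_real (q\<^sup>2)) (of_real r) (of_real c)"
    and "Wc = W_c b (of_real \<alpha>) (of_real m) (of_real (q\<^sup>2)) (of_real r) (of_real c)"
  have "of_real (Xw r c) + \<i> * of_real (Zw r c) = W r c" for r c
    using complex_weyl_scalar[of r c] weyl_scalar_identity[of a m q \<Lambda> \<alpha> r c]
    unfolding b_def[symmetric] W_def W_fun_def Om_def
    by (simp only:) (simp add: eval_nat_numeral mult_ac)
  then have XZ: "Xw = (\<lambda>r c. Re (W r c))" "Zw = (\<lambda>r c. Im (W r c))"
    by (simp_all add: fun_eq_iff complex_eq_iff)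
  have R: "r\<^sup>2 + a\<^sup>2 * c\<^sup>2 \<noteq> 0"
    using assms(3) by (simp add: rho_sq_def c_def)
  note nz = zeta_nonzero[OF b_def R]
  note dW = W_fun_real_deriv[OF nz, of "of_real \<alpha>" "of_real m" "of_real (q\<^sup>2)", folded W_def Wr_def Wc_def]
  define N where "N = wronskian_poly (a\<^sup>2) \<alpha> m (q\<^sup>2) r c"
  define B where "B = ((a^2 * m + q^2 * r)^2 * \<alpha>^2 + a^2 * m^2) * c^2
              + 2 * q^2 * \<alpha> * (a^2 * m - m * r^2 + q^2 * r) * c
              + r^2 * m^2 * \<alpha>^2 * a^2 + (m * r - q^2)^2"
  define w \<rho> where "w = 1 - \<alpha> * r * c" and "\<rho> = r\<^sup>2 + a\<^sup>2 * c\<^sup>2"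
  have w: "w \<noteq> 0" and \<rho>: "\<rho> \<noteq> 0"
    using assms(2) R by (simp_all add: w_def \<rho>_def conf_factor_def c_def)
  define T where "T = (Xw r c)\<^sup>2 + (Zw r c)\<^sup>2"
  have T: "T = 4 * w^6 * B / \<rho>^4"
    unfolding T_def XZ W_def B_def w_def \<rho>_def by (rule W_norm[OF b_def R])
  have eps: "\<epsilon>\<^sup>2 = 1" using assms(1) by auto
  \<comment> \<open>This translates the hypothesis on \<open>I1\<close> and \<open>I2\<close>;
    through the formula for \<open>T\<close> it also yields \<open>B \<noteq> 0\<close>.\<close>
  have "T \<noteq> 0"
  proof
    assume "T = 0"
    then have "Xw r c = 0" "Zw r c = 0"
      unfolding T_def by (simp_all add: sum_power2_eq_zero_iff)
    then have "I1 g x = 0" "I2 \<epsilon> g x = 0"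
      by (simp_all add: I1_carter[OF \<open>x \<in> S\<close>] I2_carter[OF \<open>x \<in> S\<close>] x c_def)
    then show False
      using assms(7) by (simp add: g_def x_def)
  qed
  then have "T > 0" unfolding T_def by (simp add: order_le_neq_trans)
  have J: "Re Wr * Im Wc - Re Wc * Im Wr = 36 * a * w^5 * N / \<rho>^5"
    unfolding Wr_def Wc_def w_def \<rho>_def N_def by (rule W_jacobian[OF b_def R])
  have "Q2 \<epsilon> g x = 4 / 81 * (Q_fun a m q \<Lambda> \<alpha> r * Y_fun a m q \<Lambda> \<alpha> c / (R r c)\<^sup>2 * (Om r c)^4)
      * (Re Wr * Im Wc - Re Wc * Im Wr)\<^sup>2 / T^3"
    using x dW \<open>T > 0\<close>
    by (intro Q2_carter(2)[OF \<open>x \<in> S\<close> eps]) (simp_all add: c_def XZ T_def)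
  also have "\<dots> = N\<^sup>2 * Q_fun a m q \<Lambda> \<alpha> r * a\<^sup>2 * Y_fun a m q \<Lambda> \<alpha> c / (w^4 * B^3)"
  proof -
    have "B \<noteq> 0" using \<open>T > 0\<close> T by auto
    \<comment> \<open>Since 36^2 / 4^3 = 81/4, this cancels the 4/81 of \<open>Q2_carter\<close>;
      the exponents of \<open>\<rho>\<close> are -10 + 12 - 2 = 0.\<close>
    have key: "(36 * a * w^5 * N / \<rho>^5)\<^sup>2 / (4 * w^6 * B / \<rho>^4)^3 * w^4 / \<rho>\<^sup>2 = 81 / 4 * (a\<^sup>2 * N\<^sup>2 / (w^4 * B^3))"
      using w \<rho> \<open>B \<noteq> 0\<close>
      by (simp add: power_divide power_mult_distrib power_mult[symmetric] field_simps power_add[symmetric])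
    have reorder: "4 / 81 * (y1 * y2 / \<rho>\<^sup>2 * w^4) * j / v = 4 / 81 * (y1 * y2) * (j / v * w^4 / \<rho>\<^sup>2)" for y1 y2 j v
      by (simp add: mult_ac)
    have RO: "R r c = \<rho>" "Om r c = w"
      by (simp_all add: R_def Om_def w_def \<rho>_def)
    show ?thesis
      unfolding J T RO reorder key by (simp add: mult_ac)
  qed
  finally have Q2: "Q2 \<epsilon> g x = N\<^sup>2 * Q_fun a m q \<Lambda> \<alpha> r * a\<^sup>2 * Y_fun a m q \<Lambda> \<alpha> c / (w^4 * B^3)" .
  have "\<alpha> * r * c - 1 = - w" by (simp add: w_def)
  then have A: "(\<alpha> * r * c - 1)^4 = w^4" by simp
  have poly: "\<alpha> * ((a^4 * m^2 * r + 2 * a^2 * m * q^2 * r^2 + 8/9 * q^4 * r^3) * \<alpha>^2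
              + a^2 * m * (m * r - 2 * q^2 / 3)) * c^3
         + ((a^4 * m^2 + 2 * a^2 * m * q^2 * r - 2 * m * q^2 * r^3 + 16/9 * q^4 * r^2) * \<alpha>^2
            + a^2 * m^2) * c^2
         + \<alpha> * (a^2 * \<alpha>^2 * m^2 * r^3 + 2 * a^2 * m * q^2 + r^3 * m^2 - 2 * m * q^2 * r^2
                + 16/9 * q^4 * r) * c
         + m * r^2 * (a^2 * m + 2 * q^2 * r / 3) * \<alpha>^2
         + r^2 * m^2 - 2 * m * q^2 * r + 8 * q^4 / 9 = N"
    by (simp add: N_def wronskian_poly_def power_mult[symmetric])
  \<comment> \<open>The bracket in the theorem is minus the metric function, which accounts for the
    leading -1.\<close>
  have Q: "r^2 * (a^2 - 2 * m * r + q^2 + r^2) * \<alpha>^2 + \<Lambda> * r^4 / 3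
           + (\<Lambda> * a^2 / 3 - 1) * r^2 + 2 * m * r - a^2 - q^2 = - Q_fun a m q \<Lambda> \<alpha> r"
    by (simp add: Q_fun_def field_simps power2_eq_square power4_eq_xxxx)
  have Y: "(sin \<theta>)^2 * (1 - 2 * \<alpha> * m * c + (\<alpha>^2 * (a^2 + q^2) + \<Lambda> * a^2 / 3) * c^2)
      = Y_fun a m q \<Lambda> \<alpha> c"
    unfolding c_def Y_fun_cos by (simp add: P_fun_def mult.commute)
  show ?thesis
    unfolding Let_def x_def[symmetric] g_def[symmetric] c_def[symmetric] B_def[symmetric] A Q2 poly Q
      mult.assoc[of "a^2" "(sin \<theta>)^2"] Y
    by simp
qed

end
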